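(* Let $m\ge1$. For each $r=0,1,2,\dots$, the Koornwinder polynomial attached to the row $(r)$ satisfies $$\frac{\langle t\rangle_{q,r}}{\langle q\rangle_{q,r}}P_{(r)}(z;a,b,c,d|q,t)=\frac{\langle t^m,\,t^{m-1}ab,\,t^{m-1}ac,\,t^{m-1}ad\rangle_{q,r}}{\langle q,\,t^{2(m-1)}abcdq^{r-1}\rangle_{q,r}}\sum_{l=0}^{r}\frac{(-1)^l\langle q^{-r},\,t^{2(m-1)}abcdq^{r-1}\rangle_{q,l}}{\langle t^m,\,t^{m-1}ab,\,t^{m-1}ac,\,t^{m-1}ad\rangle_{q,l}}\,H_l(z;a|q,t),$$ where, for $l=0,1,2,\dots$, $$H_l(z;a|q,t)=\sum_{\substack{\nu_1,\dots,\nu_m\ge0\\ \nu_1+\cdots+\nu_m=l}}\;\prod_{j=1}^{m}\frac{\langle t\rangle_{q,\nu_j}}{\langle q\rangle_{q,\nu_j}}\,\big\langle z_j;\,t^{j-1}q^{\nu_1+\cdots+\nu_{j-1}}a\big\rangle_{q,\nu_j}.$$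
   Context: Notation: $\langle z\rangle=z^{1/2}-z^{-1/2}$; $\langle z;w\rangle=\langle zw\rangle\langle z/w\rangle=z+z^{-1}-w-w^{-1}$; $\langle u\rangle_{q,l}=\langle u\rangle\langle qu\rangle\cdots\langle q^{l-1}u\rangle$; $\langle u_1,\dots,u_k\rangle_{q,l}=\langle u_1\rangle_{q,l}\cdots\langle u_k\rangle_{q,l}$; $\langle z;u\rangle_{q,l}=\langle z;u\rangle\langle z;qu\rangle\cdots\langle z;q^{l-1}u\rangle$. $\mathbb{K}=\mathbb{Q}(a^{1/2},b^{1/2},c^{1/2},d^{1/2},q^{1/2},t^{1/2})$ is the field of rational functions in indeterminates (the square roots of the parameters); square roots of monomials in the parameters are the corresponding monomials in these indeterminates. $z=(z_1,\dots,z_m)$ and $W=\{\pm1\}^m\rtimes\mathfrak{S}_m$ acts on $\mathbb{K}[z_1^{\pm1},\dots,z_m^{\pm1}]$ by permuting and inverting the variables. Koornwinder's $q$-difference operator is $$\mathcal{D}_z=\sum_{i=1}^{m}\mathcal{A}_i^{+}(z)(T_{q,z_i}-1)+\sum_{i=1}^{m}\mathcal{A}_i^{-}(z)(T_{q,z_i}^{-1}-1),$$ $$\mathcal{A}_i^{+}(z)=\frac{(1-az_i)(1-bz_i)(1-cz_i)(1-dz_i)}{(abcdq^{-1})^{1/2}t^{m-1}(1-z_i^2)(1-qz_i^2)}\prod_{j\ne i}\frac{(1-tz_iz_j)(1-tz_iz_j^{-1})}{(1-z_iz_j)(1-z_iz_j^{-1})},\qquad \mathcal{A}_i^{-}(z)=\mathcal{A}_i^{+}(z^{-1}),$$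 where $T_{q,z_i}$ replaces $z_i$ by $qz_i$ and $z^{-1}=(z_1^{-1},\dots,z_m^{-1})$. For a partition $\lambda=(\lambda_1\ge\cdots\ge\lambda_m\ge0)$, the Koornwinder polynomial $P_\lambda(z)=P_\lambda(z;a,b,c,d|q,t)$ is the unique $W$-invariant Laurent polynomial in $\mathbb{K}[z^{\pm1}]$ such that (i) $P_\lambda=m_\lambda+\sum_{\mu<\lambda}c_{\lambda,\mu}m_\mu$ with $c_{\lambda,\mu}\in\mathbb{K}$, where $m_\mu(z)=\sum_{\nu\in W\mu}z^\nu$ is the orbit sum and $\mu\le\lambda$ is the dominance ordering ($\mu_1+\cdots+\mu_i\le\lambda_1+\cdots+\lambda_i$ for all $i=1,\dots,m$, with no equality of total weights required); (ii) $\mathcal{D}_zP_\lambda=d_\lambda P_\lambda$ for some $d_\lambda\in\mathbb{K}$. $P_{(r)}$ is $P_\lambda$ for $\lambda=(r,0,\dots,0)$. *)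

theory Defs
  imports
    "HOL-Library.Poly_Mapping"
    "HOL-Library.FuncSet"
    "HOL-Combinatorics.Permutations"
    "HOL-Computational_Algebra.Polynomial_Factorial"
begin

section \<open>The field of parameters\<close>

text \<open>The six polynomial layers adjoin the square roots of \<open>t, q, d, c, b, a\<close>, the root of
  \<open>t\<close> being the innermost indeterminate and the root of \<open>a\<close> the outermost.\<close>

type_synonym pring = "rat poly poly poly poly poly poly"
type_synonym pfield = "pring fract"

definition a_half :: pfield where "a_half = to_fract [:0, 1:]"
definition b_half :: pfield where "b_half = to_fract [:[:0, 1:]:]"
definition c_half :: pfield where "c_half = to_fract [:[:[:0, 1:]:]:]"
definition d_half :: pfield where "d_half = to_fract [:[:[:[:0, 1:]:]:]:]"
definition q_half :: pfield where "q_half = to_fract [:[:[:[:[:0, 1:]:]:]:]:]"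
definition t_half :: pfield where "t_half = to_fract [:[:[:[:[:[:0, 1:]:]:]:]:]:]"

definition par_a :: pfield where "par_a = a_half ^ 2"
definition par_b :: pfield where "par_b = b_half ^ 2"
definition par_c :: pfield where "par_c = c_half ^ 2"
definition par_d :: pfield where "par_d = d_half ^ 2"
definition par_q :: pfield where "par_q = q_half ^ 2"
definition par_t :: pfield where "par_t = t_half ^ 2"

definition half_monomial :: "pfield \<Rightarrow> bool" where
  "half_monomial s \<longleftrightarrow> (\<exists>i j k l m n :: int.
     s = a_half powi i * b_half powi j * c_half powi k *
         d_half powi l * q_half powi m * t_half powi n)"

text \<open>Of the two square roots \<open>s\<close>, \<open>-s\<close> of a monomial in the parameters only one is a monomial
  with coefficient 1; see \<open>msqrt_power2\<close> below. Only used for such arguments.\<close>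

definition msqrt :: "pfield \<Rightarrow> pfield" where
  "msqrt u = (THE s. half_monomial s \<and> s ^ 2 = u)"

definition ang :: "pfield \<Rightarrow> pfield" where
  "ang u = msqrt u - inverse (msqrt u)"

definition ang_fact :: "pfield \<Rightarrow> nat \<Rightarrow> pfield" where
  "ang_fact u l = (\<Prod>k<l. ang (par_q ^ k * u))"

definition ang_facts :: "pfield list \<Rightarrow> nat \<Rightarrow> pfield" where
  "ang_facts us l = (\<Prod>u\<leftarrow>us. ang_fact u l)"


section \<open>Laurent polynomials\<close>

text \<open>A monomial \<open>z\<^sup>\<nu>\<close> is given by its exponent vector; the variables are \<open>z\<^sub>1, z\<^sub>2, \<dots>\<close>, and
  \<open>laurent_in m\<close> singles out the ring of Laurent polynomials in \<open>z\<^sub>1, \<dots>, z\<^sub>m\<close>.\<close>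

type_synonym expvec = "nat \<Rightarrow>\<^sub>0 int"
type_synonym laurent = "expvec \<Rightarrow>\<^sub>0 pfield"
type_synonym lfield = "laurent fract"

definition laurent_in :: "nat \<Rightarrow> laurent \<Rightarrow> bool" where
  "laurent_in m P \<longleftrightarrow> (\<forall>\<nu>\<in>Poly_Mapping.keys P. Poly_Mapping.keys \<nu> \<subseteq> {1..m})"

definition lconst :: "pfield \<Rightarrow> laurent" where
  "lconst c = Poly_Mapping.single 0 c"

definition zvar :: "nat \<Rightarrow> laurent" where
  "zvar j = Poly_Mapping.single (Poly_Mapping.single j 1) 1"

definition zinv :: "nat \<Rightarrow> laurent" where
  "zinv j = Poly_Mapping.single (Poly_Mapping.single j (-1)) 1"

text \<open>\<open>\<langle>z\<^sub>j; w\<rangle> = \<langle>z\<^sub>j w\<rangle>\<langle>z\<^sub>j / w\<rangle>\<close> in the form that involves no square root of \<open>z\<^sub>j\<close>.\<close>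

definition ang2 :: "nat \<Rightarrow> pfield \<Rightarrow> laurent" where
  "ang2 j w = zvar j + zinv j - lconst w - lconst (inverse w)"

definition ang2_fact :: "nat \<Rightarrow> pfield \<Rightarrow> nat \<Rightarrow> laurent" where
  "ang2_fact j u l = (\<Prod>k<l. ang2 j (par_q ^ k * u))"


section \<open>The Weyl group, orbit sums and the dominance order\<close>

text \<open>Elements of \<open>W\<close> are represented by their action on exponent vectors.\<close>

definition weyl :: "nat \<Rightarrow> (expvec \<Rightarrow> expvec) set" where
  "weyl m = {w. \<exists>\<sigma> \<epsilon>. \<sigma> permutes {1..m} \<and> (\<forall>i\<in>{1..m}. \<epsilon> i \<in> {1, -1}) \<and>
     (\<forall>i. i \<notin> {1..m} \<longrightarrow> \<epsilon> i = 1) \<and>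
     (\<forall>\<nu> i. Poly_Mapping.lookup (w \<nu>) i = \<epsilon> i * Poly_Mapping.lookup \<nu> (\<sigma> i))}"

definition weyl_act :: "(expvec \<Rightarrow> expvec) \<Rightarrow> laurent \<Rightarrow> laurent" where
  "weyl_act w P = (\<Sum>\<nu>\<in>Poly_Mapping.keys P. Poly_Mapping.single (w \<nu>) (Poly_Mapping.lookup P \<nu>))"

definition weyl_invariant :: "nat \<Rightarrow> laurent \<Rightarrow> bool" where
  "weyl_invariant m P \<longleftrightarrow> (\<forall>w\<in>weyl m. weyl_act w P = P)"

definition orbit_sum :: "nat \<Rightarrow> expvec \<Rightarrow> laurent" where
  "orbit_sum m \<mu> = (\<Sum>\<nu>\<in>(\<lambda>w. w \<mu>) ` weyl m. Poly_Mapping.single \<nu> 1)"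

definition partition_vec :: "nat \<Rightarrow> expvec \<Rightarrow> bool" where
  "partition_vec m \<mu> \<longleftrightarrow> Poly_Mapping.keys \<mu> \<subseteq> {1..m} \<and>
     (\<forall>i. Poly_Mapping.lookup \<mu> i \<ge> 0) \<and>
     (\<forall>i j. 1 \<le> i \<and> i \<le> j \<and> j \<le> m \<longrightarrow> Poly_Mapping.lookup \<mu> j \<le> Poly_Mapping.lookup \<mu> i)"

definition dominated :: "nat \<Rightarrow> expvec \<Rightarrow> expvec \<Rightarrow> bool" where
  "dominated m \<mu> \<kappa> \<longleftrightarrow>
     (\<forall>i\<in>{1..m}. (\<Sum>j=1..i. Poly_Mapping.lookup \<mu> j) \<le> (\<Sum>j=1..i. Poly_Mapping.lookup \<kappa> j))"

definition below :: "nat \<Rightarrow> expvec \<Rightarrow> expvec set" where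
  "below m \<kappa> = {\<mu>. partition_vec m \<mu> \<and> dominated m \<mu> \<kappa> \<and> \<mu> \<noteq> \<kappa>}"

definition row :: "nat \<Rightarrow> expvec" where
  "row r = Poly_Mapping.single 1 (int r)"


section \<open>Koornwinder's operator and Koornwinder polynomials\<close>

definition fconst :: "pfield \<Rightarrow> lfield" where
  "fconst c = to_fract (lconst c)"

definition zf :: "nat \<Rightarrow> lfield" where
  "zf j = to_fract (zvar j)"

text \<open>The coefficient \<open>\<A>\<^sub>i\<^sup>+\<close> with \<open>x\<^sub>j\<close> in place of \<open>z\<^sub>j\<close>.\<close>

definition koorn_A :: "nat \<Rightarrow> nat \<Rightarrow> (nat \<Rightarrow> lfield) \<Rightarrow> lfield" where
  "koorn_A m i x =
     ((1 - fconst par_a * x i) * (1 - fconst par_b * x i) *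
      (1 - fconst par_c * x i) * (1 - fconst par_d * x i)) /
     (fconst (msqrt (par_a * par_b * par_c * par_d * inverse par_q)) * fconst par_t ^ (m - 1) *
      (1 - x i ^ 2) * (1 - fconst par_q * x i ^ 2)) *
     (\<Prod>j\<in>{1..m} - {i}.
        ((1 - fconst par_t * x i * x j) * (1 - fconst par_t * x i * inverse (x j))) /
        ((1 - x i * x j) * (1 - x i * inverse (x j))))"

text \<open>The substitution \<open>z\<^sub>i \<mapsto> s z\<^sub>i\<close>, so that \<open>T\<^bsub>q,z\<^sub>i\<^esub>\<close> and its inverse are obtained for
  \<open>s = q\<close> and \<open>s = q\<^sup>-\<^sup>1\<close>.\<close>

definition zscale :: "pfield \<Rightarrow> nat \<Rightarrow> laurent \<Rightarrow> laurent" where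
  "zscale s i P = Poly_Mapping.mapp (\<lambda>\<nu> c. s powi (Poly_Mapping.lookup \<nu> i) * c) P"

definition koorn_op :: "nat \<Rightarrow> laurent \<Rightarrow> lfield" where
  "koorn_op m P =
     (\<Sum>i=1..m. koorn_A m i zf * to_fract (zscale par_q i P - P)) +
     (\<Sum>i=1..m. koorn_A m i (\<lambda>j. inverse (zf j)) * to_fract (zscale (inverse par_q) i P - P))"

definition is_koornwinder :: "nat \<Rightarrow> expvec \<Rightarrow> laurent \<Rightarrow> bool" where
  "is_koornwinder m \<kappa> P \<longleftrightarrow>
     laurent_in m P \<and> weyl_invariant m P \<and>
     (\<exists>cf. P = orbit_sum m \<kappa> + (\<Sum>\<mu>\<in>below m \<kappa>. lconst (cf \<mu>) * orbit_sum m \<mu>)) \<and>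
     (\<exists>ev. koorn_op m P = fconst ev * to_fract P)"

definition koornwinder :: "nat \<Rightarrow> expvec \<Rightarrow> laurent" where
  "koornwinder m \<kappa> = (THE P. is_koornwinder m \<kappa> P)"


section \<open>The functions \<open>H\<^sub>l\<close>\<close>

definition H_fun :: "nat \<Rightarrow> nat \<Rightarrow> laurent" where
  "H_fun m l =
     (\<Sum>\<nu> \<in> {\<nu> \<in> {1..m} \<rightarrow>\<^sub>E (UNIV :: nat set). (\<Sum>j=1..m. \<nu> j) = l}.
        \<Prod>j=1..m. lconst (ang_fact par_t (\<nu> j) / ang_fact par_q (\<nu> j)) *
          ang2_fact j (par_t ^ (j - 1) * par_q ^ (\<Sum>i=1..<j. \<nu> i) * par_a) (\<nu> j))"


section \<open>Well-definedness of the square roots and finiteness of the sums\<close>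

definition ev1 :: "pring \<Rightarrow> rat" where
  "ev1 p = poly (poly (poly (poly (poly (poly p 1) 1) 1) 1) 1) 1"

definition eval_one :: "('a :: idom \<Rightarrow> rat) \<Rightarrow> 'a fract \<Rightarrow> bool" where
  "eval_one e s \<longleftrightarrow> (\<exists>p r. e p = 1 \<and> e r = 1 \<and> s * to_fract r = to_fract p)"

definition sign_mult_map :: "('a :: idom \<Rightarrow> rat) \<Rightarrow> bool" where
  "sign_mult_map e \<longleftrightarrow> (\<forall>p r. e (p * r) = e p * e r) \<and> (\<forall>p. e (- p) = - e p) \<and> e 1 = 1 \<and> e 0 = 0"

lemma eval_one_mult:
  assumes e: "sign_mult_map e" and "eval_one e s" "eval_one e u"
  shows "eval_one e (s * u)"
proof -
  obtain p r p' r' where *: "e p = 1" "e r = 1" "s * to_fract r = to_fract p"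
    "e p' = 1" "e r' = 1" "u * to_fract r' = to_fract p'"
    using assms(2,3) unfolding eval_one_def by blast
  have "s * u * to_fract (r * r') = (s * to_fract r) * (u * to_fract r')"
    by (simp add: ac_simps)
  also have "\<dots> = to_fract (p * p')"
    by (simp only: * to_fract_mult)
  finally have "s * u * to_fract (r * r') = to_fract (p * p')" .
  moreover have "e (p * p') = 1" "e (r * r') = 1"
    using e * by (simp_all add: sign_mult_map_def)
  ultimately show ?thesis unfolding eval_one_def by blast
qed

lemma eval_one_inverse:
  assumes e: "sign_mult_map e" and "eval_one e s" shows "eval_one e (inverse s)"
proof -
  obtain p r where *: "e p = 1" "e r = 1" "s * to_fract r = to_fract p"
    using assms unfolding eval_one_def by blast
  have "p \<noteq> 0" using *(1) e by (auto simp: sign_mult_map_def)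
  hence "s \<noteq> 0" using *(3) by auto
  hence "inverse s * to_fract p = to_fract r"
    using *(3) by (simp add: field_simps)
  thus ?thesis unfolding eval_one_def using * by blast
qed

lemma eval_one_to_fract: "sign_mult_map e \<Longrightarrow> e p = 1 \<Longrightarrow> eval_one e (to_fract p)"
  unfolding eval_one_def sign_mult_map_def by (intro exI[of _ p] exI[of _ 1]) auto

lemma eval_one_powi:
  assumes e: "sign_mult_map e" and s: "eval_one e s" shows "eval_one e (s powi i)"
proof -
  have pow: "eval_one e (u ^ n)" if "eval_one e u" for u n
  proof (induction n)
    case 0
    show ?case using eval_one_to_fract[OF e, of 1] e by (simp add: sign_mult_map_def)
  next
    case (Suc n)
    thus ?case using that eval_one_mult[OF e] by simp
  qed
  show ?thesis
    using pow[OF s] pow[OF eval_one_inverse[OF e s]] by (simp add: power_int_def)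
qed

lemma eval_one_minus:
  assumes e: "sign_mult_map e" and s: "eval_one e s" "eval_one e (- s)"
  shows False
proof -
  obtain p r p' r' where *: "e p = 1" "e r = 1" "s * to_fract r = to_fract p"
    "e p' = 1" "e r' = 1" "- s * to_fract r' = to_fract p'"
    using s unfolding eval_one_def by blast
  have "to_fract (- (p * r')) = (- s * to_fract r') * to_fract r"
    using *(3)[symmetric] by (simp add: ac_simps)
  also have "\<dots> = to_fract (p' * r)"
    by (simp only: * to_fract_mult)
  finally have "- (p * r') = p' * r" by (simp only: to_fract_eq_iff)
  hence "e (- (p * r')) = e (p' * r)" by simp
  thus False using * e by (simp add: sign_mult_map_def)
qed

lemma sign_mult_map_ev1: "sign_mult_map ev1"
  unfolding sign_mult_map_def ev1_def
  by (simp only: poly_mult poly_minus poly_1 poly_0 simp_thms)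

lemma half_monomial_eval_one: "half_monomial s \<Longrightarrow> eval_one ev1 s"
  unfolding half_monomial_def a_half_def b_half_def c_half_def d_half_def q_half_def t_half_def
  by (elim exE, hypsubst,
      intro eval_one_mult[OF sign_mult_map_ev1] eval_one_powi[OF sign_mult_map_ev1]
            eval_one_to_fract[OF sign_mult_map_ev1])
     (simp_all only: ev1_def poly_pCons poly_0 poly_1 mult_zero_right mult_1_left add_0_left add_0_right)

lemma msqrt_power2:
  assumes "half_monomial s" shows "msqrt (s ^ 2) = s"
  unfolding msqrt_def
proof (rule the_equality)
  show "half_monomial s \<and> s ^ 2 = s ^ 2" using assms by blast
  fix s' assume s': "half_monomial s' \<and> s' ^ 2 = s ^ 2"
  hence "s' = s \<or> s' = - s" by (simp only: power2_eq_iff)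
  thus "s' = s"
    using eval_one_minus[OF sign_mult_map_ev1, of s] half_monomial_eval_one assms s' by blast
qed

lemma finite_below: "finite (below m \<kappa>)"
proof -
  define N where "N = (\<Sum>j=1..m. Poly_Mapping.lookup \<kappa> j)"
  define S where "S = {f :: nat \<Rightarrow> int. \<forall>i. (i \<in> {1..m} \<longrightarrow> f i \<in> {0..N}) \<and> (i \<notin> {1..m} \<longrightarrow> f i = 0)}"
  have "Poly_Mapping.lookup \<mu> \<in> S" if \<mu>: "\<mu> \<in> below m \<kappa>" for \<mu>
  proof -
    have pv: "partition_vec m \<mu>" and dom: "dominated m \<mu> \<kappa>"
      using \<mu> by (simp_all add: below_def)
    have nn: "Poly_Mapping.lookup \<mu> i \<ge> 0" for i
      using pv by (simp add: partition_vec_def)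
    have out: "Poly_Mapping.lookup \<mu> i = 0" if "i \<notin> {1..m}" for i
    proof -
      have "Poly_Mapping.keys \<mu> \<subseteq> {1..m}" using pv unfolding partition_vec_def by (rule conjunct1)
      hence "i \<notin> Poly_Mapping.keys \<mu>" using that by (rule contra_subsetD)
      thus ?thesis by (simp only: in_keys_iff simp_thms)
    qed
    have "Poly_Mapping.lookup \<mu> i \<le> N" if i: "i \<in> {1..m}" for i
    proof -
      have "Poly_Mapping.lookup \<mu> i \<le> (\<Sum>j=1..m. Poly_Mapping.lookup \<mu> j)"
        using i nn by (intro member_le_sum) auto
      also have "\<dots> \<le> N"
      proof -
        have "m \<in> {1..m}" using i by simp
        thus ?thesis using dom unfolding dominated_def N_def by blast
      qed
      finally show ?thesis .
    qed
    with nn out show ?thesis unfolding S_def by simp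
  qed
  hence "Poly_Mapping.lookup ` below m \<kappa> \<subseteq> S" by blast
  moreover have "finite S"
    unfolding S_def by (intro finite_set_of_finite_funs finite_atLeastAtMost finite_atLeastAtMost_int)
  ultimately have "finite (Poly_Mapping.lookup ` below m \<kappa>)"
    by (rule finite_subset)
  thus ?thesis
    by (rule finite_imageD) (simp add: inj_on_def)
qed

text \<open>The index set of the orbit sum.\<close>

lemma finite_orbit: "finite ((\<lambda>w. w \<mu>) ` weyl m)"
proof -
  define F where "F = Poly_Mapping.lookup \<mu>"
  define B where "B = (\<lambda>(x, y). x * y) ` ({1, -1} \<times> F ` {1..m})"
  define N where "N = {1..m} \<union> Poly_Mapping.keys \<mu>"
  define S where "S = {f :: nat \<Rightarrow> int. \<forall>i. (i \<in> N \<longrightarrow> f i \<in> B \<union> F ` N) \<and> (i \<notin> N \<longrightarrow> f i = 0)}"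
  have "Poly_Mapping.lookup (w \<mu>) \<in> S" if hw: "w \<in> weyl m" for w
  proof -
    obtain \<sigma> \<epsilon> where w: "\<sigma> permutes {1..m}" "\<forall>i\<in>{1..m}. \<epsilon> i \<in> {1, -1}"
      "\<forall>i. i \<notin> {1..m} \<longrightarrow> \<epsilon> i = 1"
      "\<forall>\<nu> i. Poly_Mapping.lookup (w \<nu>) i = \<epsilon> i * Poly_Mapping.lookup \<nu> (\<sigma> i)"
      using hw unfolding weyl_def mem_Collect_eq by (elim exE conjE) (rule that)
    have B: "Poly_Mapping.lookup (w \<mu>) i \<in> B" if i: "i \<in> {1..m}" for i
    proof -
      have "\<sigma> i \<in> {1..m}" using permutes_in_image[OF w(1)] i by blast
      hence "(\<epsilon> i, F (\<sigma> i)) \<in> {1, -1} \<times> F ` {1..m}" using w(2) i by blast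
      hence "(\<lambda>(x, y). x * y) (\<epsilon> i, F (\<sigma> i)) \<in> B" unfolding B_def by (rule imageI)
      thus ?thesis by (simp only: w(4) F_def prod.case)
    qed
    have F: "Poly_Mapping.lookup (w \<mu>) i = F i" if i: "i \<notin> {1..m}" for i
    proof -
      have "\<sigma> i = i" "\<epsilon> i = 1" using permutes_not_in[OF w(1) i] w(3) i by blast+
      thus ?thesis by (simp only: w(4) F_def mult_1_left)
    qed
    have "Poly_Mapping.lookup (w \<mu>) i \<in> B \<union> F ` N" if "i \<in> N" for i
      using B[of i] F[of i] that by (cases "i \<in> {1..m}") simp_all
    moreover have "Poly_Mapping.lookup (w \<mu>) i = 0" if "i \<notin> N" for i
    proof -
      have "i \<notin> {1..m}" "i \<notin> Poly_Mapping.keys \<mu>" using that unfolding N_def by simp_all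
      thus ?thesis using F[of i] by (simp add: F_def in_keys_iff)
    qed
    ultimately show ?thesis unfolding S_def by simp
  qed
  hence "Poly_Mapping.lookup ` (\<lambda>w. w \<mu>) ` weyl m \<subseteq> S" by blast
  moreover have "finite S"
    unfolding S_def by (rule finite_set_of_finite_funs) (simp_all add: N_def B_def)
  ultimately have "finite (Poly_Mapping.lookup ` (\<lambda>w. w \<mu>) ` weyl m)"
    by (rule finite_subset)
  thus ?thesis
    by (rule finite_imageD) (simp add: inj_on_def)
qed

end

theory Submission
  imports Defs "HOL-Computational_Algebra.Formal_Laurent_Series"
begin

text \<open>
  Write \<open>(x)\<^sub>\<infinity> = (1 - x)(1 - qx)(1 - q\<^sup>2x)\<dots>\<close>. Everything rests on the generating function
  \<open>F(z; u) = \<Prod>\<^sub>j (tuz\<^sub>j)\<^sub>\<infinity> (tu/z\<^sub>j)\<^sub>\<infinity> / ((uz\<^sub>j)\<^sub>\<infinity> (u/z\<^sub>j)\<^sub>\<infinity>)\<close>, a formal power series in \<open>u\<close>.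

  Up to a factor \<open>(q/t)\<^bsup>l/2\<^esup>\<close>, the functions \<open>H\<^sub>l(z; a)\<close> are the coefficients of \<open>F\<close> with respect to
  the series \<open>\<phi>\<^sub>l(u) = u\<^sup>l (t\<^sup>maq\<^sup>lu)\<^sub>\<infinity> (tu/a)\<^sub>\<infinity> / ((au)\<^sub>\<infinity> (t\<^bsup>1-m\<^esup>q\<^bsup>-l\<^esup>u/a)\<^sub>\<infinity>)\<close>, whose leading terms are
  the powers \<open>u\<^sup>l\<close> (\<open>gen_fun_expansion\<close>). For one variable this follows because both sides solve the
  same \<open>q\<close>-difference equation in \<open>u\<close>; for \<open>m\<close> variables, \<open>\<phi>\<^sub>k\<close> times the \<open>j\<close>-th series that belongs
  to the next variable is again a \<open>\<phi>\<^bsub>k+j\<^esub>\<close>, and this is the origin of the nested arguments in the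
  definition of \<open>H\<^sub>l\<close>. As \<open>F\<close> is visibly invariant under \<open>W\<close>, so is every \<open>H\<^sub>l\<close>.

  Koornwinder's operator acts on \<open>F\<close> through \<open>u\<close> alone. For a finite set \<open>Y\<close> put
  \<open>G\<^sub>Y(u) = \<Prod>\<^bsub>y\<in>Y\<^esub> (tyu)\<^sub>\<infinity> / (u/y)\<^sub>\<infinity>\<close>; then \<open>F = G\<^sub>Y\<close> for \<open>Y = {z\<^sub>i, 1/z\<^sub>i}\<close>. The sum of all residues of
  \<open>(1-ax)(1-bx)(1-cx)(1-dx) u / (x(1-tx\<^sup>2)(1-txu)(qx-u)) \<Prod>\<^bsub>y\<in>Y\<^esub> (1-txy)/(1-x/y)\<close> vanishes
  (\<open>five_pole_residue_sum\<close>): the residues at the points of \<open>Y\<close> make up \<open>\<D>F\<close>, those at \<open>1/(tu)\<close> and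
  \<open>u/q\<close> produce \<open>F(qu)\<close> and \<open>F(u/q)\<close>, and the rest are multiples of \<open>F\<close>. The same identity for
  \<open>Y = {1/a, t\<^bsup>m-1\<^esup>aq\<^sup>l}\<close> computes the resulting \<open>q\<close>-difference operator on \<open>\<phi>\<^sub>l\<close>; here only one point of
  \<open>Y\<close> contributes, because \<open>1 - ax\<close> vanishes at \<open>1/a\<close>, and the answer is a combination of \<open>\<phi>\<^sub>l\<close> and
  \<open>\<phi>\<^bsub>l+1\<^esub>\<close> (\<open>dual_op_qbasis\<close>). Comparing coefficients gives \<open>\<D>H\<^sub>l = e\<^sub>lH\<^sub>l + f\<^sub>lH\<^bsub>l-1\<^esub>\<close> (\<open>koorn_op_H_fun\<close>).

  Hence \<open>\<Sum>\<^bsub>l\<le>r\<^esub> \<kappa>\<^sub>lH\<^sub>l\<close> is an eigenfunction with eigenvalue \<open>e\<^sub>r\<close> as soon as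
  \<open>\<kappa>\<^bsub>l+1\<^esub>f\<^bsub>l+1\<^esub> = (e\<^sub>r - e\<^sub>l)\<kappa>\<^sub>l\<close>, and the coefficients of the theorem satisfy this recurrence
  (\<open>coefficient_recurrence\<close>). The sum is \<open>W\<close>-invariant, the exponents \<open>\<nu>\<close> of its monomials satisfy
  \<open>\<bar>\<nu>\<^sub>1\<bar> + \<dots> + \<bar>\<nu>\<^sub>m\<bar> \<le> r\<close>, and the coefficient of \<open>z\<^sub>1\<^sup>r\<close> comes from \<open>H\<^sub>r\<close> alone, where it is
  \<open>\<langle>t\<rangle>\<^bsub>q,r\<^esub>/\<langle>q\<rangle>\<^bsub>q,r\<^esub>\<close> (\<open>H_fun_leading_coeff\<close>). So a suitable multiple of the sum has all the properties that
  define \<open>P\<^bsub>(r)\<^esub>\<close>. Those properties determine \<open>P\<^bsub>(r)\<^esub>\<close> (\<open>koornwinder_unique\<close>): \<open>\<D>\<close> is triangular with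
  respect to lexicographically leading monomials, with diagonal entries that separate all exponents
  (\<open>spectrum_inj\<close>), and the difference of two candidates would be an eigenfunction with the eigenvalue
  of \<open>z\<^sub>1\<^sup>r\<close> but with another leading monomial.
\<close>


section \<open>Formal expansions in a graded family of power series\<close>

text \<open>The infinite sum \<open>\<Sum>\<^sub>l H\<^sub>l \<phi>\<^sub>l\<close>. Cutting it off at \<open>l \<le> n\<close> in degree \<open>n\<close> gives the right coefficient for
  graded families, whose \<open>l\<close>-th member is divisible by the \<open>l\<close>-th power of the variable.\<close>

definition formal_sum :: "(nat \<Rightarrow> 'k::comm_ring_1) \<Rightarrow> (nat \<Rightarrow> 'k fps) \<Rightarrow> 'k fps" where
  "formal_sum H \<phi> = Abs_fps (\<lambda>n. \<Sum>l\<le>n. H l * \<phi> l $ n)"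

definition graded_family :: "(nat \<Rightarrow> 'k::comm_ring_1 fps) \<Rightarrow> bool" where
  "graded_family \<phi> \<longleftrightarrow> (\<forall>l n. n < l \<longrightarrow> \<phi> l $ n = 0)"

lemma formal_sum_nth:
  assumes "graded_family \<phi>" "n \<le> N"
  shows "formal_sum H \<phi> $ n = (\<Sum>l\<le>N. H l * \<phi> l $ n)"
  unfolding formal_sum_def fps_nth_Abs_fps
  by (rule sum.mono_neutral_left) (use assms in \<open>auto simp: graded_family_def\<close>)

lemma graded_family_mult:
  assumes "graded_family \<phi>"
  shows "graded_family (\<lambda>l. C l * \<phi> l)"
  unfolding graded_family_def
proof (intro allI impI)
  fix l n :: nat assume "n < l"
  thus "(C l * \<phi> l) $ n = 0"
    using assms unfolding fps_mult_nth graded_family_def by (intro sum.neutral) auto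
qed

lemma formal_sum_mult:
  assumes "graded_family \<phi>"
  shows "C * formal_sum H \<phi> = formal_sum H (\<lambda>l. C * \<phi> l)"
proof (rule fps_ext)
  fix n
  have "(C * formal_sum H \<phi>) $ n = (\<Sum>i=0..n. C $ i * (\<Sum>l\<le>n. H l * \<phi> l $ (n - i)))"
    unfolding fps_mult_nth
    by (intro sum.cong refl arg_cong2[where f = "(*)"] formal_sum_nth[OF assms]) auto
  also have "\<dots> = (\<Sum>l\<le>n. H l * (\<Sum>i=0..n. C $ i * \<phi> l $ (n - i)))"
    unfolding sum_distrib_left by (subst sum.swap) (simp add: ac_simps)
  also have "\<dots> = formal_sum H (\<lambda>l. C * \<phi> l) $ n"
    by (simp add: formal_sum_def fps_mult_nth)
  finally show "(C * formal_sum H \<phi>) $ n = formal_sum H (\<lambda>l. C * \<phi> l) $ n" .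
qed

lemma formal_sum_add_left: "formal_sum (\<lambda>l. H l + G l) \<phi> = formal_sum H \<phi> + formal_sum G \<phi>"
  by (rule fps_ext) (simp add: formal_sum_def sum.distrib ring_distribs)

lemma formal_sum_add_right: "formal_sum H (\<lambda>l. \<phi> l + \<chi> l) = formal_sum H \<phi> + formal_sum H \<chi>"
  by (rule fps_ext) (simp add: formal_sum_def sum.distrib ring_distribs)

lemma formal_sum_diff_left: "formal_sum (\<lambda>l. H l - G l) \<phi> = formal_sum H \<phi> - formal_sum G \<phi>"
  by (rule fps_ext) (simp add: formal_sum_def sum_subtractf ring_distribs)

lemma formal_sum_diff_right: "formal_sum H (\<lambda>l. \<phi> l - \<chi> l) = formal_sum H \<phi> - formal_sum H \<chi>"
  by (rule fps_ext) (simp add: formal_sum_def sum_subtractf ring_distribs)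

lemma formal_sum_const_left: "formal_sum (\<lambda>l. c * H l) \<phi> = fps_const c * formal_sum H \<phi>"
  by (rule fps_ext) (simp add: formal_sum_def sum_distrib_left ac_simps)

lemma formal_sum_const_right:
  "formal_sum H (\<lambda>l. fps_const (c l) * \<phi> l) = formal_sum (\<lambda>l. H l * c l) \<phi>"
  by (rule fps_ext) (simp add: formal_sum_def ac_simps)

lemma formal_sum_sum_left:
  "formal_sum (\<lambda>l. \<Sum>i\<in>A. H i l) \<phi> = (\<Sum>i\<in>A. formal_sum (H i) \<phi>)"
  by (induction A rule: infinite_finite_induct)
     (simp_all add: formal_sum_add_left, simp_all add: formal_sum_def fps_eq_iff)

lemma formal_sum_shift:
  assumes "graded_family \<phi>"
  shows "formal_sum H (\<lambda>l. \<phi> (Suc l)) = formal_sum (\<lambda>l. if l = 0 then 0 else H (l - 1)) \<phi>"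
proof (rule fps_ext)
  fix n
  have "formal_sum (\<lambda>l. if l = 0 then 0 else H (l - 1)) \<phi> $ n =
      (\<Sum>l\<le>Suc n. (if l = 0 then 0 else H (l - 1)) * \<phi> l $ n)"
    by (rule formal_sum_nth[OF assms]) simp
  also have "\<dots> = (\<Sum>l\<le>n. H l * \<phi> (Suc l) $ n)"
    by (subst sum.atMost_Suc_shift) simp
  finally show "formal_sum H (\<lambda>l. \<phi> (Suc l)) $ n =
      formal_sum (\<lambda>l. if l = 0 then 0 else H (l - 1)) \<phi> $ n"
    by (simp add: formal_sum_def)
qed

lemma formal_sum_eq_0D:
  fixes \<phi> :: "nat \<Rightarrow> 'k::field fps"
  assumes "graded_family \<phi>" "\<And>l. \<phi> l $ l \<noteq> 0" "formal_sum H \<phi> = 0"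
  shows "H n = 0"
proof (induction n rule: less_induct)
  case (less n)
  have "0 = (\<Sum>l\<le>n. H l * \<phi> l $ n)"
    using assms(3) by (simp add: formal_sum_def fps_eq_iff)
  also have "\<dots> = (\<Sum>l\<in>{n}. H l * \<phi> l $ n)"
    using less by (intro sum.mono_neutral_right) auto
  finally show ?case using assms(2)[of n] by simp
qed

text \<open>A graded family with nonzero leading coefficients is triangular with respect to the powers of the
  variable, so that coefficients may be compared as for power series.\<close>

lemma formal_sum_cancel:
  fixes \<phi> :: "nat \<Rightarrow> 'k::field fps"
  assumes "graded_family \<phi>" "\<And>l. \<phi> l $ l \<noteq> 0" "formal_sum H \<phi> = formal_sum G \<phi>"
  shows "H n = G n"
  using formal_sum_eq_0D[OF assms(1,2), of "\<lambda>l. H l - G l" n] assms(3)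
  by (simp add: formal_sum_diff_left)


section \<open>Rescaling of the expansion variable\<close>

definition dilate :: "'k::comm_ring_1 \<Rightarrow> 'k fps \<Rightarrow> 'k fps" where
  "dilate s f = Abs_fps (\<lambda>n. s ^ n * f $ n)"

lemma dilate_nth [simp]: "dilate s f $ n = s ^ n * f $ n"
  by (simp add: dilate_def)

lemma dilate_conv_compose: "dilate s f = f oo (fps_const s * fps_X)"
  by (simp add: dilate_def fps_compose_linear)

lemma dilate_diff: "dilate s (f - g) = dilate s f - dilate s g"
  and dilate_const [simp]: "dilate s (fps_const c) = fps_const c"
  and dilate_1 [simp]: "dilate s 1 = 1"
  by (auto simp: fps_eq_iff ring_distribs)

lemma dilate_X: "dilate s fps_X = fps_const s * fps_X"
proof (rule fps_ext)
  fix n show "dilate s fps_X $ n = (fps_const s * fps_X) $ n"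
    by (cases "n = 1") auto
qed

lemma dilate_mult: "dilate s (f * g) = dilate s f * dilate (s::'k::idom) g"
  by (simp add: dilate_conv_compose fps_compose_mult_distrib)

lemma dilate_power: "dilate s (f ^ n) = dilate (s::'k::idom) f ^ n"
  by (induction n) (simp_all add: dilate_mult)

lemma dilate_prod: "dilate s (\<Prod>i\<in>A. f i) = (\<Prod>i\<in>A. dilate (s::'k::idom) (f i))"
  by (induction A rule: infinite_finite_induct) (simp_all add: dilate_mult)

lemma dilate_inverse:
  assumes "f $ 0 \<noteq> (0::'k::field)"
  shows "dilate s (inverse f) = inverse (dilate s f)"
proof -
  have "dilate s f * dilate s (inverse f) = 1"
    using assms by (simp flip: dilate_mult add: inverse_mult_eq_1')
  moreover have "dilate s f $ 0 \<noteq> 0" using assms by simp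
  ultimately show ?thesis by (metis fps_inverse_unique)
qed

lemma dilate_formal_sum: "dilate s (formal_sum H \<phi>) = formal_sum H (\<lambda>l. dilate s (\<phi> l))"
  by (rule fps_ext) (simp add: formal_sum_def sum_distrib_left ac_simps)

text \<open>In degree \<open>n\<close> the lowest coefficient \<open>x\<close> of a solution satisfies \<open>x = q\<^sup>n x\<close>. Solutions of a
  first-order \<open>q\<close>-difference equation are therefore determined by their constant terms.\<close>

lemma q_difference_eq_0D:
  fixes A B X :: "'k::field fps"
  assumes q: "\<And>n. n > 0 \<Longrightarrow> q ^ n \<noteq> 1"
    and "A $ 0 = 1" "B $ 0 = 1" "X $ 0 = 0" and eq: "A * X = B * dilate q X"
  shows "X = 0"
proof (rule fps_ext)
  fix n show "X $ n = 0 $ n"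
  proof (induction n rule: less_induct)
    case (less n)
    have only: "(C * Y) $ n = C $ 0 * Y $ n" if "\<And>k. k < n \<Longrightarrow> Y $ k = 0" for C Y :: "'k fps"
      unfolding fps_mult_nth
      by (subst sum.mono_neutral_right[of _ "{0}"]) (use that in auto)
    have "X $ n = q ^ n * X $ n"
      using only[of X A] only[of "dilate q X" B] less assms(2,3) arg_cong[OF eq, of "\<lambda>f. f $ n"]
      by simp
    hence "(1 - q ^ n) * X $ n = 0" by (simp add: algebra_simps)
    thus ?case using q[of n] assms(4) by (cases "n = 0") auto
  qed
qed


section \<open>The infinite q-shifted factorial and the generating function\<close>

locale q_field =
  fixes q t :: "'k::field"
  assumes q_power_neq_1: "\<And>n. n > 0 \<Longrightarrow> q ^ n \<noteq> 1"
    and q_nz [simp]: "q \<noteq> 0" and t_nz [simp]: "t \<noteq> 0"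
begin

text \<open>The product \<open>(xu; q)\<^sub>\<infinity>\<close> as a power series in \<open>u\<close>. The coefficients are those of Euler's
  expansion, which makes sense because \<open>q\<close> is not a root of unity.\<close>

definition qpoch :: "'k \<Rightarrow> 'k fps" where
  "qpoch x = Abs_fps (\<lambda>n. x ^ n * (\<Prod>i<n. - (q ^ i) / (1 - q ^ Suc i)))"

lemma qpoch_nth_0 [simp]: "qpoch x $ 0 = 1"
  by (simp add: qpoch_def)

lemma qpoch_nonzero [simp]: "qpoch x \<noteq> 0"
  by (metis qpoch_nth_0 fps_zero_nth zero_neq_one)

lemma dilate_qpoch: "dilate s (qpoch x) = qpoch (s * x)"
  by (simp add: qpoch_def fps_eq_iff power_mult_distrib)

lemma qpoch_rec: "qpoch x = (1 - fps_const x * fps_X) * qpoch (q * x)"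
proof (rule fps_ext)
  fix n
  show "qpoch x $ n = ((1 - fps_const x * fps_X) * qpoch (q * x)) $ n"
  proof (cases n)
    case (Suc k)
    define e where "e = (\<Prod>i<k. - (q ^ i) / (1 - q ^ Suc i))"
    have "1 - q ^ Suc k \<noteq> 0" using q_power_neq_1[of "Suc k"] by simp
    hence "x ^ Suc k * (e * (- (q ^ k) / (1 - q ^ Suc k))) =
        (q * x) ^ Suc k * (e * (- (q ^ k) / (1 - q ^ Suc k))) - x * ((q * x) ^ k * e)"
      by (simp add: divide_simps power_mult_distrib) (simp add: algebra_simps)
    thus ?thesis
      by (simp add: Suc qpoch_def e_def left_diff_distrib mult.assoc fps_mult_left_const_nth
            del: power_Suc)
  qed simp
qed

lemma inverse_qpoch_rec: "inverse (qpoch (q * x)) = (1 - fps_const x * fps_X) * inverse (qpoch x)"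
proof -
  have "inverse (qpoch x) = inverse (1 - fps_const x * fps_X) * inverse (qpoch (q * x))"
    by (subst qpoch_rec[of x]) (simp add: fps_inverse_mult)
  moreover have "(1 - fps_const x * fps_X) * inverse (1 - fps_const x * fps_X) = 1"
    by (rule inverse_mult_eq_1') simp
  ultimately show ?thesis by (simp only: mult.assoc[symmetric] mult_1_left)
qed

text \<open>The factor of the generating function that belongs to one variable.\<close>

definition gen_fun1 :: "'k \<Rightarrow> 'k fps" where
  "gen_fun1 z = qpoch (t * z) * qpoch (t / z) * inverse (qpoch z) * inverse (qpoch (1 / z))"

text \<open>The series \<open>\<phi>\<^sub>l\<close> for \<open>m\<close> variables are obtained for \<open>b = t\<^sup>m\<close>; leaving \<open>b\<close> free makes
  products of such series, where the exponents of \<open>t\<close> add up, easy to state.\<close>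

definition qbasis :: "'k \<Rightarrow> 'k \<Rightarrow> nat \<Rightarrow> 'k fps" where
  "qbasis a b l = fps_X ^ l * qpoch (b * a * q ^ l) * qpoch (t / a) *
     inverse (qpoch a) * inverse (qpoch (t / (b * a * q ^ l)))"

text \<open>Up to a power of \<open>(q/t)\<^bsup>1/2\<^esup>\<close>, the factor \<open>\<langle>t\<rangle>\<^bsub>q,k\<^esub>/\<langle>q\<rangle>\<^bsub>q,k\<^esub> \<langle>z; a\<rangle>\<^bsub>q,k\<^esub>\<close>, free of square roots.\<close>

definition hfun :: "nat \<Rightarrow> 'k \<Rightarrow> 'k \<Rightarrow> 'k" where
  "hfun k a z = (\<Prod>i<k. (1 - t * q ^ i) / (1 - q ^ Suc i)) *
     (\<Prod>i<k. z + inverse z - q ^ i * a - inverse (q ^ i * a))"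

lemma graded_fps_X_power: "graded_family (\<lambda>l. fps_X ^ l * f l)"
  by (simp add: graded_family_def fps_X_power_mult_nth)

lemma graded_qbasis: "graded_family (qbasis a b)"
  unfolding qbasis_def mult.assoc by (rule graded_fps_X_power)

lemma qbasis_nth_self: "qbasis a b l $ l = 1"
  unfolding qbasis_def mult.assoc by (simp add: fps_X_power_mult_nth)

text \<open>The polynomial identity behind the one-variable expansion. Here \<open>Q\<close> stands for \<open>q\<^sup>k\<close> and
  the primed letters for inverses; the common factor \<open>1 - sU\<^sup>2\<close> becomes part of the series \<open>\<chi>\<^sub>k\<close> in the
  next lemma.\<close>

lemma one_variable_cancellation:
  fixes U :: "'r::comm_ring_1"
  assumes "z * z' = 1" "a * a' = 1" "Q * Q' = 1"
  shows "(1 - z * U) * (1 - z' * U) * ((1 - s * a * Q * U) * (1 - s * a' * U)) -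
     Q * (1 - s * z * U) * (1 - s * z' * U) * ((1 - a * U) * (1 - a' * Q' * U)) =
     (1 - s * U ^ 2) * ((1 - Q) * ((1 - a' * Q' * U) * (1 - s * a * Q * U)) -
        (1 - s * Q) * U * (z + z' - Q * a - Q' * a'))"
proof -
  have quad: "(1 - x * U) * (1 - y * U) = 1 - (x + y) * U + x * y * U ^ 2" for x y
    by (simp add: algebra_simps power2_eq_square)
  have 1: "(1 - z * U) * (1 - z' * U) = 1 - (z + z') * U + U ^ 2"
    by (simp add: quad assms)
  have "(1 - s * z * U) * (1 - s * z' * U) = 1 - (s * z + s * z') * U + s ^ 2 * (z * z') * U ^ 2"
    unfolding quad by (simp add: power2_eq_square ac_simps)
  hence 2: "(1 - s * z * U) * (1 - s * z' * U) = 1 - s * (z + z') * U + s ^ 2 * U ^ 2"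
    by (simp add: assms ring_distribs)
  have "(1 - s * a * Q * U) * (1 - s * a' * U) =
      1 - (s * a * Q + s * a') * U + s ^ 2 * (a * a') * Q * U ^ 2"
    unfolding quad by (simp add: power2_eq_square ac_simps)
  hence 3: "(1 - s * a * Q * U) * (1 - s * a' * U) = 1 - s * (a * Q + a') * U + s ^ 2 * Q * U ^ 2"
    by (simp add: assms ring_distribs ac_simps)
  have "Q * ((1 - a * U) * (1 - a' * Q' * U)) =
      Q - (Q * a + (Q * Q') * a') * U + (Q * Q') * (a * a') * U ^ 2"
    unfolding quad by (simp add: algebra_simps power2_eq_square)
  hence 4: "Q * ((1 - a * U) * (1 - a' * Q' * U)) = Q - (Q * a + a') * U + U ^ 2"
    by (simp add: assms)
  have "(1 - Q) * ((1 - a' * Q' * U) * (1 - s * a * Q * U)) =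
      (1 - Q) - (a' * Q' - (Q * Q') * a' + (1 - Q) * (s * a * Q)) * U +
      (1 - Q) * s * (a * a') * (Q * Q') * U ^ 2"
    unfolding quad by (simp add: algebra_simps power2_eq_square)
  hence 5: "(1 - Q) * ((1 - a' * Q' * U) * (1 - s * a * Q * U)) =
      (1 - Q) - (a' * Q' - a' + (1 - Q) * (s * a * Q)) * U + (1 - Q) * s * U ^ 2"
    by (simp add: assms)
  have "(1 - s * Q) * U * (z + z' - Q * a - Q' * a') =
      U * ((1 - s * Q) * (z + z') - Q * a + s * Q * Q * a - Q' * a' + s * (Q * Q') * a')"
    by (simp add: algebra_simps)
  hence 6: "(1 - s * Q) * U * (z + z' - Q * a - Q' * a') =
      U * ((1 - s * Q) * (z + z') - Q * a + s * Q * Q * a - Q' * a' + s * a')"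
    by (simp add: assms)
  have "(1 - z * U) * (1 - z' * U) * ((1 - s * a * Q * U) * (1 - s * a' * U)) -
     Q * (1 - s * z * U) * (1 - s * z' * U) * ((1 - a * U) * (1 - a' * Q' * U)) =
     (1 - (z + z') * U + U ^ 2) * (1 - s * (a * Q + a') * U + s ^ 2 * Q * U ^ 2) -
     (1 - s * (z + z') * U + s ^ 2 * U ^ 2) * (Q - (Q * a + a') * U + U ^ 2)"
    unfolding 1[symmetric] 2[symmetric] 3[symmetric] 4[symmetric] by (simp add: ac_simps)
  also have "\<dots> = (1 - s * U ^ 2) * ((1 - Q) - (a' * Q' - a' + (1 - Q) * (s * a * Q)) * U +
      (1 - Q) * s * U ^ 2 -
      U * ((1 - s * Q) * (z + z') - Q * a + s * Q * Q * a - Q' * a' + s * a'))"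
    by (simp add: algebra_simps power2_eq_square)
  finally show ?thesis unfolding 5 6 .
qed

text \<open>The left-hand side solves \<open>(1-zu)(1-u/z) X(u) = (1-tzu)(1-tu/z) X(qu)\<close>. So does the right-hand side:
  applied to \<open>\<phi>\<^sub>k\<close>, the difference of the two sides of the equation has the form
  \<open>(1-q\<^sup>k)\<chi>\<^sub>k - (1-tq\<^sup>k)(z + 1/z - aq\<^sup>k - 1/(aq\<^sup>k))\<chi>\<^bsub>k+1\<^esub>\<close>, and with the weights \<open>hfun\<close> these terms telescope.\<close>

lemma gen_fun1_expansion:
  assumes a: "a \<noteq> 0" and z: "z \<noteq> 0"
  shows "gen_fun1 z = formal_sum (\<lambda>k. hfun k a z) (qbasis a t)"
proof -
  define U :: "'k fps" where "U = fps_X"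
  define S where "S = formal_sum (\<lambda>k. hfun k a z) (qbasis a t)"
  define A where "A = (1 - fps_const z * U) * (1 - fps_const (1 / z) * U)"
  define B where "B = (1 - fps_const (t * z) * U) * (1 - fps_const (t / z) * U)"
  define \<chi> where "\<chi> k = (1 - fps_const t * U ^ 2) * (U ^ k * qpoch (t * a * q ^ k) *
     qpoch (q * (t / a)) * inverse (qpoch a) * inverse (qpoch (q * (1 / (a * q ^ k)))))" for k
  have step: "A * qbasis a t k - B * dilate q (qbasis a t k) =
      fps_const (1 - q ^ k) * \<chi> k -
      fps_const ((1 - t * q ^ k) * (z + inverse z - q ^ k * a - inverse (q ^ k * a))) * \<chi> (Suc k)" for k
  proof -
    define P where "P = U ^ k * qpoch (q * (t * a * q ^ k)) * qpoch (q * (t / a)) *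
      inverse (qpoch a) * inverse (qpoch (1 / (a * q ^ k)))"
    have ring1: "v * (x * P) - w * (y * P) = (v * x - w * y) * P" for v w x y
      by (simp add: algebra_simps)
    have ring2: "v * (x * y - x' * y') * P = x * (v * (y * P)) - x' * (v * (y' * P))" for v x y x' y'
      by (simp add: algebra_simps)
    have 1: "qbasis a t k = (1 - fps_const (t * a * q ^ k) * U) * (1 - fps_const (t / a) * U) * P"
      unfolding qbasis_def P_def U_def using a
      by (subst qpoch_rec[of "t * a * q ^ k"], subst qpoch_rec[of "t / a"]) (simp add: ac_simps)
    have 2: "dilate q (qbasis a t k) = fps_const (q ^ k) * (1 - fps_const a * U) *
        (1 - fps_const (1 / (a * q ^ k)) * U) * P"
      unfolding qbasis_def P_def U_def using a
      by (simp add: dilate_mult dilate_inverse dilate_qpoch dilate_power dilate_X power_mult_distrib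
            fps_const_power inverse_qpoch_rec[of a] inverse_qpoch_rec[of "1 / (a * q ^ k)", simplified])
    have 3: "\<chi> k = (1 - fps_const t * U ^ 2) * ((1 - fps_const (t * a * q ^ k) * U) *
        (1 - fps_const (1 / (a * q ^ k)) * U) * P)"
      unfolding \<chi>_def P_def U_def qpoch_rec[of "t * a * q ^ k"]
        inverse_qpoch_rec[of "1 / (a * q ^ k)"]
      by (simp only: mult_ac)
    have "q * (1 / (a * q ^ Suc k)) = 1 / (a * q ^ k)" "t * a * q ^ Suc k = q * (t * a * q ^ k)"
      by simp_all
    hence 4: "\<chi> (Suc k) = (1 - fps_const t * U ^ 2) * (U * P)"
      unfolding \<chi>_def P_def U_def by (simp only: mult_ac power_Suc)
    have 5: "(1 - fps_const z * U) * (1 - fps_const (1 / z) * U) *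
        ((1 - fps_const t * fps_const a * fps_const (q ^ k) * U) * (1 - fps_const t * fps_const (1 / a) * U)) -
      fps_const (q ^ k) * (1 - fps_const t * fps_const z * U) * (1 - fps_const t * fps_const (1 / z) * U) *
        ((1 - fps_const a * U) * (1 - fps_const (1 / a) * fps_const (1 / q ^ k) * U)) =
      (1 - fps_const t * U ^ 2) * ((1 - fps_const (q ^ k)) * ((1 - fps_const (1 / a) * fps_const (1 / q ^ k) * U) *
         (1 - fps_const t * fps_const a * fps_const (q ^ k) * U)) -
        (1 - fps_const t * fps_const (q ^ k)) * U * (fps_const z + fps_const (1 / z) -
          fps_const (q ^ k) * fps_const a - fps_const (1 / q ^ k) * fps_const (1 / a)))"
      by (rule one_variable_cancellation) (use a z in simp_all)
    have c: "fps_const (t * a * q ^ k) = fps_const t * fps_const a * fps_const (q ^ k)"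
      "fps_const (t / a) = fps_const t * fps_const (1 / a)"
      "fps_const (t * z) = fps_const t * fps_const z"
      "fps_const (t / z) = fps_const t * fps_const (1 / z)"
      "fps_const (1 / (a * q ^ k)) = fps_const (1 / a) * fps_const (1 / q ^ k)"
      "fps_const (1 - q ^ k) = 1 - fps_const (q ^ k)"
      "fps_const ((1 - t * q ^ k) * (z + inverse z - q ^ k * a - inverse (q ^ k * a))) =
        (1 - fps_const t * fps_const (q ^ k)) * (fps_const z + fps_const (1 / z) -
          fps_const (q ^ k) * fps_const a - fps_const (1 / q ^ k) * fps_const (1 / a))"
      by (simp_all add: inverse_eq_divide fps_const_sub[symmetric] del: fps_const_sub)
    have 6: "A * ((1 - fps_const (t * a * q ^ k) * U) * (1 - fps_const (t / a) * U)) -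
        B * (fps_const (q ^ k) * (1 - fps_const a * U) * (1 - fps_const (1 / (a * q ^ k)) * U)) =
      (1 - fps_const t * U ^ 2) * (fps_const (1 - q ^ k) * ((1 - fps_const (t * a * q ^ k) * U) *
          (1 - fps_const (1 / (a * q ^ k)) * U)) -
        fps_const ((1 - t * q ^ k) * (z + inverse z - q ^ k * a - inverse (q ^ k * a))) * U)"
      unfolding A_def B_def c using 5 by (simp only: mult_ac)
    have "A * qbasis a t k - B * dilate q (qbasis a t k) =
        (A * ((1 - fps_const (t * a * q ^ k) * U) * (1 - fps_const (t / a) * U)) -
         B * (fps_const (q ^ k) * (1 - fps_const a * U) * (1 - fps_const (1 / (a * q ^ k)) * U))) * P"
      unfolding 2 unfolding 1 by (rule ring1)
    also have "\<dots> = fps_const (1 - q ^ k) * \<chi> k -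
        fps_const ((1 - t * q ^ k) * (z + inverse z - q ^ k * a - inverse (q ^ k * a))) * \<chi> (Suc k)"
      unfolding 6 3 4 by (rule ring2)
    finally show ?thesis .
  qed
  have "\<chi> = (\<lambda>k. (1 - fps_const t * U ^ 2) * (fps_X ^ k * (qpoch (t * a * q ^ k) *
     (qpoch (q * (t / a)) * (inverse (qpoch a) * inverse (qpoch (q * (1 / (a * q ^ k)))))))))"
    unfolding \<chi>_def U_def mult.assoc ..
  hence grad: "graded_family \<chi>"
    by (simp only:) (rule graded_family_mult[OF graded_fps_X_power])
  have h0: "hfun 0 a z = 1" by (simp add: hfun_def)
  have hSuc: "hfun (Suc k) a z * (1 - q ^ Suc k) =
      hfun k a z * ((1 - t * q ^ k) * (z + inverse z - q ^ k * a - inverse (q ^ k * a)))" for k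
    using q_power_neq_1[of "Suc k"] by (simp add: hfun_def del: power_Suc)
  have "A * S - B * dilate q S = formal_sum (\<lambda>k. hfun k a z)
      (\<lambda>k. A * qbasis a t k - B * dilate q (qbasis a t k))"
    unfolding S_def dilate_formal_sum
    by (subst formal_sum_mult[OF graded_qbasis], subst formal_sum_mult)
       (simp_all add: formal_sum_diff_right graded_family_def
          graded_qbasis[unfolded graded_family_def, rule_format])
  also have "\<dots> = formal_sum (\<lambda>k. hfun k a z * (1 - q ^ k)) \<chi> -
      formal_sum (\<lambda>k. if k = 0 then 0 else hfun (k - 1) a z *
        ((1 - t * q ^ (k - 1)) * (z + inverse z - q ^ (k - 1) * a - inverse (q ^ (k - 1) * a)))) \<chi>"
    unfolding step formal_sum_diff_right formal_sum_const_right formal_sum_shift[OF grad] ..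
  also have "(\<lambda>k. if k = 0 then 0 else hfun (k - 1) a z *
        ((1 - t * q ^ (k - 1)) * (z + inverse z - q ^ (k - 1) * a - inverse (q ^ (k - 1) * a)))) =
      (\<lambda>k. hfun k a z * (1 - q ^ k))"
  proof (rule ext)
    fix k
    show "(if k = 0 then 0 else hfun (k - 1) a z *
        ((1 - t * q ^ (k - 1)) * (z + inverse z - q ^ (k - 1) * a - inverse (q ^ (k - 1) * a)))) =
      hfun k a z * (1 - q ^ k)"
    proof (cases k)
      case (Suc j)
      show ?thesis unfolding Suc hSuc by simp
    qed simp
  qed
  finally have MS: "A * S = B * dilate q S" by (simp only: diff_self right_minus_eq)
  have MG: "A * gen_fun1 z = B * dilate q (gen_fun1 z)"
  proof -
    define P where "P = qpoch (q * (t * z)) * qpoch (q * (t / z)) *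
      inverse (qpoch z) * inverse (qpoch (1 / z))"
    have "gen_fun1 z = B * P"
      unfolding gen_fun1_def P_def B_def U_def qpoch_rec[of "t * z"] qpoch_rec[of "t / z"]
      by (simp only: mult_ac)
    moreover have "dilate q (gen_fun1 z) = A * P"
      unfolding gen_fun1_def P_def A_def U_def
      by (simp add: dilate_mult dilate_inverse dilate_qpoch inverse_qpoch_rec[of z]
           inverse_qpoch_rec[of "1 / z", simplified])
    ultimately show ?thesis by (metis mult.left_commute)
  qed
  have "gen_fun1 z - S = 0"
  proof (rule q_difference_eq_0D[OF q_power_neq_1])
    show "A * (gen_fun1 z - S) = B * dilate q (gen_fun1 z - S)"
      by (simp only: dilate_diff right_diff_distrib MS MG)
    show "A $ 0 = 1" "B $ 0 = 1" by (simp_all add: A_def B_def U_def)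
    show "(gen_fun1 z - S) $ 0 = 0"
    proof -
      have "S $ 0 = 1" using qbasis_nth_self[of a t 0] unfolding S_def formal_sum_def
        by (simp add: h0)
      moreover have "gen_fun1 z $ 0 = 1" by (simp add: gen_fun1_def)
      ultimately show ?thesis by simp
    qed
  qed
  thus ?thesis unfolding S_def by (rule eq_iff_diff_eq_0[THEN iffD2])
qed

text \<open>The second factor starts from the node \<open>bq\<^sup>ka\<close> at which the first one ends; the two infinite products
  that contain this node cancel.\<close>

lemma qbasis_mult:
  assumes "a \<noteq> 0" "b \<noteq> 0"
  shows "qbasis a b k * qbasis (b * q ^ k * a) t j = qbasis a (b * t) (k + j)"
proof -
  have c: "qpoch x * inverse (qpoch x) = 1" for x by (rule inverse_mult_eq_1') simp
  have "qbasis a b k * qbasis (b * q ^ k * a) t j = qbasis a (b * t) (k + j) *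
     (qpoch (b * a * q ^ k) * inverse (qpoch (b * a * q ^ k))) *
     (qpoch (t / (b * a * q ^ k)) * inverse (qpoch (t / (b * a * q ^ k))))"
    using assms by (simp add: qbasis_def power_add ac_simps)
  thus ?thesis by (simp add: c)
qed

text \<open>The function \<open>H\<^sub>l\<close>, rescaled like \<open>hfun\<close>, with the last index \<open>\<nu>\<^bsub>m+1\<^esub> = l - k\<close> split off: the node of
  the variable \<open>x\<^bsub>m+1\<^esub>\<close> depends on the other indices only through their sum \<open>k\<close>.\<close>

fun hsum :: "'k \<Rightarrow> nat \<Rightarrow> nat \<Rightarrow> (nat \<Rightarrow> 'k) \<Rightarrow> 'k" where
  "hsum a 0 l x = (if l = 0 then 1 else 0)"
| "hsum a (Suc m) l x = (\<Sum>k\<le>l. hsum a m k x * hfun (l - k) (t ^ m * q ^ k * a) (x (Suc m)))"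

text \<open>Induction on \<open>m\<close>: each \<open>\<phi>\<^sub>k\<close> is multiplied by the factor of the new variable, expanded at the node
  that fits \<open>\<phi>\<^sub>k\<close>.\<close>

theorem gen_fun_expansion:
  assumes a: "a \<noteq> 0" and x: "\<And>j. j \<in> {1..m} \<Longrightarrow> x j \<noteq> 0"
  shows "(\<Prod>j=1..m. gen_fun1 (x j)) = formal_sum (\<lambda>l. hsum a m l x) (qbasis a (t ^ m))"
  using x
proof (induction m)
  case 0
  have "formal_sum (\<lambda>l. hsum a 0 l x) (qbasis a 1) $ n = 1 $ n" for n
  proof -
    have "qbasis a 1 0 = 1"
    proof -
      have "qbasis a 1 0 = (qpoch a * inverse (qpoch a)) * (qpoch (t / a) * inverse (qpoch (t / a)))"
        by (simp add: qbasis_def ac_simps)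
      thus ?thesis by (simp add: inverse_mult_eq_1')
    qed
    moreover have "formal_sum (\<lambda>l. hsum a 0 l x) (qbasis a 1) $ n = (\<Sum>l\<in>{0}. qbasis a 1 l $ n)"
      unfolding formal_sum_def fps_nth_Abs_fps by (rule sum.mono_neutral_cong_right) auto
    ultimately show ?thesis by simp
  qed
  thus ?case by (simp add: fps_eq_iff)
next
  case (Suc m)
  define H where "H = (\<lambda>k. hsum a m k x)"
  define h where "h k j = hfun j (t ^ m * q ^ k * a) (x (Suc m))" for k j
  define \<phi> where "\<phi> = qbasis a (t ^ m)"
  define \<psi> where "\<psi> = qbasis a (t ^ Suc m)"
  have gr: "n < l \<Longrightarrow> \<psi> l $ n = 0" for n l
    using graded_qbasis unfolding \<psi>_def graded_family_def by blast
  have one: "\<phi> k * gen_fun1 (x (Suc m)) = formal_sum (h k) (\<lambda>j. \<psi> (k + j))" for k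
  proof -
    have "gen_fun1 (x (Suc m)) = formal_sum (h k) (qbasis (t ^ m * q ^ k * a) t)"
      unfolding h_def by (rule gen_fun1_expansion) (use a Suc.prems in auto)
    hence "\<phi> k * gen_fun1 (x (Suc m)) =
        formal_sum (h k) (\<lambda>j. \<phi> k * qbasis (t ^ m * q ^ k * a) t j)"
      by (simp add: formal_sum_mult[OF graded_qbasis])
    also have "(\<lambda>j. \<phi> k * qbasis (t ^ m * q ^ k * a) t j) = (\<lambda>j. \<psi> (k + j))"
      using a qbasis_mult[of a "t ^ m" k] by (simp add: \<phi>_def \<psi>_def mult.commute[of t])
    finally show ?thesis .
  qed
  have "(\<Prod>j=1..Suc m. gen_fun1 (x j)) = gen_fun1 (x (Suc m)) * formal_sum H \<phi>"
    using Suc.IH Suc.prems by (simp add: H_def \<phi>_def mult.commute)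
  also have "\<dots> = formal_sum H (\<lambda>k. gen_fun1 (x (Suc m)) * \<phi> k)"
    by (rule formal_sum_mult) (simp add: \<phi>_def graded_qbasis)
  also have "\<dots> = formal_sum H (\<lambda>k. formal_sum (h k) (\<lambda>j. \<psi> (k + j)))"
    by (simp add: one[symmetric] mult.commute)
  also have "\<dots> = formal_sum (\<lambda>l. \<Sum>k\<le>l. H k * h k (l - k)) \<psi>"
  proof (rule fps_ext)
    fix n
    have "formal_sum H (\<lambda>k. formal_sum (h k) (\<lambda>j. \<psi> (k + j))) $ n =
        (\<Sum>k\<le>n. \<Sum>j\<le>n. H k * h k j * \<psi> (k + j) $ n)"
      by (simp add: formal_sum_def sum_distrib_left mult.assoc)
    also have "\<dots> = (\<Sum>(k, j)\<in>{..n} \<times> {..n}. H k * h k j * \<psi> (k + j) $ n)"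
      by (simp add: sum.cartesian_product)
    also have "\<dots> = (\<Sum>(k, j)\<in>{(k, j). k + j \<le> n}. H k * h k j * \<psi> (k + j) $ n)"
      by (rule sum.mono_neutral_right) (auto, metis gr not_le)
    also have "\<dots> = (\<Sum>l\<le>n. \<Sum>k\<le>l. H k * h k (l - k) * \<psi> (k + (l - k)) $ n)"
      by (rule sum.triangle_reindex_eq)
    also have "\<dots> = formal_sum (\<lambda>l. \<Sum>k\<le>l. H k * h k (l - k)) \<psi> $ n"
      by (simp add: formal_sum_def sum_distrib_right)
    finally show "formal_sum H (\<lambda>k. formal_sum (h k) (\<lambda>j. \<psi> (k + j))) $ n =
       formal_sum (\<lambda>l. \<Sum>k\<le>l. H k * h k (l - k)) \<psi> $ n" .
  qed
  finally show ?case unfolding H_def h_def \<psi>_def hsum.simps .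
qed

end


section \<open>The residue theorem in algebraic form\<close>

text \<open>The leading coefficient in Lagrange's interpolation formula. Read as a statement about residues: those
  of \<open>N(x) / \<Prod>\<^bsub>p\<in>S\<^esub> (x - p)\<close> at the points of \<open>S\<close> add up to minus its residue at infinity.\<close>

lemma lagrange_sum:
  fixes N :: "'f::field poly"
  assumes "finite S" "degree N < card S"
  shows "(\<Sum>p\<in>S. poly N p / (\<Prod>r\<in>S - {p}. p - r)) = coeff N (card S - 1)"
proof -
  define B where "B p = (\<Prod>r\<in>S - {p}. [:-r, 1:])" for p :: 'f
  define w where "w p = poly N p / (\<Prod>r\<in>S - {p}. p - r)" for p
  define I where "I = (\<Sum>p\<in>S. smult (w p) (B p))"
  have poly_B: "poly (B p) x = (\<Prod>r\<in>S - {p}. x - r)" for p x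
    by (simp add: B_def poly_prod)
  have deg_B: "degree (B p) = card S - 1" if "p \<in> S" for p
    using assms(1) that by (simp add: B_def degree_prod_eq_sum_degree)
  have coeff_B: "coeff (B p) (card S - 1) = 1" if "p \<in> S" for p
  proof -
    have "lead_coeff (B p) = 1" by (simp add: B_def lead_coeff_prod)
    thus ?thesis by (simp add: deg_B that)
  qed
  have deg_I: "degree I < card S"
  proof -
    have "degree I \<le> card S - 1"
      unfolding I_def by (rule degree_sum_le[OF assms(1)]) (metis degree_smult_le deg_B)
    thus ?thesis using assms(2) by linarith
  qed
  have "poly I x = poly N x" if x: "x \<in> S" for x
  proof -
    have "poly I x = (\<Sum>p\<in>S. w p * (\<Prod>r\<in>S - {p}. x - r))"
      by (simp add: I_def poly_sum poly_B)
    also have "\<dots> = (\<Sum>p\<in>{x}. w p * (\<Prod>r\<in>S - {p}. x - r))"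
      using assms(1) x by (intro sum.mono_neutral_right) (auto intro: prod_zero)
    also have "\<dots> = poly N x"
      using assms(1) by (simp add: w_def prod_zero_iff)
    finally show ?thesis .
  qed
  hence "I = N" using deg_I assms(2) by (intro poly_eqI_degree[of S]) auto
  moreover have "coeff I (card S - 1) = (\<Sum>p\<in>S. w p)"
    unfolding I_def coeff_sum by (intro sum.cong refl) (simp only: coeff_smult coeff_B mult_1_right)
  ultimately show ?thesis by (simp add: w_def)
qed

text \<open>The residues of \<open>N(x) u / (x w(x) (1-tx\<^sup>2)(1-txu)(qx-u))\<close> at \<open>Y\<close>, at the five points
  \<open>0, s, -s, u/q, 1/(tu)\<close> and, on the right-hand side, at infinity.\<close>

lemma five_pole_residue_sum:
  fixes N :: "'f::field poly" and Y :: "'f set" and s t q u :: 'f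
  defines "p1 \<equiv> 1 / (t * u)" and "p2 \<equiv> u / q" and "w \<equiv> (\<lambda>p. \<Prod>y\<in>Y. 1 - p / y)"
  assumes Y: "finite Y" "0 \<notin> Y" "s \<notin> Y" "- s \<notin> Y" "p1 \<notin> Y" "p2 \<notin> Y"
    and nz: "t \<noteq> 0" "q \<noteq> 0" "u \<noteq> 0" and s: "t * s ^ 2 = 1" "s \<noteq> - s"
    and p: "p1 \<noteq> p2" "t * p1 ^ 2 \<noteq> 1" "t * p2 ^ 2 \<noteq> 1"
    and deg: "degree N \<le> card Y + 4"
  shows "(\<Sum>y\<in>Y. poly N y / (\<Prod>r\<in>Y - {y}. 1 - y / r) *
             (u / ((1 - t * y ^ 2) * (1 - t * y * u) * (q * y - u)))) +
         poly N 0 +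
         poly N s / w s * (u / (2 * (1 - t * s * u) * (q * s - u))) +
         poly N (-s) / w (-s) * (u / (2 * (1 - t * (-s) * u) * (q * (-s) - u))) -
         poly N p2 / w p2 / ((1 - t * p2 ^ 2) * (1 - t * p2 * u)) +
         poly N p1 / w p1 * (u / ((1 - t * p1 ^ 2) * (q * p1 - u))) =
         - coeff N (card Y + 4) * (\<Prod>y\<in>Y. - y) / (t ^ 2 * q)"
proof -
  define V where "V = (\<Prod>y\<in>Y. - y)"
  \<comment> \<open>\<open>\<kappa>\<close> relates the denominator as given to the monic one that Lagrange's formula requires\<close>
  define \<kappa> where "\<kappa> = - (t ^ 2 * q) / V"
  define X where "X = {0, s, - s, p2, p1}"
  define S where "S = Y \<union> X"
  define T where "T p = poly N p / (\<Prod>r\<in>S - {p}. p - r)" for p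
  have V: "V \<noteq> 0" using Y by (simp add: V_def prod_zero_iff)
  have \<kappa>: "\<kappa> \<noteq> 0" using V nz by (simp add: \<kappa>_def)
  have s0: "s \<noteq> 0" using s by auto
  have two: "(2::'f) \<noteq> 0" using s(2) s0 by (metis add_eq_0_iff mult_2 mult_eq_0_iff)
  have p0: "p1 \<noteq> 0" "p2 \<noteq> 0" using nz by (simp_all add: p1_def p2_def)
  have ps: "p1 \<noteq> s" "p1 \<noteq> - s" "p2 \<noteq> s" "p2 \<noteq> - s" using p s by auto
  have sq: "(y - s) * (y + s) = - (1 - t * y ^ 2) / t" for y
    using s(1) nz by (simp add: field_simps power2_eq_square)
  have d1: "y - p1 = - (1 - t * y * u) / (t * u)" for y
    using nz by (simp add: p1_def field_simps)
  have d2: "y - p2 = (q * y - u) / q" for y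
    using nz by (simp add: p2_def field_simps)
  have disj: "Y \<inter> X = {}" using Y by (auto simp: X_def)
  have finX: "finite X" by (simp add: X_def)
  have cardX: "card X = 5"
    using s0 s(2) p0 p(1) ps by (simp add: X_def)
  have cardS: "card S = card Y + 5"
    using Y(1) finX disj cardX by (simp add: S_def card_Un_disjoint)
  have prodY: "(\<Prod>r\<in>Y. p - r) = V * w p" for p
    unfolding V_def w_def prod.distrib[symmetric]
    using Y(2) by (intro prod.cong refl) (auto simp: field_simps)
  have prodX: "(\<Prod>r\<in>X. p - r) = p * (p - s) * (p + s) * (p - p2) * (p - p1)" for p
    using s0 s(2) p0 p(1) ps by (simp add: X_def mult.assoc)
  have split: "(\<Prod>r\<in>S - {x}. x - r) = V * w x * (\<Prod>r\<in>X - {x}. x - r)" if "x \<in> X" for x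
  proof -
    have "S - {x} = Y \<union> (X - {x})" "Y \<inter> (X - {x}) = {}" using that disj by (auto simp: S_def)
    thus ?thesis using Y(1) finX by (simp add: prod.union_disjoint prodY)
  qed
  have TY: "T y = \<kappa> * (poly N y / (\<Prod>r\<in>Y - {y}. 1 - y / r) *
             (u / ((1 - t * y ^ 2) * (1 - t * y * u) * (q * y - u))))" if y: "y \<in> Y" for y
  proof -
    define W where "W = (\<Prod>r\<in>Y - {y}. 1 - y / r)"
    have "S - {y} = (Y - {y}) \<union> X" "(Y - {y}) \<inter> X = {}" using y disj by (auto simp: S_def)
    hence "(\<Prod>r\<in>S - {y}. y - r) = (\<Prod>r\<in>Y - {y}. y - r) * (\<Prod>r\<in>X. y - r)"
      using Y(1) finX by (simp add: prod.union_disjoint)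
    also have "(\<Prod>r\<in>Y - {y}. y - r) = (\<Prod>r\<in>Y - {y}. - r) * W"
      unfolding W_def prod.distrib[symmetric]
      using Y(2) by (intro prod.cong refl) (auto simp: field_simps)
    also have "(\<Prod>r\<in>Y - {y}. - r) = V / (- y)"
    proof -
      have "y \<noteq> 0" using Y(2) y by auto
      thus ?thesis unfolding V_def prod.remove[OF Y(1) y] by simp
    qed
    also have "(\<Prod>r\<in>X. y - r) = y * ((y - s) * (y + s)) * (y - p2) * (y - p1)"
      by (simp add: prodX mult.assoc)
    finally have "(\<Prod>r\<in>S - {y}. y - r) = V / (- y) * W *
        (y * (- (1 - t * y ^ 2) / t) * ((q * y - u) / q) * (- (1 - t * y * u) / (t * u)))"
      by (simp only: sq d1 d2)
    also have "\<dots> = - V / (t ^ 2 * q) * (W * ((1 - t * y ^ 2) * (1 - t * y * u) * (q * y - u)) / u)"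
    proof -
      have "y \<noteq> 0" using Y(2) y by auto
      hence "V / (- y) * W * (y * (- A / t) * (D / q) * (- B / (t * u))) =
          - V / (t ^ 2 * q) * (W * (A * B * D) / u)" for A B D
        using nz by (simp add: power2_eq_square mult_ac)
      thus ?thesis .
    qed
    finally have e: "(\<Prod>r\<in>S - {y}. y - r) = \<dots>" .
    have "n / (- V / (t ^ 2 * q) * (W * Z / u)) = - (t ^ 2 * q) / V * (n / W * (u / Z))" for n Z
      using V nz by simp
    thus ?thesis unfolding T_def e W_def[symmetric] \<kappa>_def .
  qed
  have T0: "T 0 = \<kappa> * poly N 0"
  proof -
    have "X - {0} = {s, - s, p2, p1}" using s0 p0 by (auto simp: X_def)
    hence "(\<Prod>r\<in>X - {0}. 0 - r) = - (s ^ 2) * (p2 * p1)"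
      using s(2) p(1) ps by (simp add: power2_eq_square)
    also have "p2 * p1 = 1 / (t * q)" using nz by (simp add: p1_def p2_def)
    also have "s ^ 2 = 1 / t" using s(1) nz by (simp add: field_simps)
    finally have e: "(\<Prod>r\<in>X - {0}. 0 - r) = - (1 / t) * (1 / (t * q))" .
    have w0: "w 0 = 1" by (simp add: w_def)
    have "0 \<in> X" by (simp add: X_def)
    from split[OF this] show ?thesis
      using V nz unfolding T_def \<kappa>_def e w0 by (simp add: power2_eq_square)
  qed
  have Ts: "T \<sigma> = \<kappa> * (poly N \<sigma> / w \<sigma> * (u / (2 * (1 - t * \<sigma> * u) * (q * \<sigma> - u))))"
    if \<sigma>: "\<sigma> = s \<or> \<sigma> = - s" for \<sigma>
  proof -
    have \<sigma>2: "\<sigma> * \<sigma> = 1 / t" using \<sigma> s(1) nz by (auto simp: field_simps power2_eq_square)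
    have "X - {\<sigma>} = {0, - \<sigma>, p2, p1}" using \<sigma> s0 s(2) ps by (auto simp: X_def)
    moreover have "\<sigma> \<noteq> - \<sigma>" "\<sigma> \<noteq> 0" "p1 \<noteq> -\<sigma>" "p2 \<noteq> - \<sigma>" using \<sigma> s s0 ps by auto
    ultimately have "(\<Prod>r\<in>X - {\<sigma>}. \<sigma> - r) = \<sigma> * (\<sigma> + \<sigma>) * (\<sigma> - p2) * (\<sigma> - p1)"
      using p(1) p0 by (simp add: mult.assoc)
    also have "\<dots> = 2 * (\<sigma> * \<sigma>) * ((q * \<sigma> - u) / q) * (- (1 - t * \<sigma> * u) / (t * u))"
      unfolding d1 d2 by (simp add: algebra_simps)
    also have "\<dots> = - (1 / (t ^ 2 * q)) * (2 * (1 - t * \<sigma> * u) * (q * \<sigma> - u) / u)"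
      unfolding \<sigma>2 using nz by (simp add: field_simps power2_eq_square)
    finally have e: "(\<Prod>r\<in>X - {\<sigma>}. \<sigma> - r) = \<dots>" .
    have "\<sigma> \<in> X" using \<sigma> by (auto simp: X_def)
    have "n / (V * v * (- (1 / (t ^ 2 * q)) * (Z / u))) = - (t ^ 2 * q) / V * (n / v * (u / Z))" for n v Z
      using V nz by (simp add: mult_ac)
    thus ?thesis unfolding T_def \<kappa>_def split[OF \<open>\<sigma> \<in> X\<close>] e .
  qed
  have Tp2: "T p2 = \<kappa> * (- (poly N p2 / w p2 / ((1 - t * p2 ^ 2) * (1 - t * p2 * u))))"
  proof -
    have "X - {p2} = {0, s, - s, p1}" using p0 p(1) ps by (auto simp: X_def)
    hence "(\<Prod>r\<in>X - {p2}. p2 - r) = p2 * ((p2 - s) * (p2 + s)) * (p2 - p1)"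
      using s(2) ps p0 s0 by (simp add: mult.assoc)
    also have "\<dots> = p2 * (1 - t * p2 ^ 2) * (1 - t * p2 * u) / (t ^ 2 * u)"
      unfolding sq d1 by (simp add: power2_eq_square mult_ac minus_divide_left[symmetric] del: minus_diff_eq)
    also have "\<dots> = (1 - t * p2 ^ 2) * (1 - t * p2 * u) / (t ^ 2 * q)"
    proof -
      have "p2 * A / (t ^ 2 * u) = A / (t ^ 2 * q)" for A using nz by (simp add: p2_def)
      thus ?thesis by (simp add: mult.assoc)
    qed
    finally have e: "(\<Prod>r\<in>X - {p2}. p2 - r) = \<dots>" .
    have "n / (V * v * (A * B / (t ^ 2 * q))) = - (t ^ 2 * q) / V * (- (n / v / (A * B)))" for n v A B
      using V nz by (simp add: mult_ac)
    moreover have "p2 \<in> X" by (simp add: X_def)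
    ultimately show ?thesis unfolding T_def \<kappa>_def by (simp only: split e)
  qed
  have Tp1: "T p1 = \<kappa> * (poly N p1 / w p1 * (u / ((1 - t * p1 ^ 2) * (q * p1 - u))))"
  proof -
    have "X - {p1} = {0, s, - s, p2}" using p0 p(1) ps by (auto simp: X_def)
    hence "(\<Prod>r\<in>X - {p1}. p1 - r) = p1 * ((p1 - s) * (p1 + s)) * (p1 - p2)"
      using s(2) ps p0 s0 by (simp add: mult.assoc)
    also have "\<dots> = - (p1 * ((1 - t * p1 ^ 2) * (q * p1 - u)) / (t * q))"
    proof -
      have "p1 * (- A / t) * (B / q) = - (p1 * (A * B) / (t * q))" for A B by simp
      thus ?thesis unfolding sq d2 .
    qed
    also have "\<dots> = - ((1 - t * p1 ^ 2) * (q * p1 - u) / u / (t ^ 2 * q))"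
    proof -
      have "p1 * A / (t * q) = A / u / (t ^ 2 * q)" for A
        using nz by (simp add: p1_def power2_eq_square)
      thus ?thesis by simp
    qed
    finally have e: "(\<Prod>r\<in>X - {p1}. p1 - r) = \<dots>" .
    have "n / (V * v * (- (Z / u / (t ^ 2 * q)))) = - (t ^ 2 * q) / V * (n / v * (u / Z))" for n v Z
      using V nz by (simp add: mult_ac)
    moreover have "p1 \<in> X" by (simp add: X_def)
    ultimately show ?thesis unfolding T_def \<kappa>_def by (simp only: split e)
  qed
  have "(\<Sum>x\<in>S. T x) = coeff N (card S - 1)"
    unfolding T_def by (rule lagrange_sum) (use Y(1) finX deg cardS in \<open>auto simp: S_def\<close>)
  also have "card S - 1 = card Y + 4" by (simp add: cardS)
  also have "(\<Sum>x\<in>S. T x) = (\<Sum>y\<in>Y. T y) + (\<Sum>x\<in>X. T x)"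
    unfolding S_def using Y(1) finX disj by (rule sum.union_disjoint)
  also have "(\<Sum>x\<in>X. T x) = T 0 + T s + T (-s) + T p2 + T p1"
    using s0 s(2) p0 p(1) ps by (simp add: X_def add.assoc)
  finally have "\<kappa> * ((\<Sum>y\<in>Y. poly N y / (\<Prod>r\<in>Y - {y}. 1 - y / r) *
             (u / ((1 - t * y ^ 2) * (1 - t * y * u) * (q * y - u)))) +
         poly N 0 +
         poly N s / w s * (u / (2 * (1 - t * s * u) * (q * s - u))) +
         poly N (-s) / w (-s) * (u / (2 * (1 - t * (-s) * u) * (q * (-s) - u))) -
         poly N p2 / w p2 / ((1 - t * p2 ^ 2) * (1 - t * p2 * u)) +
         poly N p1 / w p1 * (u / ((1 - t * p1 ^ 2) * (q * p1 - u)))) = coeff N (card Y + 4)"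
    (is "\<kappa> * ?E = _")
  proof -
    assume e: "(\<Sum>y\<in>Y. T y) + (T 0 + T s + T (- s) + T p2 + T p1) = coeff N (card Y + 4)"
    have sumY: "(\<Sum>y\<in>Y. T y) = \<kappa> * (\<Sum>y\<in>Y. poly N y / (\<Prod>r\<in>Y - {y}. 1 - y / r) *
             (u / ((1 - t * y ^ 2) * (1 - t * y * u) * (q * y - u))))"
      unfolding sum_distrib_left by (rule sum.cong[OF refl TY])
    have ring: "\<kappa> * x1 + (\<kappa> * x2 + \<kappa> * x3 + \<kappa> * x4 + \<kappa> * (- x5) + \<kappa> * x6) =
        \<kappa> * (x1 + x2 + x3 + x4 - x5 + x6)" for x1 x2 x3 x4 x5 x6
      by (simp add: ring_distribs)
    show ?thesis
      using e unfolding sumY T0 Ts[OF disjI1[OF refl]] Ts[OF disjI2[OF refl]] Tp2 Tp1 ring .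
  qed
  hence "?E = coeff N (card Y + 4) / \<kappa>" using \<kappa> by (simp add: eq_divide_eq mult.commute)
  also have "\<dots> = - coeff N (card Y + 4) * V / (t ^ 2 * q)" by (simp add: \<kappa>_def)
  finally show ?thesis unfolding V_def .
qed


section \<open>The residue identity for the kernel function\<close>

text \<open>One factor of the residue at \<open>1/(tu)\<close>; \<open>e\<close> and \<open>f\<close> stand for the infinite products with argument \<open>qu\<close>.\<close>

lemma residue_factor_up:
  fixes t y u e f :: "'f::field"
  assumes "t \<noteq> 0" "y \<noteq> 0" "u \<noteq> 0" "1 - t * y * u \<noteq> 0" "1 - u / y \<noteq> 0"
  shows "(1 - t * y * (1 / (t * u))) / (1 - 1 / (t * u) / y) * ((1 - t * y * u) * e / ((1 - u / y) * f)) =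
    t * y * y * (e / f)"
proof -
  have 1: "1 - t * y * (1 / (t * u)) = - (y / u) * (1 - u / y)"
    using assms(1-3) by (simp add: field_simps)
  have 2: "1 - 1 / (t * u) / y = - (1 / (t * u * y)) * (1 - t * y * u)"
    using assms(1-3) by (simp add: field_simps)
  show ?thesis unfolding 1 2 using assms by simp
qed

lemma poly_four_linear:
  "poly ([:1, - a:] * [:1, - b:] * [:1, - c:] * [:1, - d:]) p =
     (1 - a * p) * (1 - b * p) * (1 - c * p) * (1 - (d::'f::comm_ring_1) * p)"
  by (simp only: poly_mult poly_pCons poly_0) (simp add: mult.commute)

lemma four_linear_coeffs:
  fixes a b c d :: "'f::field"
  assumes "a \<noteq> 0" "b \<noteq> 0" "c \<noteq> 0" "d \<noteq> 0"
  shows "degree ([:1, - a:] * [:1, - b:] * [:1, - c:] * [:1, - d:]) = 4"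
    and "lead_coeff ([:1, - a:] * [:1, - b:] * [:1, - c:] * [:1, - d:]) = a * b * c * d"
proof -
  have nz: "[:1, - x:] \<noteq> 0" for x :: 'f by simp
  have deg: "degree [:1, - x:] = 1" if "x \<noteq> 0" for x :: 'f using that by simp
  have lc: "lead_coeff [:1, - x:] = - x" if "x \<noteq> 0" for x :: 'f using that by simp
  show "degree ([:1, - a:] * [:1, - b:] * [:1, - c:] * [:1, - d:]) = 4"
    by (subst degree_mult_eq degree_mult_eq, (simp only: mult_eq_0_iff nz simp_thms)+)+
       (simp add: deg assms)
  show "lead_coeff ([:1, - a:] * [:1, - b:] * [:1, - c:] * [:1, - d:]) = a * b * c * d"
    unfolding lead_coeff_mult lc[OF assms(1)] lc[OF assms(2)] lc[OF assms(3)] lc[OF assms(4)] by simp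
qed

lemma mult_inverse_power2_eq_1D:
  fixes t u :: "'f::field"
  assumes "t \<noteq> 0" "t * (1 / (t * u)) ^ 2 = 1"
  shows "t * u ^ 2 = 1"
proof -
  have "t * (1 / (t * u)) ^ 2 = 1 / (t * u ^ 2)"
    using assms(1) by (simp add: power2_eq_square)
  thus ?thesis using assms(2) by (metis div_by_1 divide_divide_eq_right mult_1 nonzero_eq_divide_eq zero_neq_one div_0 divide_eq_0_iff)
qed

lemma fls_X_neq_const: "(fls_X :: 'k::field fls) \<noteq> fls_const c"
proof
  assume "(fls_X :: 'k fls) = fls_const c"
  hence "fls_nth (fls_X :: 'k fls) 1 = fls_nth (fls_const c) 1" by simp
  thus False by simp
qed

lemma fls_X_power2_neq_const: "(fls_X :: 'k::field fls) ^ 2 \<noteq> fls_const c"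
proof
  assume "(fls_X :: 'k fls) ^ 2 = fls_const c"
  hence "fls_nth ((fls_X :: 'k fls) ^ 2) 2 = fls_nth (fls_const c) 2" by simp
  thus False by simp
qed

lemma fls_const_mult_X_neq: "fls_const x * fls_X \<noteq> fls_const (y::'k::field)" if "x \<noteq> 0"
proof
  assume e: "fls_const x * fls_X = fls_const y"
  have "fls_const (1 / x) * (fls_const x * fls_X) = (fls_X :: 'k fls)"
    unfolding mult.assoc[symmetric] fls_const_mult_const using that by simp
  hence "fls_X = fls_const (y / x)" by (simp add: e)
  thus False using fls_X_neq_const by blast
qed

lemma fls_const_divide: "fls_const (x / y) = fls_const x / fls_const (y::'k::field)"
  by (simp add: fls_const_divide_const)

lemma fls_const_prod: "fls_const (\<Prod>i\<in>A. f i) = (\<Prod>i\<in>A. fls_const (f i :: 'k::field))"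
  by (induction A rule: infinite_finite_induct) (simp_all flip: fls_const_mult_const)

lemma fps_to_fls_prod: "fps_to_fls (\<Prod>i\<in>A. f i) = (\<Prod>i\<in>A. fps_to_fls (f i :: 'k::field fps))"
  by (induction A rule: infinite_finite_induct) (simp_all add: fls_times_fps_to_fls)

text \<open>The parameter \<open>al\<close> is \<open>(abcd/q)\<^bsup>1/2\<^esup>\<close> and \<open>s\<close> is \<open>t\<^bsup>-1/2\<^esup>\<close>; that \<open>s \<noteq> -s\<close> excludes characteristic two. The
  field will be the field of rational functions in \<open>z\<close>.\<close>

locale koornwinder_field = q_field q t for q t :: "'k::field" +
  fixes a b c d al s :: 'k
  assumes abcd_nz: "a \<noteq> 0" "b \<noteq> 0" "c \<noteq> 0" "d \<noteq> 0"
    and al: "al ^ 2 = a * b * c * d / q"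
    and s: "t * s ^ 2 = 1" "s \<noteq> - s"
begin

abbreviation C :: "'k \<Rightarrow> 'k fls" where "C \<equiv> fls_const"
abbreviation U :: "'k fls" where "U \<equiv> fls_X"

definition quartic :: "'k \<Rightarrow> 'k" where
  "quartic x = (1 - a * x) * (1 - b * x) * (1 - c * x) * (1 - d * x)"

definition quartic_fls :: "'k fls \<Rightarrow> 'k fls" where
  "quartic_fls x = (1 - C a * x) * (1 - C b * x) * (1 - C c * x) * (1 - C d * x)"

text \<open>The term of the residue identity that belongs to \<open>y \<in> Y\<close> is \<open>res_coeff Y y\<close>, which is free of \<open>u\<close>, times
  the rational function \<open>pole y\<close> of \<open>u\<close>.\<close>

definition res_coeff :: "'k set \<Rightarrow> 'k \<Rightarrow> 'k" where
  "res_coeff Y y = quartic y * (\<Prod>r\<in>Y - {y}. (1 - t * y * r) / (1 - y / r))"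

definition pole :: "'k \<Rightarrow> 'k fls" where
  "pole y = U / ((1 - C (t * y) * U) * (C (q * y) - U))"

text \<open>The series \<open>G\<^sub>Y(u)\<close>.\<close>

definition kernel :: "'k set \<Rightarrow> 'k fps" where
  "kernel Y = (\<Prod>y\<in>Y. qpoch (t * y) * inverse (qpoch (1 / y)))"

text \<open>The contributions of the poles \<open>\<plusminus>s\<close> together (\<open>res0\<close>), of \<open>u/q\<close> (\<open>res_down\<close>) and of \<open>1/(tu)\<close>
  (\<open>res_up\<close>), each without the value of \<open>\<Prod>\<^bsub>y\<in>Y\<^esub> (1-txy)/(1-x/y)\<close> at the pole. They are rational
  functions of \<open>u\<close> that do not depend on \<open>Y\<close>.\<close>

definition res0 :: "'k fls" where
  "res0 = quartic_fls (C s) * (U / (2 * (1 - C (t * s) * U) * (C (q * s) - U))) +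
     quartic_fls (C (- s)) * (U / (2 * (1 - C (t * (- s)) * U) * (C (q * (- s)) - U)))"

definition res_down :: "'k fls" where
  "res_down = - (quartic_fls (U / C q) / ((1 - C t * (U / C q) ^ 2) * (1 - C t * (U / C q) * U)))"

definition res_up :: "'k fls" where
  "res_up = quartic_fls (1 / (C t * U)) *
     (U / ((1 - C t * (1 / (C t * U)) ^ 2) * (C q * (1 / (C t * U)) - U)))"

lemma qpoch_fls_rec:
  "fps_to_fls (qpoch x) = (1 - C x * U) * fps_to_fls (qpoch (q * x))"
  by (subst qpoch_rec) (simp add: fls_times_fps_to_fls)

lemma fps_to_fls_inverse_qpoch: "fps_to_fls (inverse (qpoch x)) = inverse (fps_to_fls (qpoch x))"
proof -
  have "subdegree (qpoch x) = 0" by (simp add: subdegree_eq_0_iff)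
  thus ?thesis by (simp add: fls_inverse_fps_to_fls)
qed

lemma one_minus_CU_nz: "1 - C x * U \<noteq> 0"
proof (cases "x = 0")
  case False
  thus ?thesis using fls_const_mult_X_neq[of x 1] by (metis fls_const_1 right_minus_eq)
qed simp

lemma C_minus_U_nz: "C x - U \<noteq> 0"
  using fls_X_neq_const[of x] by (metis right_minus_eq)

lemma kernel_dilate_fls:
  "fps_to_fls (dilate \<sigma> (kernel Y)) =
     (\<Prod>y\<in>Y. fps_to_fls (qpoch (\<sigma> * (t * y))) / fps_to_fls (qpoch (\<sigma> * (1 / y))))"
  by (simp add: kernel_def dilate_prod dilate_mult dilate_inverse dilate_qpoch fps_to_fls_prod
      fls_times_fps_to_fls fps_to_fls_inverse_qpoch divide_inverse)

lemma kernel_fls: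
  "fps_to_fls (kernel Y) = (\<Prod>y\<in>Y. fps_to_fls (qpoch (t * y)) / fps_to_fls (qpoch (1 / y)))"
  by (simp add: kernel_def fps_to_fls_prod
      fls_times_fps_to_fls fps_to_fls_inverse_qpoch divide_inverse)

text \<open>At \<open>x = 1/(tu)\<close> the product \<open>\<Prod>\<^bsub>y\<in>Y\<^esub> (1-txy)/(1-x/y)\<close> is, up to a constant, the quotient
  \<open>G\<^sub>Y(qu)/G\<^sub>Y(u)\<close>; at \<open>x = u/q\<close> it is \<open>G\<^sub>Y(u/q)/G\<^sub>Y(u)\<close>.\<close>

lemma kernel_dilate_up:
  assumes "0 \<notin> Y"
  shows "(\<Prod>y\<in>Y. (1 - C (t * y) * (1 / (C t * U))) / (1 - 1 / (C t * U) / C y)) * fps_to_fls (kernel Y) =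
    C (\<Prod>y\<in>Y. t * y ^ 2) * fps_to_fls (dilate q (kernel Y))"
  unfolding kernel_fls kernel_dilate_fls fls_const_prod prod.distrib[symmetric]
proof (rule prod.cong[OF refl])
  fix y assume "y \<in> Y"
  hence y: "C y \<noteq> 0" "y \<noteq> 0" using assms by auto
  have 1: "fps_to_fls (qpoch (t * y)) = (1 - C t * C y * U) * fps_to_fls (qpoch (q * (t * y)))"
    by (subst qpoch_fls_rec) simp
  have 2: "fps_to_fls (qpoch (1 / y)) = (1 - U / C y) * fps_to_fls (qpoch (q * (1 / y)))"
    by (subst qpoch_fls_rec) (simp add: fls_const_divide)
  have nz2: "1 - C t * C y * U \<noteq> 0" using one_minus_CU_nz[of "t * y"] by simp
  have nz3: "1 - U / C y \<noteq> 0" using one_minus_CU_nz[of "1 / y"] by (simp add: fls_const_divide)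
  show "(1 - C (t * y) * (1 / (C t * U))) / (1 - 1 / (C t * U) / C y) *
        (fps_to_fls (qpoch (t * y)) / fps_to_fls (qpoch (1 / y))) =
      C (t * y ^ 2) * (fps_to_fls (qpoch (q * (t * y))) / fps_to_fls (qpoch (q * (1 / y))))"
    unfolding 1 2 power2_eq_square mult.assoc[symmetric] fls_const_mult_const[symmetric]
    by (rule residue_factor_up) (use nz2 nz3 y in simp_all)
qed

lemma kernel_dilate_down:
  assumes "0 \<notin> Y"
  shows "(\<Prod>y\<in>Y. (1 - C (t * y) * (U / C q)) / (1 - U / C q / C y)) * fps_to_fls (kernel Y) =
    fps_to_fls (dilate (1 / q) (kernel Y))"
  unfolding kernel_fls kernel_dilate_fls prod.distrib[symmetric]
proof (rule prod.cong[OF refl])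
  fix y assume "y \<in> Y"
  hence y: "C y \<noteq> 0" "y \<noteq> 0" using assms by auto
  have 1: "fps_to_fls (qpoch (1 / q * (t * y))) = (1 - C (t * y) * (U / C q)) * fps_to_fls (qpoch (t * y))"
    by (subst qpoch_fls_rec) (simp add: fls_const_divide)
  have 2: "fps_to_fls (qpoch (1 / q * (1 / y))) = (1 - U / C q / C y) * fps_to_fls (qpoch (1 / y))"
    by (subst qpoch_fls_rec) (simp add: fls_const_divide mult.commute)
  show "(1 - C (t * y) * (U / C q)) / (1 - U / C q / C y) *
        (fps_to_fls (qpoch (t * y)) / fps_to_fls (qpoch (1 / y))) =
      fps_to_fls (qpoch (1 / q * (t * y))) / fps_to_fls (qpoch (1 / q * (1 / y)))"
    unfolding 1 2 by simp
qed

text \<open>The residue theorem for \<open>N(x) = (1-ax)(1-bx)(1-cx)(1-dx) \<Prod>\<^bsub>y\<in>Y\<^esub> (1-txy)\<close>, multiplied by \<open>G\<^sub>Y\<close>. At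
  \<open>x = \<plusminus>s\<close> one has \<open>(1-txy)/(1-x/y) = -y/x\<close>, so that the value of the product at both points is \<open>\<tau>\<close>. The
  assumptions on \<open>\<tau>\<close> hold for \<open>Y = {z\<^sub>i, 1/z\<^sub>i}\<close> with \<open>\<tau> = t\<^sup>m\<close>, and for a two-element \<open>Y\<close> with \<open>\<tau>\<close> equal to
  \<open>t\<close> times the product of its elements.\<close>

theorem kernel_residue_identity:
  assumes Y: "finite Y" "0 \<notin> Y" "s \<notin> Y" "- s \<notin> Y"
    and \<tau>: "(\<Prod>y\<in>Y. - (y / s)) = \<tau>" "(\<Prod>y\<in>Y. y / s) = \<tau>" "(\<Prod>y\<in>Y. t * y ^ 2) = \<tau> ^ 2"
  shows "((\<Sum>y\<in>Y. C (res_coeff Y y) * pole y) + 1 + C \<tau> * res0 + C (al ^ 2 * \<tau> ^ 2 / t ^ 2)) *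
      fps_to_fls (kernel Y) + res_down * fps_to_fls (dilate (1 / q) (kernel Y)) +
      C (\<tau> ^ 2) * res_up * fps_to_fls (dilate q (kernel Y)) = 0"
proof -
  define N4 where "N4 = [:1, - C a:] * [:1, - C b:] * [:1, - C c:] * [:1, - C d:]"
  define NY where "NY = (\<Prod>y\<in>Y. [:1, - C (t * y):])"
  define N where "N = N4 * NY"
  define p1 where "p1 = 1 / (C t * U)"
  define p2 where "p2 = U / C q"
  define w where "w p = (\<Prod>y\<in>C ` Y. 1 - p / y)" for p
  define \<psi> where "\<psi> p = (\<Prod>y\<in>Y. (1 - C (t * y) * p) / (1 - p / C y))" for p
  have injC: "inj_on C A" for A by (rule inj_onI) (metis fls_const_nth)
  have Ynz: "y \<in> Y \<Longrightarrow> y \<noteq> 0" for y using Y by auto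
  have s0: "s \<noteq> 0" using s by auto
  have polyN4: "poly N4 p = quartic_fls p" for p
    unfolding N4_def quartic_fls_def by (rule poly_four_linear)
  have degN4: "degree N4 = 4" and lcN4: "lead_coeff N4 = C (a * b * c * d)"
    unfolding N4_def fls_const_mult_const[symmetric]
    by (rule four_linear_coeffs; use abcd_nz in simp)+
  have degNY: "degree NY = card Y"
    using Ynz unfolding NY_def by (simp add: degree_prod_eq_sum_degree)
  have lcNY: "lead_coeff NY = (\<Prod>y\<in>Y. - C (t * y))"
    unfolding NY_def lead_coeff_prod using Ynz by (intro prod.cong refl) simp
  have cardY: "card (C ` Y) = card Y" by (rule card_image[OF injC])
  have degN: "degree N \<le> card (C ` Y) + 4"
    unfolding N_def cardY using degree_mult_le[of N4 NY] by (simp add: degN4 degNY)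
  have coeffN: "coeff N (card (C ` Y) + 4) = C (a * b * c * d) * (\<Prod>y\<in>Y. - C (t * y))"
    using coeff_mult_degree_sum[of N4 NY] lcN4 lcNY
    by (simp add: N_def cardY degN4 degNY add.commute)
  have polyN: "poly N p / w p = quartic_fls p * \<psi> p" for p
    unfolding N_def w_def NY_def \<psi>_def
    by (simp add: polyN4 poly_prod prod.reindex[OF injC] prod_dividef mult.commute)
  have five: "(\<Sum>y\<in>C ` Y. poly N y / (\<Prod>r\<in>C ` Y - {y}. 1 - y / r) *
             (U / ((1 - C t * y ^ 2) * (1 - C t * y * U) * (C q * y - U)))) +
         poly N 0 +
         poly N (C s) / w (C s) * (U / (2 * (1 - C t * C s * U) * (C q * C s - U))) +
         poly N (- C s) / w (- C s) * (U / (2 * (1 - C t * (- C s) * U) * (C q * (- C s) - U))) -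
         poly N p2 / w p2 / ((1 - C t * p2 ^ 2) * (1 - C t * p2 * U)) +
         poly N p1 / w p1 * (U / ((1 - C t * p1 ^ 2) * (C q * p1 - U))) =
         - coeff N (card (C ` Y) + 4) * (\<Prod>y\<in>C ` Y. - y) / ((C t) ^ 2 * C q)"
    unfolding w_def p1_def p2_def
  proof (rule five_pole_residue_sum)
    show "finite (C ` Y)" using Y by simp
    show "0 \<notin> C ` Y" using Ynz by auto
    show "C s \<notin> C ` Y" "- C s \<notin> C ` Y"
      using Y(3,4) injC[of UNIV] by (auto simp: inj_on_def simp flip: fls_const_uminus)
    show "1 / (C t * U) \<notin> C ` Y"
    proof
      assume "1 / (C t * U) \<in> C ` Y"
      then obtain y where "y \<in> Y" "1 / (C t * U) = C y" by auto
      hence "1 - C (t * y) * U = 0" by (simp add: field_simps flip: fls_const_mult_const)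
      thus False using one_minus_CU_nz by blast
    qed
    show "U / C q \<notin> C ` Y"
    proof
      assume "U / C q \<in> C ` Y"
      then obtain y where "y \<in> Y" "U / C q = C y" by auto
      hence "C (q * y) - U = 0" by (simp add: field_simps flip: fls_const_mult_const)
      thus False using C_minus_U_nz by blast
    qed
    show "C t \<noteq> 0" "C q \<noteq> 0" "U \<noteq> 0" by simp_all
    show "C t * (C s)\<^sup>2 = 1" using s(1) by (simp flip: fls_const_power)
    show "C s \<noteq> - C s" using s(2) injC[of UNIV] by (metis fls_const_uminus injD)
    have X2: "C x * U ^ 2 \<noteq> C y" if "x \<noteq> 0" for x y
    proof
      assume "C x * U ^ 2 = C y"
      hence "U ^ 2 = C (y / x)" using that by (simp add: field_simps fls_const_divide)
      thus False using fls_X_power2_neq_const by blast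
    qed
    show "1 / (C t * U) \<noteq> U / C q"
    proof
      assume "1 / (C t * U) = U / C q"
      hence "C t * U ^ 2 = C q" by (simp add: field_simps power2_eq_square)
      thus False using X2 by auto
    qed
    show "C t * (1 / (C t * U))\<^sup>2 \<noteq> 1"
    proof
      assume "C t * (1 / (C t * U))\<^sup>2 = 1"
      hence "C t * U ^ 2 = C 1" using mult_inverse_power2_eq_1D[of "C t" U] by simp
      thus False using X2[of t 1] by auto
    qed
    show "C t * (U / C q)\<^sup>2 \<noteq> 1"
    proof
      assume "C t * (U / C q)\<^sup>2 = 1"
      hence "C t * U ^ 2 = C (q * q)" by (simp add: field_simps power2_eq_square)
      thus False using X2 by auto
    qed
    show "degree N \<le> card (C ` Y) + 4" by (rule degN)
  qed
  have t1: "(\<Sum>y\<in>C ` Y. poly N y / (\<Prod>r\<in>C ` Y - {y}. 1 - y / r) *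
             (U / ((1 - C t * y ^ 2) * (1 - C t * y * U) * (C q * y - U)))) =
      (\<Sum>y\<in>Y. C (res_coeff Y y) * pole y)"
    unfolding sum.reindex[OF injC] o_def
  proof (rule sum.cong[OF refl])
    fix y assume y: "y \<in> Y"
    have "C ` Y - {C y} = C ` (Y - {y})" using injC[of UNIV] by (auto simp: inj_on_def)
    hence "(\<Prod>r\<in>C ` Y - {C y}. 1 - C y / r) = (\<Prod>r\<in>Y - {y}. 1 - C y / C r)"
      by (simp add: prod.reindex[OF injC])
    also have "\<dots> = C (\<Prod>r\<in>Y - {y}. 1 - y / r)"
      unfolding fls_const_prod by (simp add: fls_const_divide flip: fls_minus_const)
    finally have e1: "(\<Prod>r\<in>C ` Y - {C y}. 1 - C y / r) = C (\<Prod>r\<in>Y - {y}. 1 - y / r)" .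
    have e2: "quartic_fls (C y) = C (quartic y)"
      by (simp add: quartic_fls_def quartic_def flip: fls_minus_const fls_const_mult_const)
    have "poly N (C y) = C (quartic y) * (\<Prod>r\<in>Y. 1 - C (t * r) * C y)"
      by (simp add: N_def polyN4 e2 NY_def poly_prod mult.commute)
    also have "(\<Prod>r\<in>Y. 1 - C (t * r) * C y) = C (\<Prod>r\<in>Y. 1 - t * y * r)"
      unfolding fls_const_prod by (simp add: ac_simps flip: fls_minus_const)
    finally have e3: "poly N (C y) = C (quartic y * ((1 - t * y ^ 2) * (\<Prod>r\<in>Y - {y}. 1 - t * y * r)))"
      using Y(1) y by (subst (asm) prod.remove) (simp_all add: power2_eq_square mult.assoc)
    have nz: "1 - t * y ^ 2 \<noteq> 0"
    proof
      assume "1 - t * y ^ 2 = 0"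
      hence "t * y ^ 2 = t * s ^ 2" using s(1) by simp
      hence "y = s \<or> y = - s" by (simp add: power2_eq_iff)
      thus False using Y y by auto
    qed
    have e4: "1 - C t * C y ^ 2 = C (1 - t * y ^ 2)"
      by (simp add: power2_eq_square mult.assoc flip: fls_minus_const fls_const_power)
    have e5: "res_coeff Y y = quartic y * (\<Prod>r\<in>Y - {y}. 1 - t * y * r) / (\<Prod>r\<in>Y - {y}. 1 - y / r)"
      by (simp add: res_coeff_def prod_dividef)
    have nzC: "C (1 - t * y ^ 2) \<noteq> 0" using nz by (simp only: fls_const_eq_0_iff) simp
    define K where "K = C (1 - t * y ^ 2)"
    define R where "R = C (quartic y * (\<Prod>r\<in>Y - {y}. 1 - t * y * r))"
    define W where "W = C (\<Prod>r\<in>Y - {y}. 1 - y / r)"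
    have e6: "poly N (C y) = R * K"
      unfolding e3 R_def K_def fls_const_mult_const by (simp only: mult_ac)
    have e7: "C (res_coeff Y y) = R / W" unfolding e5 R_def W_def fls_const_divide ..
    show "poly N (C y) / (\<Prod>r\<in>C ` Y - {C y}. 1 - C y / r) *
        (U / ((1 - C t * C y ^ 2) * (1 - C t * C y * U) * (C q * C y - U))) =
        C (res_coeff Y y) * pole y"
      unfolding e1 e4 e6 e7 pole_def K_def[symmetric] W_def[symmetric] fls_const_mult_const
      using nzC unfolding K_def[symmetric] by simp
  qed
  have t0: "poly N 0 = 1"
    by (simp add: N_def N4_def NY_def poly_prod)
  have \<psi>\<sigma>: "\<psi> (C \<sigma>) = C (\<Prod>y\<in>Y. - (y / \<sigma>))" if \<sigma>: "\<sigma> = s \<or> \<sigma> = - s" for \<sigma>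
    unfolding \<psi>_def fls_const_prod
  proof (rule prod.cong[OF refl])
    fix y assume y: "y \<in> Y"
    have "\<sigma> \<noteq> 0" "y \<noteq> 0" "1 - \<sigma> / y \<noteq> 0" using \<sigma> s0 Ynz[OF y] Y y by auto
    moreover have "t * y * \<sigma> = y / \<sigma>"
      using \<sigma> s(1) s0 by (auto simp: field_simps power2_eq_square)
    ultimately have "(1 - t * y * \<sigma>) / (1 - \<sigma> / y) = - (y / \<sigma>)"
      by (simp add: field_simps)
    hence "C ((1 - t * y * \<sigma>) / (1 - \<sigma> / y)) = C (- (y / \<sigma>))" by simp
    thus "(1 - C (t * y) * C \<sigma>) / (1 - C \<sigma> / C y) = C (- (y / \<sigma>))"
      by (simp add: fls_const_divide flip: fls_minus_const)
  qed
  have ps: "\<psi> (C s) = C \<tau>" "\<psi> (- C s) = C \<tau>"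
    using \<psi>\<sigma>[of s] \<psi>\<sigma>[of "- s"] \<tau>(1,2) by simp_all
  have rhs: "- coeff N (card (C ` Y) + 4) * (\<Prod>y\<in>C ` Y. - y) / ((C t) ^ 2 * C q) =
      - C (al ^ 2 * \<tau> ^ 2 / t ^ 2)"
  proof -
    have "(\<Prod>y\<in>Y. - C (t * y)) * (\<Prod>y\<in>C ` Y. - y) = C (\<tau> ^ 2)"
      unfolding \<tau>(3)[symmetric] prod.reindex[OF injC] o_def prod.distrib[symmetric] fls_const_prod
      by (simp add: power2_eq_square mult.assoc)
    hence "coeff N (card (C ` Y) + 4) * (\<Prod>y\<in>C ` Y. - y) = C (a * b * c * d) * C (\<tau> ^ 2)"
      unfolding coeffN mult.assoc by simp
    hence "- coeff N (card (C ` Y) + 4) * (\<Prod>y\<in>C ` Y. - y) / ((C t) ^ 2 * C q) =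
        - (C (a * b * c * d) * C (\<tau> ^ 2) / ((C t) ^ 2 * C q))"
      by (simp only: mult_minus_left minus_divide_left)
    also have "\<dots> = - C (a * b * c * d * \<tau> ^ 2 / (t ^ 2 * q))"
      by (simp only: fls_const_divide fls_const_mult_const fls_const_power[symmetric])
    also have "a * b * c * d * \<tau> ^ 2 / (t ^ 2 * q) = al ^ 2 * \<tau> ^ 2 / t ^ 2"
      unfolding al by simp
    finally show ?thesis .
  qed
  define R where "R = (\<Sum>y\<in>Y. C (res_coeff Y y) * pole y)"
  have main: "R + 1 + C \<tau> * res0 + res_down * \<psi> p2 + res_up * \<psi> p1 =
      - C (al ^ 2 * \<tau> ^ 2 / t ^ 2)"
  proof -
    define k1 where "k1 = U / (2 * (1 - C t * C s * U) * (C q * C s - U))"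
    define k2 where "k2 = U / (2 * (1 - C t * (- C s) * U) * (C q * (- C s) - U))"
    define k3 where "k3 = (1 - C t * p2 ^ 2) * (1 - C t * p2 * U)"
    define k4 where "k4 = U / ((1 - C t * p1 ^ 2) * (C q * p1 - U))"
    have r0: "res0 = quartic_fls (C s) * k1 + quartic_fls (- C s) * k2"
      by (simp add: res0_def k1_def k2_def)
    have rd: "res_down = - (quartic_fls p2 / k3)" unfolding res_down_def p2_def k3_def ..
    have ru: "res_up = quartic_fls p1 * k4" unfolding res_up_def p1_def k4_def ..
    have ring: "R' + 1 + T * (v * x1 + v' * x2) + - (w' / x3) * y + (z * x4) * y' =
        R' + 1 + v * T * x1 + v' * T * x2 - w' * y / x3 + z * y' * x4"
      for R' T v v' w' y z y' x1 x2 x3 x4 :: "'k fls" by (simp add: ring_distribs mult_ac)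
    show ?thesis
      using five unfolding t1 t0 polyN ps rhs R_def[symmetric] k1_def[symmetric] k2_def[symmetric]
        k3_def[symmetric] k4_def[symmetric] r0 rd ru ring .
  qed
  have up: "\<psi> p1 * fps_to_fls (kernel Y) = C (\<tau> ^ 2) * fps_to_fls (dilate q (kernel Y))"
    using kernel_dilate_up[OF Y(2)] by (simp add: \<psi>_def p1_def \<tau>(3))
  have down: "\<psi> p2 * fps_to_fls (kernel Y) = fps_to_fls (dilate (1 / q) (kernel Y))"
    using kernel_dilate_down[OF Y(2)] by (simp add: \<psi>_def p2_def)
  have "(R + 1 + C \<tau> * res0 + C (al ^ 2 * \<tau> ^ 2 / t ^ 2)) * fps_to_fls (kernel Y) +
      res_down * (\<psi> p2 * fps_to_fls (kernel Y)) + res_up * (\<psi> p1 * fps_to_fls (kernel Y)) =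
      (R + 1 + C \<tau> * res0 + res_down * \<psi> p2 + res_up * \<psi> p1 + C (al ^ 2 * \<tau> ^ 2 / t ^ 2)) *
        fps_to_fls (kernel Y)"
    by (simp only: ring_distribs mult.assoc ac_simps)
  also have "\<dots> = 0" unfolding main by simp
  finally show ?thesis unfolding up down R_def by (simp only: mult_ac)
qed

end


section \<open>The operator on the generating function\<close>

text \<open>The partial fraction by which shifting one variable in its generating function produces the rational
  function \<open>pole\<close>.\<close>

lemma shift_ratio:
  fixes t q x u :: "'f::field"
  assumes "q \<noteq> 0" "x \<noteq> 0" "1 - t * x * u \<noteq> 0" "q * x - u \<noteq> 0"
  shows "(1 - x * u) * (1 - t / (q * x) * u) / ((1 - t * x * u) * (1 - 1 / (q * x) * u)) - 1 =
    (1 - t) * (1 - q * x ^ 2) * (u / ((1 - t * x * u) * (q * x - u)))"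
proof -
  have 1: "1 - 1 / (q * x) * u = (q * x - u) / (q * x)"
    using assms(1,2) by (simp add: field_simps)
  have 2: "1 - t / (q * x) * u = (q * x - t * u) / (q * x)"
    using assms(1,2) by (simp add: field_simps)
  have "(1 - x * u) * (1 - t / (q * x) * u) / ((1 - t * x * u) * (1 - 1 / (q * x) * u)) =
      (1 - x * u) * (q * x - t * u) / ((1 - t * x * u) * (q * x - u))"
    unfolding 1 2 using assms(1,2) by simp
  also have "\<dots> - 1 = ((1 - x * u) * (q * x - t * u) - (1 - t * x * u) * (q * x - u)) /
      ((1 - t * x * u) * (q * x - u))"
    using assms(3,4) by (simp add: diff_divide_distrib)
  also have "(1 - x * u) * (q * x - t * u) - (1 - t * x * u) * (q * x - u) =
      (1 - t) * (1 - q * x ^ 2) * u"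
    by (simp add: algebra_simps power2_eq_square)
  finally show ?thesis by simp
qed

lemma fls_eventually_fps:
  fixes f :: "'k::field fls"
  obtains k P where "fls_X ^ k * f = fps_to_fls P"
proof (cases "f = 0")
  case True
  thus ?thesis using that[of 0 0] by simp
next
  case False
  define k where "k = nat (- fls_subdegree f)"
  have "fls_subdegree (fls_X ^ k * f) \<ge> 0"
    using False by (simp add: k_def fls_subdegree_mult fls_subdegree_pow)
  hence "fps_to_fls (fls_regpart (fls_X ^ k * f)) = fls_X ^ k * f"
    by (rule fls_regpart_to_fls_trivial)
  thus ?thesis by (rule that[OF sym])
qed

lemma graded_dilate: "graded_family \<phi> \<Longrightarrow> graded_family (\<lambda>l. dilate s (\<phi> l))"
  by (simp add: graded_family_def)

context koornwinder_field
begin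

abbreviation fl :: "'k fps \<Rightarrow> 'k fls" where "fl \<equiv> fps_to_fls"

lemma al_nz [simp]: "al \<noteq> 0"
  using al abcd_nz by auto

lemma s_nz [simp]: "s \<noteq> 0"
  using s by auto

lemma eq_pm_s_iff: "y = s \<or> y = - s \<longleftrightarrow> t * y ^ 2 = 1"
proof -
  have "t * y ^ 2 = 1 \<longleftrightarrow> t * y ^ 2 = t * s ^ 2" using s by simp
  thus ?thesis by (simp add: power2_eq_iff)
qed

text \<open>The \<open>q\<close>-difference operator in \<open>u\<close> obtained by solving the residue identity with \<open>\<tau> = B\<close> for
  the terms that belong to \<open>Y\<close>.\<close>

definition dual_op :: "'k \<Rightarrow> 'k fps \<Rightarrow> 'k fls" where
  "dual_op B X = - ((1 + C B * res0 + C (al ^ 2 * B ^ 2 / t ^ 2)) * fl X +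
     res_down * fl (dilate (1 / q) X) + C (B ^ 2) * res_up * fl (dilate q X))"

text \<open>For \<open>B = t\<^sup>m\<close> the nodes are \<open>t\<^bsup>m-1\<^esup>aq\<^sup>l\<close>.\<close>

definition node :: "'k \<Rightarrow> nat \<Rightarrow> 'k" where
  "node B l = B * a * q ^ l / t"

definition raise_coeff :: "'k \<Rightarrow> nat \<Rightarrow> 'k" where
  "raise_coeff B l = (1 - b * node B l) * (1 - c * node B l) * (1 - d * node B l) *
     (1 - B * q ^ l) / (q ^ l * (q * node B l))"

definition eigen_coeff :: "'k \<Rightarrow> nat \<Rightarrow> 'k" where
  "eigen_coeff B l = (1 / q ^ l - 1) + al ^ 2 * B ^ 2 / t ^ 2 * (q ^ l - 1)"

text \<open>\<open>\<phi>\<^sub>l = u\<^sup>l G\<^sub>Y(u)\<close> for \<open>Y = {1/a, x}\<close>, where \<open>x\<close> is the \<open>l\<close>-th node, and \<open>\<tau> = Bq\<^sup>l\<close> for this \<open>Y\<close>. The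
  powers of \<open>q\<^sup>l\<close> that arise from the factor \<open>u\<^sup>l\<close> under \<open>u \<mapsto> q\<^bsup>\<plusminus>1\<^esup>u\<close> turn \<open>\<tau>\<close> into \<open>B\<close> after
  division by \<open>q\<^sup>l\<close>. The residue at \<open>1/a\<close> is zero, and \<open>pole x\<close> takes \<open>\<phi>\<^sub>l\<close> to a multiple of \<open>\<phi>\<^bsub>l+1\<^esub>\<close>.
  The assumptions keep the points of \<open>Y\<close> apart from each other and from \<open>\<plusminus>s\<close>.\<close>

theorem dual_op_qbasis:
  assumes B: "B \<noteq> 0"
    and gen: "a ^ 2 \<noteq> t" "a * node B l \<noteq> 1" "t * node B l ^ 2 \<noteq> 1"
  shows "dual_op B (qbasis a B l) =
    C (raise_coeff B l) * fl (qbasis a B (Suc l)) + C (eigen_coeff B l) * fl (qbasis a B l)"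
proof -
  define Q where "Q = q ^ l"
  define x where "x = node B l"
  define Y where "Y = {1 / a, x}"
  have nz: "a \<noteq> 0" "Q \<noteq> 0" "x \<noteq> 0" using B abcd_nz by (simp_all add: Q_def x_def node_def)
  have xB: "t * x = B * a * Q" by (simp add: x_def node_def Q_def)
  have ne: "1 / a \<noteq> x"
  proof
    assume "1 / a = x"
    moreover have "a * (1 / a) = 1" using nz by simp
    ultimately show False using gen(2) by (simp add: x_def)
  qed
  have finY: "finite Y" by (simp add: Y_def)
  have Y0: "0 \<notin> Y" using nz by (simp add: Y_def)
  have Ys: "s \<notin> Y" "- s \<notin> Y"
  proof -
    have "t * (1 / a) ^ 2 \<noteq> 1" using gen(1) nz by (simp add: power_divide)
    moreover have "t * x ^ 2 \<noteq> 1" using gen(3) by (simp add: x_def)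
    ultimately show "s \<notin> Y" "- s \<notin> Y" using eq_pm_s_iff[of "1 / a"] eq_pm_s_iff[of x]
      unfolding Y_def by (metis insertE singletonD)+
  qed
  have s2: "s * s = 1 / t" using s by (simp add: field_simps power2_eq_square)
  have prodY: "(\<Prod>y\<in>Y. f y) = f (1 / a) * f x" for f :: "'k \<Rightarrow> 'r::comm_monoid_mult"
    using ne by (simp add: Y_def)
  have xa: "x / a = B * Q / t" using nz by (simp add: x_def node_def Q_def)
  have tau1: "(\<Prod>y\<in>Y. y / s) = B * Q"
  proof -
    have "(\<Prod>y\<in>Y. y / s) = (x / a) / (s * s)" by (simp add: prodY)
    thus ?thesis unfolding xa s2 by simp
  qed
  have tau2: "(\<Prod>y\<in>Y. - (y / s)) = B * Q"
    using tau1 by (simp add: prodY)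
  have tau3: "(\<Prod>y\<in>Y. t * y ^ 2) = (B * Q) ^ 2"
  proof -
    have "(\<Prod>y\<in>Y. t * y ^ 2) = (t * (x / a)) ^ 2"
      by (simp add: prodY power2_eq_square)
    thus ?thesis unfolding xa by simp
  qed
  define G where "G = fl (kernel Y)"
  define Gu where "Gu = fl (dilate q (kernel Y))"
  define Gd where "Gd = fl (dilate (1 / q) (kernel Y))"
  have basis: "qbasis a B l = fps_X ^ l * kernel Y"
  proof -
    have "t / (B * a * q ^ l) = 1 / x" using nz B by (simp add: x_def node_def)
    thus ?thesis using xB by (simp add: qbasis_def kernel_def prodY Q_def[symmetric] mult_ac)
  qed
  have b0: "fl (qbasis a B l) = U ^ l * G"
    by (simp add: basis G_def fls_times_fps_to_fls fps_to_fls_power)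
  have bu: "fl (dilate q (qbasis a B l)) = C Q * (U ^ l * Gu)"
    by (simp add: basis Gu_def dilate_mult dilate_power dilate_X power_mult_distrib fps_const_power
        fls_times_fps_to_fls fps_to_fls_power Q_def mult.assoc)
  have bd: "fl (dilate (1 / q) (qbasis a B l)) = C (1 / Q) * (U ^ l * Gd)"
    by (simp add: basis Gd_def dilate_mult dilate_power dilate_X power_mult_distrib fps_const_power
        fls_times_fps_to_fls fps_to_fls_power Q_def mult.assoc power_divide)
  have next1: "fl (qbasis a B (Suc l)) = U ^ l * G * (C (q * x) * pole x)"
  proof -
    have ax: "t / (B * a * q ^ Suc l) = 1 / (q * x)" "B * a * q ^ Suc l = q * (t * x)"
      using nz B by (simp_all add: xB Q_def x_def node_def)
    define e f where "e = fl (qpoch (q * (t * x)))" and "f = fl (qpoch (1 / x))"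
    have e: "fl (qpoch (t * x)) = (1 - C (t * x) * U) * e"
      by (subst qpoch_fls_rec) (simp add: e_def)
    have f: "fl (qpoch (1 / (q * x))) = (1 - C (1 / (q * x)) * U) * f"
      by (subst qpoch_fls_rec) (simp add: f_def)
    have cx: "C (q * x) * (1 - C (1 / (q * x)) * U) = C (q * x) - U"
    proof -
      have "C (q * x) * C (1 / (q * x)) = 1" unfolding fls_const_mult_const using nz by simp
      thus ?thesis by (simp only: right_diff_distrib mult.assoc[symmetric] mult_1 mult_1_right)
    qed
    have nz1: "1 - C (t * x) * U \<noteq> 0" "1 - C (1 / (q * x)) * U \<noteq> 0" by (rule one_minus_CU_nz)+
    have cnz: "C (q * x) \<noteq> 0" using nz by simp
    define k where "k = fl (qpoch (t / a)) * inverse (fl (qpoch a))"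
    have G': "G = fl (qpoch (t * x)) * k / f"
      by (simp add: G_def kernel_def prodY fls_times_fps_to_fls fps_to_fls_inverse_qpoch
          f_def k_def divide_inverse mult_ac)
    have "fl (qbasis a B (Suc l)) = U ^ Suc l * (e * k / fl (qpoch (1 / (q * x))))"
      unfolding qbasis_def ax(1) unfolding ax(2) e_def k_def
      by (simp add: fls_times_fps_to_fls fps_to_fls_inverse_qpoch fps_to_fls_power divide_inverse mult_ac)
    also have "\<dots> = U ^ l * (U * (e * k / ((1 - C (1 / (q * x)) * U) * f)))"
      unfolding f by (simp add: mult_ac)
    finally have n1: "fl (qbasis a B (Suc l)) = \<dots>" .
    have ring: "v * (p1 * e * k / f) * (z * (u / (p1 * (z * p2)))) = v * (u * (e * k / (p2 * f)))"
      if "p1 \<noteq> 0" "z \<noteq> 0" for v p1 z u p2 :: "'k fls" using that by (simp add: mult_ac)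
    show ?thesis
      unfolding n1 G' e pole_def cx[symmetric] by (rule ring[symmetric]) (rule nz1 cnz)+
  qed
  have rc0: "res_coeff Y (1 / a) = 0"
    using nz by (simp add: res_coeff_def quartic_def)
  have rcx: "res_coeff Y x = q ^ l * raise_coeff B l * (q * x)"
  proof -
    have "Y - {x} = {1 / a}" using ne by (auto simp: Y_def)
    hence "res_coeff Y x = quartic x * ((1 - t * x * (1 / a)) / (1 - x / (1 / a)))"
      by (simp add: res_coeff_def)
    also have "t * x * (1 / a) = B * q ^ l" using nz by (simp add: xB Q_def)
    also have "x / (1 / a) = a * x" by simp
    also have "quartic x * ((1 - B * q ^ l) / (1 - a * x)) =
        (1 - b * x) * (1 - c * x) * (1 - d * x) * (1 - B * q ^ l)"
    proof -
      have "1 - a * x \<noteq> 0" using gen(2) by (simp add: x_def)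
      thus ?thesis by (simp add: quartic_def)
    qed
    finally show ?thesis using nz by (simp add: raise_coeff_def x_def[symmetric] Q_def)
  qed
  define R where "R = C (res_coeff Y x) * pole x"
  have sumY: "(\<Sum>y\<in>Y. C (res_coeff Y y) * pole y) = R"
    using ne rc0 by (simp add: Y_def[symmetric] R_def) (simp add: Y_def rc0[unfolded Y_def] R_def)
  have id: "(R + 1 + C (B * Q) * res0 + C (al ^ 2 * (B * Q) ^ 2 / t ^ 2)) * G +
      res_down * Gd + C ((B * Q) ^ 2) * res_up * Gu = 0"
    using kernel_residue_identity[OF finY Y0 Ys tau2 tau1 tau3] unfolding sumY G_def Gu_def Gd_def .
  define q' where "q' = C (1 / Q)"
  define A where "A = C (al ^ 2 * B ^ 2 / t ^ 2)"
  have qq: "q' * C Q = 1" unfolding q'_def fls_const_mult_const using nz by simp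
  have c1: "C (B * Q) = C B * C Q" "C ((B * Q) ^ 2) = C (B ^ 2) * C Q * C Q"
    "C (al ^ 2 * (B * Q) ^ 2 / t ^ 2) = A * C Q * C Q"
    by (simp_all add: A_def power2_eq_square mult_ac)
  have "q' * ((R + 1 + C (B * Q) * res0 + C (al ^ 2 * (B * Q) ^ 2 / t ^ 2)) * G +
      res_down * Gd + C ((B * Q) ^ 2) * res_up * Gu) =
      q' * R * G + q' * G + (q' * C Q) * C B * res0 * G + (q' * C Q) * A * C Q * G +
      res_down * q' * Gd + (q' * C Q) * C (B ^ 2) * C Q * res_up * Gu"
    unfolding c1 by (simp only: ring_distribs mult_ac mult_1_left mult_1_right)
  hence "q' * R * G + q' * G + C B * res0 * G + A * C Q * G +
      res_down * q' * Gd + C (B ^ 2) * C Q * res_up * Gu = 0"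
    unfolding id qq mult_zero_right mult_1_left by (rule sym)
  moreover have "- (v + y + z) = r + g + w" if "r + g + v + w + y + z = 0" for r g v w y z :: "'k fls"
  proof -
    have "(r + g + w) - - (v + y + z) = r + g + v + w + y + z" by (simp add: algebra_simps)
    thus ?thesis unfolding that by (metis right_minus_eq)
  qed
  ultimately have eq: "- (C B * res0 * G + res_down * q' * Gd + C (B ^ 2) * C Q * res_up * Gu) =
      q' * R * G + q' * G + A * C Q * G"
    by blast
  have "dual_op B (qbasis a B l) = U ^ l * (- (C B * res0 * G + res_down * q' * Gd +
      C (B ^ 2) * C Q * res_up * Gu) - G - A * G)"
    unfolding dual_op_def b0 bu bd q'_def[symmetric] A_def[symmetric]
    by (simp only: ring_distribs mult_ac minus_add_distrib diff_conv_add_uminus mult_minus_right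
        mult_minus_left mult_1_left add_ac)
  also have "\<dots> = U ^ l * (q' * R * G + (q' - 1 + A * (C Q - 1)) * G)"
    unfolding eq by (simp add: algebra_simps del: fls_const_mult_const)
  also have "\<dots> = U ^ l * (q' * R * G) + (q' - 1 + A * (C Q - 1)) * fl (qbasis a B l)"
    unfolding b0 by (simp only: ring_distribs mult_ac)
  also have "q' - 1 + A * (C Q - 1) = C (eigen_coeff B l)"
    unfolding eigen_coeff_def A_def q'_def Q_def
    by (simp only: fls_plus_const fls_minus_const fls_const_mult_const fls_const_1[symmetric])
  also have "U ^ l * (q' * R * G) = C (raise_coeff B l) * fl (qbasis a B (Suc l))"
  proof -
    have "q' * R = C (raise_coeff B l) * (C (q * x) * pole x)"
    proof -
      have "q' * R = (q' * C Q) * C (raise_coeff B l) * C (q * x) * pole x"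
        unfolding R_def rcx Q_def by (simp only: fls_const_mult_const[symmetric] mult_ac)
      thus ?thesis unfolding qq by (simp only: mult_1 mult.assoc)
    qed
    thus ?thesis unfolding next1 by (simp only: mult_ac)
  qed
  finally show ?thesis .
qed

text \<open>Points at which neither the coefficients of Koornwinder's operator nor the residue identity for
  \<open>Y = {x\<^sub>i, 1/x\<^sub>i}\<close> degenerate; the conditions are invariant under \<open>x \<mapsto> x\<^bsup>-1\<^esup>\<close>.\<close>

definition regular :: "nat \<Rightarrow> (nat \<Rightarrow> 'k) \<Rightarrow> bool" where
  "regular m x \<longleftrightarrow> (\<forall>i\<in>{1..m}. x i \<noteq> 0 \<and> q * x i ^ 2 \<noteq> 1 \<and> q \<noteq> x i ^ 2 \<and> t * x i ^ 2 \<noteq> 1 \<and> t \<noteq> x i ^ 2) \<and>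
     (\<forall>i\<in>{1..m}. \<forall>j\<in>{1..m}. x i * x j \<noteq> 1 \<and> (x i = x j \<longrightarrow> i = j))"

definition Yset :: "nat set \<Rightarrow> (nat \<Rightarrow> 'k) \<Rightarrow> 'k set" where
  "Yset J x = x ` J \<union> (\<lambda>j. 1 / x j) ` J"

definition Acoeff :: "nat \<Rightarrow> nat \<Rightarrow> (nat \<Rightarrow> 'k) \<Rightarrow> 'k" where
  "Acoeff m i x = quartic (x i) / (al * t ^ (m - 1) * (1 - x i ^ 2) * (1 - q * x i ^ 2)) *
     (\<Prod>j\<in>{1..m} - {i}. ((1 - t * x i * x j) * (1 - t * x i * inverse (x j))) /
        ((1 - x i * x j) * (1 - x i * inverse (x j))))"

text \<open>Koornwinder's operator on functions of points.\<close>

definition diff_op :: "nat \<Rightarrow> (nat \<Rightarrow> 'k) \<Rightarrow> ((nat \<Rightarrow> 'k) \<Rightarrow> 'k) \<Rightarrow> 'k" where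
  "diff_op m x g =
     (\<Sum>i=1..m. Acoeff m i x * (g (x(i := q * x i)) - g x)) +
     (\<Sum>i=1..m. Acoeff m i (\<lambda>j. inverse (x j)) * (g (x(i := inverse q * x i)) - g x))"

lemma Yset_inverse: "Yset J (\<lambda>j. inverse (x j)) = Yset J x"
  by (auto simp: Yset_def inverse_eq_divide)

lemma regular_inverse:
  assumes "regular m x"
  shows "regular m (\<lambda>j. inverse (x j))"
proof -
  have iff: "v * inverse z ^ 2 = 1 \<longleftrightarrow> v = z ^ 2" "v = inverse z ^ 2 \<longleftrightarrow> v * z ^ 2 = 1"
    if "z \<noteq> 0" for v z :: 'k using that by (simp_all add: inverse_eq_divide power_divide eq_divide_eq divide_eq_eq)
  have iff2: "inverse z * inverse w = 1 \<longleftrightarrow> z * w = 1" for z w :: 'k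
    by (simp only: inverse_mult_distrib[symmetric] inverse_eq_1_iff)
  have f: "x i \<noteq> 0" "q * x i ^ 2 \<noteq> 1" "q \<noteq> x i ^ 2" "t * x i ^ 2 \<noteq> 1" "t \<noteq> x i ^ 2"
    if "i \<in> {1..m}" for i using assms that unfolding regular_def by blast+
  have g: "x i * x j \<noteq> 1" "x i = x j \<Longrightarrow> i = j" if "i \<in> {1..m}" "j \<in> {1..m}" for i j
    using assms that unfolding regular_def by blast+
  show ?thesis unfolding regular_def
  proof (intro conjI ballI impI)
    fix i assume i: "i \<in> {1..m}"
    note iffi = iff[OF f(1)[OF i]]
    show "inverse (x i) \<noteq> 0" using f(1)[OF i] by simp
    show "q * inverse (x i) ^ 2 \<noteq> 1" unfolding iffi by (rule f(3)[OF i])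
    show "q \<noteq> inverse (x i) ^ 2" unfolding iffi by (rule f(2)[OF i])
    show "t * inverse (x i) ^ 2 \<noteq> 1" unfolding iffi by (rule f(5)[OF i])
    show "t \<noteq> inverse (x i) ^ 2" unfolding iffi by (rule f(4)[OF i])
    fix j assume j: "j \<in> {1..m}"
    show "inverse (x i) * inverse (x j) \<noteq> 1" unfolding iff2 by (rule g(1)[OF i j])
    show "i = j" if "inverse (x i) = inverse (x j)"
      using that unfolding inverse_eq_iff_eq by (rule g(2)[OF i j])
  qed
qed

lemma prod_Yset:
  fixes f :: "'k \<Rightarrow> 'r::comm_monoid_mult"
  assumes "regular m x" "J \<subseteq> {1..m}"
  shows "(\<Prod>y\<in>Yset J x. f y) = (\<Prod>j\<in>J. f (x j) * f (1 / x j))"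
    and "inj_on x J" "inj_on (\<lambda>j. 1 / x j) J" "x ` J \<inter> (\<lambda>j. 1 / x j) ` J = {}"
proof -
  have J: "j \<in> {1..m}" if "j \<in> J" for j using that assms(2) by blast
  have fin: "finite J" using assms(2) finite_subset by blast
  show i1: "inj_on x J"
    using assms(1) J unfolding regular_def inj_on_def by blast
  thus i2: "inj_on (\<lambda>j. 1 / x j) J"
    unfolding inj_on_def by simp
  have nz: "x j \<noteq> 0" if "j \<in> J" for j
    using assms(1) J[OF that] unfolding regular_def by blast
  have ne: "x i \<noteq> 1 / x j" if "i \<in> J" "j \<in> J" for i j
  proof
    assume "x i = 1 / x j"
    hence "x i * x j = 1" using nz[OF that(2)] by simp
    thus False using assms(1) J that unfolding regular_def by blast
  qed
  show disj: "x ` J \<inter> (\<lambda>j. 1 / x j) ` J = {}" using ne by blast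
  show "(\<Prod>y\<in>Yset J x. f y) = (\<Prod>j\<in>J. f (x j) * f (1 / x j))"
    unfolding Yset_def
    by (simp only: prod.union_disjoint[OF finite_imageI[OF fin] finite_imageI[OF fin] disj]
        prod.reindex[OF i1] prod.reindex[OF i2] prod.distrib o_def)
qed

lemma kernel_Yset:
  assumes "regular m x"
  shows "kernel (Yset {1..m} x) = (\<Prod>j=1..m. gen_fun1 (x j))"
  unfolding kernel_def prod_Yset(1)[OF assms subset_refl]
  by (intro prod.cong refl) (simp add: gen_fun1_def mult_ac)

lemma res_coeff_Yset:
  assumes x: "regular m x" and i: "i \<in> {1..m}"
  shows "res_coeff (Yset {1..m} x) (x i) =
    al * t ^ (m - 1) * Acoeff m i x * ((1 - t) * (1 - q * x i ^ 2))"
proof -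
  define J where "J = {1..m} - {i}"
  have xi: "x i \<noteq> 0" "x i * x i \<noteq> 1" "q * x i ^ 2 \<noteq> 1"
    using x i unfolding regular_def by blast+
  have ins: "{1..m} = insert i J" "i \<notin> J" using i by (auto simp: J_def)
  note inj = prod_Yset(2-4)[OF x subset_refl]
  have Yi: "Yset {1..m} x - {x i} = insert (1 / x i) (Yset J x)"
  proof -
    have e1: "x ` {1..m} - {x i} = x ` J"
      using inj_on_image_set_diff[OF inj(1), of "{1..m}" "{i}"] i by (simp add: J_def)
    have "x i \<notin> (\<lambda>j. 1 / x j) ` {1..m}" using inj(3) i by blast
    hence e2: "(\<lambda>j. 1 / x j) ` {1..m} - {x i} = insert (1 / x i) ((\<lambda>j. 1 / x j) ` J)"
      unfolding ins(1) image_insert by (rule Diff_insert0[of _ _ "{}", unfolded Diff_empty])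
    show ?thesis unfolding Yset_def Un_Diff e1 e2 by (rule Un_insert_right)
  qed
  have nin: "1 / x i \<notin> Yset J x"
  proof -
    have "1 / x i \<notin> x ` J" using inj(3) i unfolding J_def by blast
    moreover have "1 / x i \<notin> (\<lambda>j. 1 / x j) ` J"
      using inj_on_image_mem_iff[OF inj(2), of i J] i ins(2) by (simp add: J_def)
    ultimately show ?thesis unfolding Yset_def by blast
  qed
  have finJ: "finite (Yset J x)" by (simp add: Yset_def J_def)
  have Jsub: "J \<subseteq> {1..m}" by (auto simp: J_def)
  have "res_coeff (Yset {1..m} x) (x i) = quartic (x i) *
      ((1 - t * x i * (1 / x i)) / (1 - x i / (1 / x i)) *
       (\<Prod>j\<in>J. (1 - t * x i * x j) / (1 - x i / x j) *
          ((1 - t * x i * (1 / x j)) / (1 - x i / (1 / x j)))))"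
    unfolding res_coeff_def Yi prod.insert[OF finJ nin] prod_Yset(1)[OF x Jsub] ..
  also have "(\<Prod>j\<in>J. (1 - t * x i * x j) / (1 - x i / x j) *
          ((1 - t * x i * (1 / x j)) / (1 - x i / (1 / x j)))) =
      (\<Prod>j\<in>J. ((1 - t * x i * x j) * (1 - t * x i * inverse (x j))) /
        ((1 - x i * x j) * (1 - x i * inverse (x j))))"
    by (intro prod.cong refl) (simp add: divide_inverse mult_ac)
  also have "1 - t * x i * (1 / x i) = 1 - t" using xi by simp
  also have "x i / (1 / x i) = x i ^ 2" by (simp add: power2_eq_square)
  finally show ?thesis
    unfolding Acoeff_def J_def[symmetric] using xi by (simp add: power2_eq_square mult_ac)
qed

lemma gen_fun1_shift:
  assumes "x \<noteq> 0"
  shows "fl (gen_fun1 (q * x)) - fl (gen_fun1 x) =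
    C ((1 - t) * (1 - q * x ^ 2)) * pole x * fl (gen_fun1 x)"
proof -
  define e f g h where "e = fl (qpoch (t * (q * x)))" and "f = fl (qpoch (t / x))"
    and "g = fl (qpoch (q * x))" and "h = fl (qpoch (1 / x))"
  have 1: "fl (qpoch (t * x)) = (1 - C t * C x * U) * e"
    by (subst qpoch_fls_rec) (simp add: e_def mult.left_commute)
  have 2: "fl (qpoch (t / (q * x))) = (1 - C t / (C q * C x) * U) * f"
    by (subst qpoch_fls_rec) (simp add: f_def fls_const_divide[symmetric])
  have 3: "fl (qpoch x) = (1 - C x * U) * g"
    by (subst qpoch_fls_rec) (simp add: g_def)
  have 4: "fl (qpoch (1 / (q * x))) = (1 - 1 / (C q * C x) * U) * h"
    by (subst qpoch_fls_rec) (simp add: h_def fls_const_divide)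
  have nz: "1 - C t * C x * U \<noteq> 0" "1 - C x * U \<noteq> 0" "1 - 1 / (C q * C x) * U \<noteq> 0"
      "C q * C x - U \<noteq> 0"
    using one_minus_CU_nz[of "t * x"] one_minus_CU_nz[of x] one_minus_CU_nz[of "1 / (q * x)"]
      C_minus_U_nz[of "q * x"] by (simp_all add: fls_const_divide)
  have G: "fl (gen_fun1 x) = (1 - C t * C x * U) * e * f / ((1 - C x * U) * g * h)"
    unfolding gen_fun1_def fls_times_fps_to_fls fps_to_fls_inverse_qpoch 1 3
      f_def[symmetric] h_def[symmetric]
    by (simp only: divide_inverse inverse_mult_distrib mult_ac)
  have "fl (gen_fun1 (q * x)) = e * ((1 - C t / (C q * C x) * U) * f) /
      (g * ((1 - 1 / (C q * C x) * U) * h))"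
    unfolding gen_fun1_def fls_times_fps_to_fls fps_to_fls_inverse_qpoch 2 4
      e_def[symmetric] g_def[symmetric]
    by (simp only: divide_inverse inverse_mult_distrib mult_ac)
  also have "\<dots> = (1 - C x * U) * (1 - C t / (C q * C x) * U) /
      ((1 - C t * C x * U) * (1 - 1 / (C q * C x) * U)) * fl (gen_fun1 x)"
  proof -
    have "e * (p2 * f) / (g * (p4 * h)) = p3 * p2 / (p1 * p4) * (p1 * e * f / (p3 * g * h))"
      if "p1 \<noteq> 0" "p3 \<noteq> 0" for p1 p2 p3 p4 :: "'k fls" using that by (simp add: mult_ac)
    thus ?thesis unfolding G using nz by blast
  qed
  finally have "fl (gen_fun1 (q * x)) - fl (gen_fun1 x) =
      ((1 - C x * U) * (1 - C t / (C q * C x) * U) /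
      ((1 - C t * C x * U) * (1 - 1 / (C q * C x) * U)) - 1) * fl (gen_fun1 x)"
    by (simp only: left_diff_distrib mult_1)
  also have "(1 - C x * U) * (1 - C t / (C q * C x) * U) /
      ((1 - C t * C x * U) * (1 - 1 / (C q * C x) * U)) - 1 =
      (1 - C t) * (1 - C q * C x ^ 2) * (U / ((1 - C t * C x * U) * (C q * C x - U)))"
    by (rule shift_ratio) (use nz assms in simp_all)
  also have "\<dots> = C ((1 - t) * (1 - q * x ^ 2)) * pole x"
    unfolding pole_def power2_eq_square
    by (simp only: fls_minus_const[symmetric] fls_const_mult_const[symmetric] fls_const_1)
  finally show ?thesis .
qed

lemma gen_fun1_inverse: "gen_fun1 (inverse x) = gen_fun1 x"
  by (simp add: gen_fun1_def divide_inverse mult_ac)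

text \<open>Replacing \<open>x\<^sub>i\<close> by \<open>qx\<^sub>i\<close> changes the generating function by \<open>(1-t)(1-qx\<^sub>i\<^sup>2)\<close> times \<open>pole (x i)\<close> times
  itself. The factor \<open>1 - qx\<^sub>i\<^sup>2\<close> cancels in \<open>\<A>\<^sub>i\<^sup>+\<close>, and what remains is the residue at \<open>x\<^sub>i\<close>.\<close>

lemma Acoeff_shift:
  assumes x: "regular m x" and i: "i \<in> {1..m}"
  defines "F \<equiv> \<lambda>x. \<Prod>j=1..m. gen_fun1 (x j)"
  shows "C (al * t ^ (m - 1)) * (C (Acoeff m i x) * (fl (F (x(i := q * x i))) - fl (F x))) =
    C (res_coeff (Yset {1..m} x) (x i)) * pole (x i) * fl (F x)"
proof -
  define k where "k = fl (\<Prod>j\<in>{1..m} - {i}. gen_fun1 (x j))"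
  have xi: "x i \<noteq> 0" using x i unfolding regular_def by blast
  have F1: "fl (F x) = fl (gen_fun1 (x i)) * k"
    unfolding F_def k_def using i by (subst prod.remove[of _ i]) (simp_all add: fls_times_fps_to_fls)
  have "(\<Prod>j\<in>{1..m} - {i}. gen_fun1 ((x(i := q * x i)) j)) = (\<Prod>j\<in>{1..m} - {i}. gen_fun1 (x j))"
    by (intro prod.cong) auto
  hence F2: "fl (F (x(i := q * x i))) = fl (gen_fun1 (q * x i)) * k"
    unfolding F_def k_def using i by (subst prod.remove[of _ i]) (simp_all add: fls_times_fps_to_fls)
  have "fl (F (x(i := q * x i))) - fl (F x) = (fl (gen_fun1 (q * x i)) - fl (gen_fun1 (x i))) * k"
    unfolding F1 F2 by (simp only: left_diff_distrib)
  also have "\<dots> = C ((1 - t) * (1 - q * x i ^ 2)) * pole (x i) * fl (F x)"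
    unfolding gen_fun1_shift[OF xi] F1 by (simp only: mult_ac)
  finally show ?thesis
    unfolding res_coeff_Yset[OF x i] by (simp only: fls_const_mult_const[symmetric] mult_ac)
qed

text \<open>The terms with \<open>\<A>\<^sub>i\<^sup>+\<close> are the residues at \<open>x\<^sub>i\<close>, those with \<open>\<A>\<^sub>i\<^sup>-\<close> the residues at \<open>1/x\<^sub>i\<close>; the latter
  follow from the former by the symmetry \<open>x \<mapsto> x\<^bsup>-1\<^esup>\<close> of the generating function.\<close>

theorem diff_op_kernel:
  assumes x: "regular m x" and m: "m \<ge> 1"
  defines "F \<equiv> \<lambda>x. \<Prod>j=1..m. gen_fun1 (x j)"
  shows "C (al * t ^ (m - 1)) *
     ((\<Sum>i=1..m. C (Acoeff m i x) * (fl (F (x(i := q * x i))) - fl (F x))) +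
      (\<Sum>i=1..m. C (Acoeff m i (\<lambda>j. inverse (x j))) * (fl (F (x(i := inverse q * x i))) - fl (F x)))) =
     dual_op (t ^ m) (F x)"
proof -
  define Y where "Y = Yset {1..m} x"
  define B where "B = t ^ m"
  have xnz: "x j \<noteq> 0" if "j \<in> {1..m}" for j using x that unfolding regular_def by blast
  have F_inv: "F (\<lambda>j. inverse (y j)) = F y" for y by (simp add: F_def gen_fun1_inverse)
  note pY = prod_Yset[OF x subset_refl]
  have finY: "finite Y" by (simp add: Y_def Yset_def)
  have Y0: "0 \<notin> Y" using xnz by (auto simp: Y_def Yset_def)
  have tY: "t * y ^ 2 \<noteq> 1" if "y \<in> Y" for y
    using that x unfolding Y_def Yset_def regular_def by (auto simp: power_divide field_simps)
  have Ys: "s \<notin> Y" "- s \<notin> Y" using tY eq_pm_s_iff by blast+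
  have "s * s = 1 / t" using s by (simp add: field_simps power2_eq_square)
  hence ss: "1 / (s * s) = t" by simp
  have tau1: "(\<Prod>y\<in>Y. - (y / s)) = B"
  proof -
    have "(\<Prod>y\<in>Y. - (y / s)) = (\<Prod>j=1..m. 1 / (s * s))"
      unfolding Y_def pY(1) using xnz by (intro prod.cong refl) simp
    thus ?thesis by (simp only: ss) (simp add: B_def)
  qed
  have tau2: "(\<Prod>y\<in>Y. y / s) = B"
  proof -
    have "(\<Prod>y\<in>Y. y / s) = (\<Prod>j=1..m. 1 / (s * s))"
      unfolding Y_def pY(1) using xnz by (intro prod.cong refl) simp
    thus ?thesis by (simp only: ss) (simp add: B_def)
  qed
  have tau3: "(\<Prod>y\<in>Y. t * y ^ 2) = B ^ 2"
  proof -
    have "(\<Prod>y\<in>Y. t * y ^ 2) = (\<Prod>j=1..m. t ^ 2)"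
      unfolding Y_def pY(1) using xnz by (intro prod.cong refl) (simp add: power2_eq_square)
    thus ?thesis by (simp add: B_def power_mult[symmetric] mult.commute)
  qed
  have kF: "kernel Y = F x" unfolding Y_def F_def by (rule kernel_Yset[OF x])
  define R where "R = (\<Sum>y\<in>Y. C (res_coeff Y y) * pole y)"
  have plus: "C (al * t ^ (m - 1)) * (C (Acoeff m i x) * (fl (F (x(i := q * x i))) - fl (F x))) =
    C (res_coeff Y (x i)) * pole (x i) * fl (F x)" if "i \<in> {1..m}" for i
    unfolding Y_def F_def by (rule Acoeff_shift[OF x that])
  have minus: "C (al * t ^ (m - 1)) * (C (Acoeff m i (\<lambda>j. inverse (x j))) *
      (fl (F (x(i := inverse q * x i))) - fl (F x))) =
    C (res_coeff Y (1 / x i)) * pole (1 / x i) * fl (F x)" if "i \<in> {1..m}" for i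
  proof -
    define x' where "x' = (\<lambda>j. inverse (x j))"
    have "(\<lambda>j. inverse ((x'(i := q * x' i)) j)) = x(i := inverse q * x i)"
      by (auto simp: x'_def fun_eq_iff)
    hence "F (x'(i := q * x' i)) = F (x(i := inverse q * x i))" using F_inv by metis
    moreover have "F x' = F x" unfolding x'_def by (rule F_inv)
    moreover have "Yset {1..m} x' = Y" unfolding Y_def x'_def by (rule Yset_inverse)
    moreover have "x' i = 1 / x i" by (simp add: x'_def inverse_eq_divide)
    moreover have "regular m x'" unfolding x'_def by (rule regular_inverse[OF x])
    ultimately show ?thesis
      using Acoeff_shift[of m x' i] that unfolding F_def x'_def[symmetric] by simp
  qed
  have "C (al * t ^ (m - 1)) *
     ((\<Sum>i=1..m. C (Acoeff m i x) * (fl (F (x(i := q * x i))) - fl (F x))) +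
      (\<Sum>i=1..m. C (Acoeff m i (\<lambda>j. inverse (x j))) * (fl (F (x(i := inverse q * x i))) - fl (F x)))) =
     (\<Sum>i=1..m. C (res_coeff Y (x i)) * pole (x i) * fl (F x)) +
     (\<Sum>i=1..m. C (res_coeff Y (1 / x i)) * pole (1 / x i) * fl (F x))"
    unfolding ring_distribs(1) sum_distrib_left
    by (intro arg_cong2[where f = "(+)"] sum.cong refl plus minus)
  also have "\<dots> = R * fl (F x)"
  proof -
    define g where "g y = C (res_coeff Y y) * pole y * fl (F x)" for y
    have "(\<Sum>y\<in>Y. g y) = (\<Sum>i=1..m. g (x i)) + (\<Sum>i=1..m. g (1 / x i))"
      unfolding Y_def Yset_def
      by (simp only: sum.union_disjoint[OF finite_imageI[OF finite_atLeastAtMost]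
          finite_imageI[OF finite_atLeastAtMost] pY(4)] sum.reindex[OF pY(2)] sum.reindex[OF pY(3)] o_def)
    thus ?thesis unfolding R_def sum_distrib_right g_def by (rule sym)
  qed
  also have "\<dots> = dual_op B (F x)"
  proof -
    have "(R + 1 + C B * res0 + C (al ^ 2 * B ^ 2 / t ^ 2)) * fl (F x) +
      res_down * fl (dilate (1 / q) (F x)) + C (B ^ 2) * res_up * fl (dilate q (F x)) = 0"
      using kernel_residue_identity[OF finY Y0 Ys tau1 tau2 tau3] unfolding R_def kF .
    moreover have "(r + 1 + v + w) * y + z1 + z2 = 0 \<Longrightarrow> r * y = - ((1 + v + w) * y + z1 + z2)"
      for r v w y z1 z2 :: "'k fls"
    proof -
      assume e: "(r + 1 + v + w) * y + z1 + z2 = 0"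
      have "r * y - - ((1 + v + w) * y + z1 + z2) = (r + 1 + v + w) * y + z1 + z2"
        by (simp add: algebra_simps)
      thus ?thesis unfolding e by (metis right_minus_eq)
    qed
    ultimately show ?thesis unfolding dual_op_def by blast
  qed
  finally show ?thesis unfolding B_def .
qed

text \<open>Both \<open>\<D>F\<close> and the image of \<open>F\<close> under the dual operator are expanded in the series \<open>\<phi>\<^sub>l\<close>. The
  coefficients of the dual operator are Laurent series in \<open>u\<close>; a power of \<open>u\<close> clears their poles, after
  which the operator acts on formal sums term by term.\<close>

theorem diff_op_hsum:
  assumes x: "regular m x" and m: "m \<ge> 1"
    and gen: "\<And>i j. a ^ 2 * t ^ i * q ^ j \<noteq> t"
  shows "al * t ^ (m - 1) * diff_op m x (hsum a m l) =
    eigen_coeff (t ^ m) l * hsum a m l x +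
    (if l = 0 then 0 else raise_coeff (t ^ m) (l - 1) * hsum a m (l - 1) x)"
proof -
  define B where "B = t ^ m"
  define \<phi> where "\<phi> = qbasis a B"
  define F where "F x = (\<Prod>j=1..m. gen_fun1 (x j))" for x :: "nat \<Rightarrow> 'k"
  define H where "H = (\<lambda>l. hsum a m l x)"
  define D where "D = (\<lambda>l. diff_op m x (hsum a m l))"
  have a0: "a \<noteq> 0" and B0: "B \<noteq> 0" using abcd_nz by (simp_all add: B_def)
  have xnz: "x j \<noteq> 0" if "j \<in> {1..m}" for j using x that unfolding regular_def by blast
  have gr: "graded_family \<phi>" unfolding \<phi>_def by (rule graded_qbasis)
  have expand: "F y = formal_sum (\<lambda>l. hsum a m l y) \<phi>" if "\<And>j. j \<in> {1..m} \<Longrightarrow> y j \<noteq> 0" for y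
    unfolding F_def \<phi>_def B_def by (rule gen_fun_expansion) (use a0 that in auto)
  have FD: "formal_sum D \<phi> =
      (\<Sum>i=1..m. fps_const (Acoeff m i x) * (F (x(i := q * x i)) - F x)) +
      (\<Sum>i=1..m. fps_const (Acoeff m i (\<lambda>j. inverse (x j))) * (F (x(i := inverse q * x i)) - F x))"
  proof -
    have e0: "F x = formal_sum (\<lambda>l. hsum a m l x) \<phi>" by (rule expand[OF xnz])
    have e1: "F (x(i := q * x i)) = formal_sum (\<lambda>l. hsum a m l (x(i := q * x i))) \<phi>"
      if "i \<in> {1..m}" for i by (rule expand) (use xnz that in auto)
    have e2: "F (x(i := inverse q * x i)) = formal_sum (\<lambda>l. hsum a m l (x(i := inverse q * x i))) \<phi>"
      if "i \<in> {1..m}" for i by (rule expand) (use xnz that in auto)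
    have "formal_sum D \<phi> =
      (\<Sum>i=1..m. fps_const (Acoeff m i x) * (formal_sum (\<lambda>l. hsum a m l (x(i := q * x i))) \<phi> - F x)) +
      (\<Sum>i=1..m. fps_const (Acoeff m i (\<lambda>j. inverse (x j))) *
        (formal_sum (\<lambda>l. hsum a m l (x(i := inverse q * x i))) \<phi> - F x))"
      unfolding D_def diff_op_def e0
      by (simp only: formal_sum_add_left formal_sum_sum_left formal_sum_const_left formal_sum_diff_left)
    thus ?thesis using e1 e2 by simp
  qed
  have flsum: "fl (\<Sum>i\<in>A. f i) = (\<Sum>i\<in>A. fl (f i))" for f and A :: "nat set"
    by (induction A rule: infinite_finite_induct) simp_all
  have kernel: "C (al * t ^ (m - 1)) * fl (formal_sum D \<phi>) = dual_op B (formal_sum H \<phi>)"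
  proof -
    have "fl (formal_sum D \<phi>) =
     ((\<Sum>i=1..m. C (Acoeff m i x) * (fl (F (x(i := q * x i))) - fl (F x))) +
      (\<Sum>i=1..m. C (Acoeff m i (\<lambda>j. inverse (x j))) * (fl (F (x(i := inverse q * x i))) - fl (F x))))"
      unfolding FD by (simp add: flsum fls_times_fps_to_fls)
    moreover have "formal_sum H \<phi> = F x" unfolding H_def by (rule expand[OF xnz, symmetric])
    ultimately show ?thesis using diff_op_kernel[OF x m] unfolding F_def B_def by simp
  qed
  have basis: "dual_op B (\<phi> l) = C (raise_coeff B l) * fl (\<phi> (Suc l)) + C (eigen_coeff B l) * fl (\<phi> l)" for l
    unfolding \<phi>_def
  proof (rule dual_op_qbasis[OF B0])
    show "a ^ 2 \<noteq> t" using gen[of 0 0] by simp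
    show "a * node B l \<noteq> 1"
      using gen[of m l] by (simp add: node_def B_def field_simps power2_eq_square)
    have "t * node B l ^ 2 = a ^ 2 * t ^ (2 * m) * q ^ (2 * l) / t"
      by (simp add: node_def B_def power_divide power_mult_distrib power_mult[symmetric]
          power2_eq_square[of t] mult_ac)
    thus "t * node B l ^ 2 \<noteq> 1" using gen[of "2 * m" "2 * l"] by simp
  qed
  define c0 where "c0 = - (1 + C B * res0 + C (al ^ 2 * B ^ 2 / t ^ 2))"
  obtain k0 P0 where k0: "U ^ k0 * c0 = fl P0" by (rule fls_eventually_fps)
  obtain k1 P1 where k1: "U ^ k1 * res_down = fl P1" by (rule fls_eventually_fps)
  obtain k2 P2 where k2: "U ^ k2 * (C (B ^ 2) * res_up) = fl P2" by (rule fls_eventually_fps)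
  define k where "k = k0 + k1 + k2"
  define L where "L X = fps_X ^ (k1 + k2) * P0 * X - fps_X ^ (k0 + k2) * P1 * dilate (1 / q) X -
      fps_X ^ (k0 + k1) * P2 * dilate q X" for X
  have L: "fl (L X) = U ^ k * dual_op B X" for X
  proof -
    have "fl (L X) = U ^ (k1 + k2) * (U ^ k0 * c0) * fl X -
        U ^ (k0 + k2) * (U ^ k1 * res_down) * fl (dilate (1 / q) X) -
        U ^ (k0 + k1) * (U ^ k2 * (C (B ^ 2) * res_up)) * fl (dilate q X)"
      unfolding k0 k1 k2 by (simp add: L_def fls_times_fps_to_fls fps_to_fls_power)
    also have "\<dots> = U ^ k * (c0 * fl X - res_down * fl (dilate (1 / q) X) -
        C (B ^ 2) * res_up * fl (dilate q X))"
      unfolding k_def power_add by (simp only: right_diff_distrib mult_ac)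
    also have "c0 * fl X - res_down * fl (dilate (1 / q) X) - C (B ^ 2) * res_up * fl (dilate q X) =
        dual_op B X"
    proof -
      have "- v * y - z - w = - (v * y + z + w)" for v y z w :: "'k fls" by simp
      thus ?thesis unfolding dual_op_def c0_def .
    qed
    finally show ?thesis .
  qed
  have L_sum: "L (formal_sum H \<phi>) = formal_sum H (\<lambda>l. L (\<phi> l))"
    unfolding L_def dilate_formal_sum formal_sum_diff_right
    by (simp only: formal_sum_mult[OF gr] formal_sum_mult[OF graded_dilate[OF gr]])
  have L_basis: "L (\<phi> l) = fps_X ^ k * (fps_const (raise_coeff B l) * \<phi> (Suc l) +
      fps_const (eigen_coeff B l) * \<phi> l)" for l
  proof -
    have "fl (L (\<phi> l)) = fl (fps_X ^ k * (fps_const (raise_coeff B l) * \<phi> (Suc l) +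
      fps_const (eigen_coeff B l) * \<phi> l))"
      unfolding L basis by (simp add: fls_times_fps_to_fls fps_to_fls_power)
    thus ?thesis by simp
  qed
  define E where "E = (\<lambda>l. (if l = 0 then 0 else H (l - 1) * raise_coeff B (l - 1)) + H l * eigen_coeff B l)"
  have grE: "graded_family (\<lambda>l. fps_const (raise_coeff B l) * \<phi> (Suc l) + fps_const (eigen_coeff B l) * \<phi> l)"
    using gr by (simp add: graded_family_def)
  have "fl (fps_X ^ k * (fps_const (al * t ^ (m - 1)) * formal_sum D \<phi>)) =
      U ^ k * (C (al * t ^ (m - 1)) * fl (formal_sum D \<phi>))"
    by (simp add: fls_times_fps_to_fls fps_to_fls_power)
  also have "\<dots> = fl (L (formal_sum H \<phi>))"
    unfolding kernel L ..
  also have "L (formal_sum H \<phi>) = fps_X ^ k * formal_sum H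
      (\<lambda>l. fps_const (raise_coeff B l) * \<phi> (Suc l) + fps_const (eigen_coeff B l) * \<phi> l)"
    unfolding L_sum L_basis by (rule formal_sum_mult[OF grE, symmetric])
  also have "formal_sum H (\<lambda>l. fps_const (raise_coeff B l) * \<phi> (Suc l) +
      fps_const (eigen_coeff B l) * \<phi> l) = formal_sum E \<phi>"
    unfolding E_def formal_sum_add_right formal_sum_add_left formal_sum_const_right
      formal_sum_shift[OF gr] ..
  finally have "formal_sum (\<lambda>l. al * t ^ (m - 1) * D l) \<phi> = formal_sum E \<phi>"
    unfolding formal_sum_const_left by simp
  hence "al * t ^ (m - 1) * D l = E l"
    by (rule formal_sum_cancel[OF gr, rotated]) (simp add: \<phi>_def qbasis_nth_self)
  thus ?thesis by (simp add: D_def E_def H_def B_def mult.commute)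
qed

text \<open>The symmetries of the generating function pass to its coefficients.\<close>

lemma hsum_cong_gen_fun:
  assumes "\<And>j. j \<in> {1..m} \<Longrightarrow> x j \<noteq> 0" "\<And>j. j \<in> {1..m} \<Longrightarrow> y j \<noteq> 0"
    and "(\<Prod>j=1..m. gen_fun1 (x j)) = (\<Prod>j=1..m. gen_fun1 (y j))"
  shows "hsum a m l x = hsum a m l y"
proof (rule formal_sum_cancel[of "qbasis a (t ^ m)"])
  show "graded_family (qbasis a (t ^ m))" by (rule graded_qbasis)
  show "qbasis a (t ^ m) k $ k \<noteq> 0" for k by (simp add: qbasis_nth_self)
  show "formal_sum (\<lambda>l. hsum a m l x) (qbasis a (t ^ m)) =
      formal_sum (\<lambda>l. hsum a m l y) (qbasis a (t ^ m))"
    using assms(3) gen_fun_expansion[of a m x] gen_fun_expansion[of a m y] assms(1,2) abcd_nz by simp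
qed

end


section \<open>Independence of the parameters\<close>

definition par_monom :: "nat \<Rightarrow> nat \<Rightarrow> nat \<Rightarrow> nat \<Rightarrow> nat \<Rightarrow> nat \<Rightarrow> pring" where
  "par_monom i j k l m n = monom (monom (monom (monom (monom (monom 1 n) m) l) k) j) i"

text \<open>The coefficient of a monomial in the square roots of the parameters, which makes their algebraic
  independence available: monomials with different exponents are told apart by their coefficients.\<close>

definition par_coeff :: "nat \<Rightarrow> nat \<Rightarrow> nat \<Rightarrow> nat \<Rightarrow> nat \<Rightarrow> nat \<Rightarrow> pring \<Rightarrow> rat" where
  "par_coeff i j k l m n p = coeff (coeff (coeff (coeff (coeff (coeff p i) j) k) l) m) n"

lemma par_coeff_monom:
  "par_coeff i j k l m n (par_monom i' j' k' l' m' n') =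
     (if i = i' \<and> j = j' \<and> k = k' \<and> l = l' \<and> m = m' \<and> n = n' then 1 else 0)"
  by (simp add: par_coeff_def par_monom_def)

lemma par_coeff_add: "par_coeff i j k l m n (p + p') = par_coeff i j k l m n p + par_coeff i j k l m n p'"
  and par_coeff_0: "par_coeff i j k l m n 0 = 0"
  by (simp_all add: par_coeff_def)

lemma par_coeff_sum: "par_coeff i j k l m n (sum f A) = (\<Sum>x\<in>A. par_coeff i j k l m n (f x))"
  by (induction A rule: infinite_finite_induct) (simp_all add: par_coeff_add par_coeff_0)

lemma to_fract_power: "to_fract (x ^ n) = to_fract (x :: 'a::idom) ^ n"
  by (induction n) simp_all

lemma to_fract_par_monom:
  "to_fract (par_monom i j k l m n) =
     a_half ^ i * b_half ^ j * c_half ^ k * d_half ^ l * q_half ^ m * t_half ^ n"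
proof -
  have X: "[:0, x:] ^ n = monom (x ^ n) n" for x :: "'a::comm_semiring_1" and n
    by (induction n) (simp_all add: monom_0 monom_Suc one_pCons smult_monom)
  have c: "[:x:] ^ n = [:x ^ n:]" for x :: "'a::comm_semiring_1" and n
    by (induction n) (simp_all add: one_pCons mult.commute)
  have mc: "monom p i * [:y:] = monom (p * y) i" for p y :: "'a::comm_semiring_1" and i
    by (simp add: mult_monom monom_0[symmetric])
  have "par_monom i j k l m n = [:0, 1:] ^ i * [:[:0, 1:]:] ^ j * [:[:[:0, 1:]:]:] ^ k *
      [:[:[:[:0, 1:]:]:]:] ^ l * [:[:[:[:[:0, 1:]:]:]:]:] ^ m * [:[:[:[:[:[:0, 1:]:]:]:]:]:] ^ n"
    unfolding par_monom_def by (simp only: X c mc mult_1_left power_one)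
  thus ?thesis
    by (simp only: to_fract_mult to_fract_power a_half_def b_half_def c_half_def d_half_def
        q_half_def t_half_def)
qed

lemma par_monom_eqD:
  assumes "to_fract (par_monom i j k l m n) = to_fract (par_monom i' j' k' l' m' n')"
  shows "i = i' \<and> j = j' \<and> k = k' \<and> l = l' \<and> m = m' \<and> n = n'"
proof -
  have "par_monom i j k l m n = par_monom i' j' k' l' m' n'" using assms by simp
  hence "par_coeff i j k l m n (par_monom i' j' k' l' m' n') = 1"
    using par_coeff_monom[of i j k l m n i j k l m n] by simp
  thus ?thesis unfolding par_coeff_monom by (simp split: if_splits)
qed

lemma half_nz [simp]: "a_half \<noteq> 0" "b_half \<noteq> 0" "c_half \<noteq> 0" "d_half \<noteq> 0" "q_half \<noteq> 0" "t_half \<noteq> 0"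
  by (simp_all add: a_half_def b_half_def c_half_def d_half_def q_half_def t_half_def)

lemma par_nz [simp]: "par_a \<noteq> 0" "par_b \<noteq> 0" "par_c \<noteq> 0" "par_d \<noteq> 0" "par_q \<noteq> 0" "par_t \<noteq> 0"
  by (simp_all add: par_a_def par_b_def par_c_def par_d_def par_q_def par_t_def)

lemma par_conv_monom:
  "par_a ^ i * par_b ^ j * par_c ^ k * par_d ^ l * par_q ^ m * par_t ^ n =
     to_fract (par_monom (2 * i) (2 * j) (2 * k) (2 * l) (2 * m) (2 * n))"
  by (simp add: to_fract_par_monom par_a_def par_b_def par_c_def par_d_def par_q_def par_t_def
      power_mult[symmetric])

lemma par_power_eqD:
  assumes "par_a ^ i * par_b ^ j * par_c ^ k * par_d ^ l * par_q ^ m * par_t ^ n =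
    par_a ^ i' * par_b ^ j' * par_c ^ k' * par_d ^ l' * par_q ^ m' * par_t ^ n'"
  shows "i = i' \<and> j = j' \<and> k = k' \<and> l = l' \<and> m = m' \<and> n = n'"
  using par_monom_eqD[OF assms[unfolded par_conv_monom]] by simp

lemma par_q_power_neq_1: "n > 0 \<Longrightarrow> par_q ^ n \<noteq> 1"
  using par_power_eqD[of 0 0 0 0 n 0 0 0 0 0 0 0] by auto

text \<open>The genericity condition on which \<open>diff_op_hsum\<close> depends.\<close>

lemma par_a_t_q_neq_t: "par_a ^ 2 * par_t ^ i * par_q ^ j \<noteq> par_t"
  using par_power_eqD[of 2 0 0 0 j i 0 0 0 0 0 1] by (auto simp: mult_ac)


section \<open>Substitution of monomials in Laurent polynomials\<close>

text \<open>Rescaling of a variable and the action of \<open>W\<close> are both of this form.\<close>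

definition monom_subst :: "(expvec \<Rightarrow> expvec) \<Rightarrow> (expvec \<Rightarrow> pfield) \<Rightarrow> laurent \<Rightarrow> laurent" where
  "monom_subst w \<kappa> P = (\<Sum>\<nu>\<in>Poly_Mapping.keys P.
     Poly_Mapping.single (w \<nu>) (\<kappa> \<nu> * Poly_Mapping.lookup P \<nu>))"

lemma sum_single_keys:
  "(\<Sum>k\<in>Poly_Mapping.keys P. Poly_Mapping.single k (Poly_Mapping.lookup P k)) = P"
proof (rule poly_mapping_eqI)
  fix k
  have "(\<Sum>x\<in>Poly_Mapping.keys P. Poly_Mapping.lookup P x when x = k) =
      (\<Sum>x\<in>Poly_Mapping.keys P. if x = k then Poly_Mapping.lookup P x else 0)"
    by (simp add: when_def)
  also have "\<dots> = Poly_Mapping.lookup P k"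
    by (simp add: sum.delta' in_keys_iff)
  finally show "Poly_Mapping.lookup (\<Sum>k\<in>Poly_Mapping.keys P.
      Poly_Mapping.single k (Poly_Mapping.lookup P k)) k = Poly_Mapping.lookup P k"
    by (simp add: lookup_sum lookup_single)
qed

lemma monom_subst_add: "monom_subst w \<kappa> (P + Q) = monom_subst w \<kappa> P + monom_subst w \<kappa> Q"
  unfolding monom_subst_def
  by (rule setsum_keys_plus_distrib) (simp_all add: ring_distribs single_add)

lemma monom_subst_single: "monom_subst w \<kappa> (Poly_Mapping.single \<nu> c) = Poly_Mapping.single (w \<nu>) (\<kappa> \<nu> * c)"
  by (simp add: monom_subst_def)

lemma monom_subst_0: "monom_subst w \<kappa> 0 = 0"
  by (simp add: monom_subst_def)

lemma monom_subst_sum: "monom_subst w \<kappa> (sum f A) = (\<Sum>x\<in>A. monom_subst w \<kappa> (f x))"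
  by (induction A rule: infinite_finite_induct) (simp_all add: monom_subst_add monom_subst_0)

lemma monom_subst_mult:
  assumes "\<And>\<mu> \<nu>. w (\<mu> + \<nu>) = w \<mu> + w \<nu>" "\<And>\<mu> \<nu>. \<kappa> (\<mu> + \<nu>) = \<kappa> \<mu> * \<kappa> \<nu>"
  shows "monom_subst w \<kappa> (P * Q) = monom_subst w \<kappa> P * monom_subst w \<kappa> Q"
proof -
  have "P * Q = (\<Sum>x\<in>Poly_Mapping.keys P. Poly_Mapping.single x (Poly_Mapping.lookup P x)) *
      (\<Sum>y\<in>Poly_Mapping.keys Q. Poly_Mapping.single y (Poly_Mapping.lookup Q y))"
    by (simp add: sum_single_keys)
  also have "\<dots> = (\<Sum>x\<in>Poly_Mapping.keys P. \<Sum>y\<in>Poly_Mapping.keys Q.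
      Poly_Mapping.single (x + y) (Poly_Mapping.lookup P x * Poly_Mapping.lookup Q y))"
    by (simp add: sum_product mult_single)
  finally have "monom_subst w \<kappa> (P * Q) = (\<Sum>x\<in>Poly_Mapping.keys P. \<Sum>y\<in>Poly_Mapping.keys Q.
      Poly_Mapping.single (w x) (\<kappa> x * Poly_Mapping.lookup P x) *
      Poly_Mapping.single (w y) (\<kappa> y * Poly_Mapping.lookup Q y))"
    by (simp add: monom_subst_sum monom_subst_single assms mult_single mult_ac)
  thus ?thesis by (simp add: monom_subst_def sum_product)
qed

lemma zscale_conv_monom_subst:
  "zscale s i P = monom_subst (\<lambda>\<nu>. \<nu>) (\<lambda>\<nu>. s powi (Poly_Mapping.lookup \<nu> i)) P"
proof (rule poly_mapping_eqI)
  fix k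
  have "(\<Sum>x\<in>Poly_Mapping.keys P. s powi (Poly_Mapping.lookup x i) * Poly_Mapping.lookup P x when x = k) =
      (\<Sum>x\<in>Poly_Mapping.keys P. if x = k then s powi (Poly_Mapping.lookup x i) * Poly_Mapping.lookup P x else 0)"
    by (simp add: when_def)
  also have "\<dots> = s powi (Poly_Mapping.lookup k i) * Poly_Mapping.lookup P k"
    by (simp add: sum.delta' in_keys_iff)
  finally show "Poly_Mapping.lookup (zscale s i P) k =
      Poly_Mapping.lookup (monom_subst (\<lambda>\<nu>. \<nu>) (\<lambda>\<nu>. s powi (Poly_Mapping.lookup \<nu> i)) P) k"
    by (simp add: zscale_def monom_subst_def lookup_sum lookup_single lookup_mapp when_def in_keys_iff)
qed

lemma weyl_act_conv_monom_subst: "weyl_act w P = monom_subst w (\<lambda>_. 1) P"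
  by (simp add: weyl_act_def monom_subst_def)

lemma zvar_zinv: "zvar j * zinv j = 1"
  by (simp add: zvar_def zinv_def mult_single single_add[symmetric])

text \<open>A homomorphism over the parameter field. The functions \<open>H\<^sub>l\<close> are evaluated once and for all
  under such maps; the identity, the rescalings and the action of \<open>W\<close> are the instances of interest.\<close>

locale laurent_eval =
  fixes \<tau> :: "laurent \<Rightarrow> lfield"
  assumes add: "\<tau> (P + Q) = \<tau> P + \<tau> Q" and mult: "\<tau> (P * Q) = \<tau> P * \<tau> Q"
    and const: "\<tau> (lconst c) = fconst c"
begin

lemma one: "\<tau> 1 = 1"
  using const[of 1] by (simp add: lconst_def fconst_def)

lemma zero: "\<tau> 0 = 0"
  using const[of 0] by (simp add: lconst_def fconst_def)

lemma diff: "\<tau> (P - Q) = \<tau> P - \<tau> Q"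
  using add[of "P - Q" Q] by simp

lemma sum: "\<tau> (sum f A) = (\<Sum>x\<in>A. \<tau> (f x))"
  by (induction A rule: infinite_finite_induct) (simp_all add: add zero)

lemma prod: "\<tau> (prod f A) = (\<Prod>x\<in>A. \<tau> (f x))"
  by (induction A rule: infinite_finite_induct) (simp_all add: mult one)

lemma zvar_nz: "\<tau> (zvar j) \<noteq> 0" and zinv: "\<tau> (zinv j) = inverse (\<tau> (zvar j))"
proof -
  have "\<tau> (zvar j) * \<tau> (zinv j) = 1" using mult[of "zvar j" "zinv j"] by (simp add: zvar_zinv one)
  thus "\<tau> (zvar j) \<noteq> 0" "\<tau> (zinv j) = inverse (\<tau> (zvar j))"
    by (auto simp: inverse_unique)
qed

end

interpretation fconst: laurent_eval to_fract
  by unfold_locales (simp_all add: fconst_def)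

lemma laurent_eval_monom_subst:
  assumes "\<And>\<mu> \<nu>. w (\<mu> + \<nu>) = w \<mu> + w \<nu>" "\<And>\<mu> \<nu>. \<kappa> (\<mu> + \<nu>) = \<kappa> \<mu> * \<kappa> \<nu>" "w 0 = 0" "\<kappa> 0 = 1"
  shows "laurent_eval (\<lambda>P. to_fract (monom_subst w \<kappa> P))"
  by unfold_locales
     (simp_all add: monom_subst_add monom_subst_mult assms(1,2) lconst_def fconst_def
        monom_subst_single assms(3,4))

lemma fconst_mult [simp]: "fconst (x * y) = fconst x * fconst y"
  and fconst_add: "fconst (x + y) = fconst x + fconst y"
  and fconst_diff: "fconst (x - y) = fconst x - fconst y"
  and fconst_uminus: "fconst (- x) = - fconst x"
  and fconst_1 [simp]: "fconst 1 = 1"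
  and fconst_0 [simp]: "fconst 0 = 0"
  by (simp_all add: fconst_def lconst_def mult_single single_add single_diff single_uminus
      flip: to_fract_mult to_fract_add to_fract_diff to_fract_uminus)

lemma fconst_eq_iff [simp]: "fconst x = fconst y \<longleftrightarrow> x = y"
  unfolding fconst_def lconst_def to_fract_eq_iff by (metis lookup_single_eq)

lemma fconst_eq_0_iff [simp]: "fconst x = 0 \<longleftrightarrow> x = 0"
  using fconst_eq_iff[of x 0] by simp

lemma fconst_inverse: "fconst (inverse x) = inverse (fconst x)"
proof (cases "x = 0")
  case False
  hence "fconst x * fconst (inverse x) = 1" by (simp flip: fconst_mult)
  thus ?thesis by (rule inverse_unique[symmetric])
qed simp

lemma fconst_divide: "fconst (x / y) = fconst x / fconst y"
  by (simp add: divide_inverse fconst_inverse)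

lemma fconst_power: "fconst (x ^ n) = fconst x ^ n"
  by (induction n) simp_all

lemma fconst_prod: "fconst (\<Prod>i\<in>A. f i) = (\<Prod>i\<in>A. fconst (f i))"
  by (induction A rule: infinite_finite_induct) simp_all


section \<open>The brackets\<close>

lemma half_monomial_mult: "half_monomial x \<Longrightarrow> half_monomial y \<Longrightarrow> half_monomial (x * y)"
proof -
  assume "half_monomial x" "half_monomial y"
  then obtain i j k l m n i' j' k' l' m' n' where
    x: "x = a_half powi i * b_half powi j * c_half powi k * d_half powi l * q_half powi m * t_half powi n"
    and y: "y = a_half powi i' * b_half powi j' * c_half powi k' * d_half powi l' * q_half powi m' * t_half powi n'"
    unfolding half_monomial_def by blast
  have "x * y = a_half powi (i + i') * b_half powi (j + j') * c_half powi (k + k') *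
      d_half powi (l + l') * q_half powi (m + m') * t_half powi (n + n')"
    unfolding x y by (simp add: power_int_add mult_ac)
  thus ?thesis unfolding half_monomial_def by blast
qed

lemma half_monomial_inverse: "half_monomial x \<Longrightarrow> half_monomial (inverse x)"
proof -
  assume "half_monomial x"
  then obtain i j k l m n where
    x: "x = a_half powi i * b_half powi j * c_half powi k * d_half powi l * q_half powi m * t_half powi n"
    unfolding half_monomial_def by blast
  have "inverse x = a_half powi (- i) * b_half powi (- j) * c_half powi (- k) *
      d_half powi (- l) * q_half powi (- m) * t_half powi (- n)"
    unfolding x by (simp add: power_int_minus)
  thus ?thesis unfolding half_monomial_def by blast
qed

lemma half_monomial_1: "half_monomial 1"
  unfolding half_monomial_def by (intro exI[of _ 0]) simp

lemma half_monomial_power: "half_monomial x \<Longrightarrow> half_monomial (x ^ n)"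
  by (induction n) (simp_all add: half_monomial_1 half_monomial_mult)

lemma half_monomial_half:
  "half_monomial a_half" "half_monomial b_half" "half_monomial c_half"
  "half_monomial d_half" "half_monomial q_half" "half_monomial t_half"
proof -
  have h: "half_monomial (a_half powi i * b_half powi j * c_half powi k *
     d_half powi l * q_half powi m * t_half powi n)" for i j k l m n
    unfolding half_monomial_def by blast
  show "half_monomial a_half" using h[of 1 0 0 0 0 0] by simp
  show "half_monomial b_half" using h[of 0 1 0 0 0 0] by simp
  show "half_monomial c_half" using h[of 0 0 1 0 0 0] by simp
  show "half_monomial d_half" using h[of 0 0 0 1 0 0] by simp
  show "half_monomial q_half" using h[of 0 0 0 0 1 0] by simp
  show "half_monomial t_half" using h[of 0 0 0 0 0 1] by simp
qed

lemmas half_monomial_intros =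
  half_monomial_mult half_monomial_inverse half_monomial_power half_monomial_half half_monomial_1

lemma half_monomial_nz: "half_monomial x \<Longrightarrow> x \<noteq> 0"
  unfolding half_monomial_def by auto

lemma diff_inverse_conv:
  fixes x :: "'f::field"
  shows "x \<noteq> 0 \<Longrightarrow> x - inverse x = - (1 - x ^ 2) / x"
  by (simp add: field_simps power2_eq_square)

lemma bracket_quotient:
  fixes x y w :: "'f::field"
  assumes "w \<noteq> 0" "x \<noteq> 0" "y \<noteq> 0"
  shows "(- A / (w * x)) / (- B / (w * y)) = (y / x) * (A / B)"
  using assms by simp

lemma ang_square:
  assumes "half_monomial x"
  shows "ang (x ^ 2) = - (1 - x ^ 2) / x"
  unfolding ang_def msqrt_power2[OF assms] by (rule diff_inverse_conv[OF half_monomial_nz[OF assms]])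

lemma ang_fact_square:
  assumes "half_monomial x"
  shows "ang_fact (x ^ 2) l = (\<Prod>k<l. - (1 - par_q ^ k * x ^ 2) / (q_half ^ k * x))"
  unfolding ang_fact_def
proof (rule prod.cong[OF refl])
  fix k
  have "par_q ^ k * x ^ 2 = (q_half ^ k * x) ^ 2"
    by (simp add: par_q_def power_mult_distrib power_mult[symmetric] mult.commute)
  thus "ang (par_q ^ k * x ^ 2) = - (1 - par_q ^ k * x ^ 2) / (q_half ^ k * x)"
    using ang_square[OF half_monomial_mult[OF half_monomial_power[OF half_monomial_half(5), of k] assms]]
    by (simp only:)
qed

text \<open>The half-integral powers in \<open>\<langle>t\<rangle>\<^bsub>q,n\<^esub>\<close> and \<open>\<langle>q\<rangle>\<^bsub>q,n\<^esub>\<close> cancel except for \<open>(q/t)\<^bsup>1/2\<^esup>\<close> in each factor.\<close>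

lemma bracket_ratio:
  "ang_fact par_t n / ang_fact par_q n =
     (q_half / t_half) ^ n * (\<Prod>i<n. (1 - par_t * par_q ^ i) / (1 - par_q ^ Suc i))"
proof -
  have "ang_fact par_t n / ang_fact par_q n =
      (\<Prod>k<n. (- (1 - par_q ^ k * par_t) / (q_half ^ k * t_half)) /
        (- (1 - par_q ^ k * par_q) / (q_half ^ k * q_half)))"
    unfolding ang_fact_square[OF half_monomial_half(6), of n, folded par_t_def]
      ang_fact_square[OF half_monomial_half(5), of n, folded par_q_def] by (rule prod_dividef[symmetric])
  also have "\<dots> = (\<Prod>k<n. (q_half / t_half) * ((1 - par_t * par_q ^ k) / (1 - par_q ^ Suc k)))"
    unfolding power_Suc2 mult.commute[of par_t]
    by (intro prod.cong refl bracket_quotient) (simp_all only: half_nz power_not_zero simp_thms not_False_eq_True)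
  also have "\<dots> = (q_half / t_half) ^ n * (\<Prod>i<n. (1 - par_t * par_q ^ i) / (1 - par_q ^ Suc i))"
    unfolding prod.distrib prod_constant card_lessThan ..
  finally show ?thesis .
qed


section \<open>The functions \<open>H\<^sub>l\<close> under substitution\<close>

definition al_half :: pfield where
  "al_half = a_half * b_half * c_half * d_half * inverse q_half"

lemma al_half_power2: "al_half ^ 2 = par_a * par_b * par_c * par_d * inverse par_q"
  by (simp only: al_half_def par_a_def par_b_def par_c_def par_d_def par_q_def
      power_mult_distrib power_inverse)

lemma msqrt_al: "msqrt (par_a * par_b * par_c * par_d * inverse par_q) = al_half"
proof -
  have "half_monomial al_half"
    unfolding al_half_def by (intro half_monomial_intros)
  thus ?thesis unfolding al_half_power2[symmetric] by (rule msqrt_power2)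
qed

text \<open>Characteristic zero.\<close>

lemma fconst_neq_minus:
  assumes "x \<noteq> 0" shows "fconst x \<noteq> - fconst x"
proof
  assume "fconst x = - fconst x"
  hence "x = - x" by (simp only: fconst_uminus[symmetric] fconst_eq_iff)
  hence "x + x = 0" by (metis add.right_inverse)
  hence "(1 + 1) * x = 0" by (simp only: ring_distribs mult_1_left)
  hence "(1 + 1 :: pfield) = 0" using assms by (metis mult_eq_0_iff)
  thus False by simp
qed

interpretation K: koornwinder_field "fconst par_q" "fconst par_t" "fconst par_a" "fconst par_b"
  "fconst par_c" "fconst par_d" "fconst al_half" "fconst (inverse t_half)"
proof unfold_locales
  show "fconst par_q ^ n \<noteq> 1" if "n > 0" for n
    using par_q_power_neq_1[OF that] by (metis fconst_power fconst_1 fconst_eq_iff)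
  show "fconst al_half ^ 2 = fconst par_a * fconst par_b * fconst par_c * fconst par_d / fconst par_q"
    unfolding fconst_power[symmetric] al_half_power2 divide_inverse fconst_inverse[symmetric]
      fconst_mult[symmetric] ..
  show "fconst par_t * fconst (inverse t_half) ^ 2 = 1"
  proof -
    have "par_t * inverse t_half ^ 2 = 1"
      by (simp only: par_t_def power_mult_distrib[symmetric] right_inverse[OF half_nz(6)] power_one)
    thus ?thesis by (metis fconst_power fconst_mult fconst_1)
  qed
  show "fconst (inverse t_half) \<noteq> - fconst (inverse t_half)"
    by (rule fconst_neq_minus) (simp only: inverse_nonzero_iff_nonzero half_nz not_False_eq_True simp_thms)
qed (simp_all only: fconst_eq_0_iff par_nz not_False_eq_True simp_thms)

definition compositions :: "nat \<Rightarrow> nat \<Rightarrow> (nat \<Rightarrow> nat) set" where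
  "compositions m l = {\<nu> \<in> {1..m} \<rightarrow>\<^sub>E (UNIV :: nat set). (\<Sum>j=1..m. \<nu> j) = l}"

lemma finite_compositions: "finite (compositions m l)"
proof (rule finite_subset)
  show "compositions m l \<subseteq> {1..m} \<rightarrow>\<^sub>E {..l}"
  proof
    fix \<nu> assume \<nu>: "\<nu> \<in> compositions m l"
    hence "\<nu> j \<le> l" if "j \<in> {1..m}" for j
      using member_le_sum[of j "{1..m}" \<nu>] that by (auto simp: compositions_def)
    thus "\<nu> \<in> {1..m} \<rightarrow>\<^sub>E {..l}" using \<nu> by (auto simp: compositions_def PiE_iff)
  qed
  show "finite ({1..m} \<rightarrow>\<^sub>E {..l})" by (intro finite_PiE) auto
qed

text \<open>Splitting off the last part. The parts before it are a composition of the partial sum \<open>k\<close>.\<close>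

lemma sum_compositions_Suc:
  "(\<Sum>\<nu>\<in>compositions (Suc m) l. f \<nu>) =
    (\<Sum>k\<le>l. \<Sum>\<nu>\<in>compositions m k. f (\<nu>(Suc m := l - k)))"
proof -
  have "(\<Sum>k\<le>l. \<Sum>\<nu>\<in>compositions m k. f (\<nu>(Suc m := l - k))) =
      (\<Sum>(k, \<nu>)\<in>(SIGMA k:{..l}. compositions m k). f (\<nu>(Suc m := l - k)))"
    by (rule sum.Sigma) (simp_all add: finite_compositions)
  also have "\<dots> = (\<Sum>\<nu>\<in>compositions (Suc m) l. f \<nu>)"
  proof (rule sum.reindex_bij_witness[of _ "\<lambda>\<nu>. (\<Sum>j=1..m. \<nu> j, \<nu>(Suc m := undefined))"
        "\<lambda>(k, \<nu>). \<nu>(Suc m := l - k)"])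
    fix p assume "p \<in> (SIGMA k:{..l}. compositions m k)"
    then obtain k \<nu> where p: "p = (k, \<nu>)" "k \<le> l" "\<nu> \<in> {1..m} \<rightarrow>\<^sub>E (UNIV :: nat set)"
      "(\<Sum>j=1..m. \<nu> j) = k" by (auto simp: compositions_def)
    have s: "(\<Sum>j=1..m. (\<nu>(Suc m := x)) j) = k" for x
      unfolding p(4)[symmetric] by (rule sum.cong) auto
    have und: "\<nu> (Suc m) = undefined" by (rule PiE_arb[OF p(3)]) simp
    show "(case p of (k, \<nu>) \<Rightarrow> \<nu>(Suc m := l - k)) \<in> compositions (Suc m) l"
      using p s by (auto simp: compositions_def PiE_def extensional_def)
    show "(\<lambda>\<nu>. (\<Sum>j=1..m. \<nu> j, \<nu>(Suc m := undefined))) (case p of (k, \<nu>) \<Rightarrow> \<nu>(Suc m := l - k)) = p"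
      using s und by (auto simp: p(1) fun_eq_iff)
    show "f (case p of (k, \<nu>) \<Rightarrow> \<nu>(Suc m := l - k)) = (case p of (k, \<nu>) \<Rightarrow> f (\<nu>(Suc m := l - k)))"
      by (simp add: p(1))
  next
    fix \<nu> assume \<nu>: "\<nu> \<in> compositions (Suc m) l"
    hence s: "(\<Sum>j=1..m. \<nu> j) + \<nu> (Suc m) = l" and e: "\<nu> \<in> {1..Suc m} \<rightarrow>\<^sub>E (UNIV :: nat set)"
      by (auto simp: compositions_def)
    have s': "(\<Sum>j=1..m. (\<nu>(Suc m := x)) j) = (\<Sum>j=1..m. \<nu> j)" for x
      by (rule sum.cong) auto
    show "(\<Sum>j=1..m. \<nu> j, \<nu>(Suc m := undefined)) \<in> (SIGMA k:{..l}. compositions m k)"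
      using s s' e by (auto simp: compositions_def PiE_def extensional_def)
    show "(case (\<Sum>j=1..m. \<nu> j, \<nu>(Suc m := undefined)) of (k, \<nu>) \<Rightarrow> \<nu>(Suc m := l - k)) = \<nu>"
      using s by (auto simp: fun_eq_iff)
  qed
  finally show ?thesis ..
qed

lemma H_fun_0: "H_fun 0 l = (if l = 0 then 1 else 0)"
  by (auto simp: H_fun_def)

lemma H_fun_Suc:
  "H_fun (Suc m) l = (\<Sum>k\<le>l. H_fun m k * (lconst (ang_fact par_t (l - k) / ang_fact par_q (l - k)) *
     ang2_fact (Suc m) (par_t ^ m * par_q ^ k * par_a) (l - k)))"
proof -
  define g where "g \<nu> j = lconst (ang_fact par_t (\<nu> j) / ang_fact par_q (\<nu> j)) *
     ang2_fact j (par_t ^ (j - 1) * par_q ^ (\<Sum>i=1..<j. \<nu> i) * par_a) (\<nu> j)" for \<nu> :: "nat \<Rightarrow> nat" and j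
  have H: "H_fun n k = (\<Sum>\<nu>\<in>compositions n k. \<Prod>j=1..n. g \<nu> j)" for n k
    by (simp add: H_fun_def compositions_def g_def)
  have g: "(\<Prod>j=1..Suc m. g (\<nu>(Suc m := x)) j) = (\<Prod>j=1..m. g \<nu> j) *
      (lconst (ang_fact par_t x / ang_fact par_q x) * ang2_fact (Suc m) (par_t ^ m * par_q ^ k * par_a) x)"
    if \<nu>: "\<nu> \<in> compositions m k" for \<nu> x k
  proof -
    have "(\<Sum>i=1..<Suc m. (\<nu>(Suc m := x)) i) = (\<Sum>i=1..m. \<nu> i)"
      by (rule sum.cong) auto
    hence "(\<Sum>i=1..<Suc m. (\<nu>(Suc m := x)) i) = k" using \<nu> by (simp add: compositions_def)
    hence 1: "g (\<nu>(Suc m := x)) (Suc m) = lconst (ang_fact par_t x / ang_fact par_q x) *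
        ang2_fact (Suc m) (par_t ^ m * par_q ^ k * par_a) x"
      by (simp only: g_def fun_upd_same diff_Suc_1)
    have 2: "g (\<nu>(Suc m := x)) j = g \<nu> j" if "j \<in> {1..m}" for j
    proof -
      have "(\<Sum>i=1..<j. (\<nu>(Suc m := x)) i) = (\<Sum>i=1..<j. \<nu> i)"
        using that by (intro sum.cong) auto
      moreover have "(\<nu>(Suc m := x)) j = \<nu> j" using that by auto
      ultimately show ?thesis by (simp only: g_def)
    qed
    have "(\<Prod>j=1..m. g (\<nu>(Suc m := x)) j) = (\<Prod>j=1..m. g \<nu> j)" by (rule prod.cong[OF refl 2])
    thus ?thesis by (simp only: prod.cl_ivl_Suc 1) simp
  qed
  show ?thesis
    unfolding H sum_compositions_Suc sum_distrib_right by (intro sum.cong refl g)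
qed

context laurent_eval
begin

lemma bracket_eval:
  assumes "w \<noteq> 0"
  shows "\<tau> (lconst (ang_fact par_t n / ang_fact par_q n) * ang2_fact j w n) =
    fconst (q_half / t_half) ^ n * K.hfun n (fconst w) (\<tau> (zvar j))"
proof -
  have "\<tau> (ang2_fact j w n) = (\<Prod>k<n. \<tau> (zvar j) + inverse (\<tau> (zvar j)) -
      fconst par_q ^ k * fconst w - inverse (fconst par_q ^ k * fconst w))"
    unfolding ang2_fact_def prod
    by (intro prod.cong refl)
       (simp only: ang2_def diff add zinv const fconst_mult fconst_power fconst_inverse)
  moreover have "fconst (ang_fact par_t n / ang_fact par_q n) = fconst (q_half / t_half) ^ n *
      (\<Prod>i<n. (1 - fconst par_t * fconst par_q ^ i) / (1 - fconst par_q ^ Suc i))"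
    unfolding bracket_ratio
    by (simp only: fconst_mult fconst_prod fconst_divide fconst_diff fconst_power fconst_1)
  ultimately show ?thesis
    by (simp only: mult const K.hfun_def mult.assoc)
qed

text \<open>The recursion of \<open>hsum\<close> is that of \<open>H\<^sub>l\<close> once the factor \<open>(q/t)\<^bsup>l/2\<^esup>\<close> is distributed over the
  parts.\<close>

theorem H_fun_eval:
  "\<tau> (H_fun m l) = fconst (q_half / t_half) ^ l * K.hsum (fconst par_a) m l (\<lambda>j. \<tau> (zvar j))"
proof (induction m arbitrary: l)
  case 0
  show ?case by (simp add: H_fun_0 one zero)
next
  case (Suc m)
  have "\<tau> (H_fun (Suc m) l) = (\<Sum>k\<le>l. \<tau> (H_fun m k) *
      \<tau> (lconst (ang_fact par_t (l - k) / ang_fact par_q (l - k)) *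
        ang2_fact (Suc m) (par_t ^ m * par_q ^ k * par_a) (l - k)))"
    unfolding H_fun_Suc by (simp only: sum mult)
  also have "\<dots> = (\<Sum>k\<le>l. fconst (q_half / t_half) ^ l * (K.hsum (fconst par_a) m k (\<lambda>j. \<tau> (zvar j)) *
      K.hfun (l - k) (fconst par_t ^ m * fconst par_q ^ k * fconst par_a) (\<tau> (zvar (Suc m)))))"
  proof (rule sum.cong[OF refl])
    fix k assume "k \<in> {..l}"
    hence e: "fconst (q_half / t_half) ^ l = fconst (q_half / t_half) ^ k * fconst (q_half / t_half) ^ (l - k)"
      by (simp only: power_add[symmetric] atMost_iff le_add_diff_inverse)
    have nz: "par_t ^ m * par_q ^ k * par_a \<noteq> 0"
      by (simp only: mult_eq_0_iff power_eq_0_iff par_nz simp_thms)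
    show "\<tau> (H_fun m k) * \<tau> (lconst (ang_fact par_t (l - k) / ang_fact par_q (l - k)) *
        ang2_fact (Suc m) (par_t ^ m * par_q ^ k * par_a) (l - k)) =
      fconst (q_half / t_half) ^ l * (K.hsum (fconst par_a) m k (\<lambda>j. \<tau> (zvar j)) *
      K.hfun (l - k) (fconst par_t ^ m * fconst par_q ^ k * fconst par_a) (\<tau> (zvar (Suc m))))"
      unfolding Suc.IH bracket_eval[OF nz] e unfolding fconst_mult fconst_power by (simp only: mult_ac)
  qed
  finally show ?case by (simp only: K.hsum.simps sum_distrib_left)
qed

end

lemma to_fract_single_eqD:
  assumes "to_fract (Poly_Mapping.single \<mu> c) = to_fract (Poly_Mapping.single \<nu> e)" "c \<noteq> (0 :: pfield)"
  shows "\<mu> = (\<nu> :: expvec)"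
proof -
  have "Poly_Mapping.lookup (Poly_Mapping.single \<nu> e) \<mu> = c"
    using assms(1) by (metis to_fract_eq_iff lookup_single_eq)
  thus ?thesis using assms(2) by (metis lookup_single_not_eq)
qed

lemma fconst_zf: "fconst c * zf i = to_fract (Poly_Mapping.single (Poly_Mapping.single i 1) c)"
  by (simp add: fconst_def zf_def lconst_def zvar_def mult_single flip: to_fract_mult)

lemma zf_mult: "zf i * zf j = to_fract (Poly_Mapping.single (Poly_Mapping.single i 1 + Poly_Mapping.single j 1) 1)"
  by (simp add: zf_def zvar_def mult_single flip: to_fract_mult)

lemma zf_nz: "zf i \<noteq> 0"
  using fconst.zvar_nz[of i] by (simp add: zf_def)

lemma single_sum_neq_0: "Poly_Mapping.single i 1 + Poly_Mapping.single j 1 \<noteq> (0 :: expvec)"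
proof
  assume "Poly_Mapping.single i 1 + Poly_Mapping.single j 1 = (0 :: expvec)"
  hence "Poly_Mapping.lookup (Poly_Mapping.single i 1 + Poly_Mapping.single j 1) i = (0 :: int)" by simp
  thus False by (simp add: lookup_add lookup_single when_def split: if_splits)
qed

lemma zf_mult_neq_const: "fconst c * (zf i * zf j) \<noteq> fconst e" if "c \<noteq> 0"
proof
  assume "fconst c * (zf i * zf j) = fconst e"
  hence "to_fract (Poly_Mapping.single (Poly_Mapping.single i 1 + Poly_Mapping.single j 1) c) =
      to_fract (Poly_Mapping.single 0 e :: laurent)"
    by (simp add: fconst_def zf_mult lconst_def mult_single flip: to_fract_mult)
  from to_fract_single_eqD[OF this that] show False using single_sum_neq_0 by blast
qed

lemma zf_inj: "zf i = zf j \<Longrightarrow> i = j"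
proof -
  assume "zf i = zf j"
  from to_fract_single_eqD[OF this[unfolded zf_def zvar_def]]
  have "Poly_Mapping.single i 1 = (Poly_Mapping.single j 1 :: expvec)" by simp
  hence "Poly_Mapping.lookup (Poly_Mapping.single j 1) i = (1 :: int)" by (metis lookup_single_eq)
  thus ?thesis by (simp add: lookup_single when_def split: if_splits)
qed

lemma regular_zf: "K.regular m zf"
  unfolding K.regular_def power2_eq_square
proof (intro conjI ballI impI)
  fix i
  have n1: "c \<noteq> 0 \<Longrightarrow> fconst c * (zf i * zf j) \<noteq> 1" for c j using zf_mult_neq_const[of c i j 1] by simp
  have n2: "fconst c \<noteq> zf i * zf i" for c using zf_mult_neq_const[of 1 i i c] by (simp add: eq_commute)
  show "zf i \<noteq> 0" by (rule zf_nz)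
  show "fconst par_q * (zf i * zf i) \<noteq> 1" "fconst par_t * (zf i * zf i) \<noteq> 1"
    using n1 par_nz by blast+
  show "fconst par_q \<noteq> zf i * zf i" "fconst par_t \<noteq> zf i * zf i" by (rule n2)+
  fix j
  show "zf i * zf j \<noteq> 1" using n1[of 1 j] by simp
  show "i = j" if "zf i = zf j" using that by (rule zf_inj)
qed

lemma koorn_A_conv: "koorn_A m i x = K.Acoeff m i x"
  unfolding koorn_A_def K.Acoeff_def K.quartic_def msqrt_al ..

lemma laurent_eval_zscale:
  assumes "s \<noteq> 0"
  shows "laurent_eval (\<lambda>P. to_fract (zscale s i P))"
  unfolding zscale_conv_monom_subst
  by (rule laurent_eval_monom_subst) (simp_all add: lookup_add power_int_add assms)

lemma zscale_zvar:
  "to_fract (zscale s i (zvar j)) = (zf(i := fconst s * zf i)) j"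
proof -
  have "zscale s i (zvar j) = Poly_Mapping.single (Poly_Mapping.single j 1)
      (s powi (Poly_Mapping.lookup (Poly_Mapping.single j 1) i) * 1)"
    unfolding zscale_conv_monom_subst zvar_def monom_subst_single ..
  thus ?thesis
    by (cases "i = j") (simp_all add: fconst_zf lookup_single_not_eq, simp add: zf_def zvar_def)
qed

text \<open>The point \<open>z\<close> itself is regular in the field of rational functions, and rescaling \<open>z\<^sub>i\<close> in \<open>H\<^sub>l\<close> amounts to
  evaluating at the rescaled point. The normalisation \<open>(q/t)\<^bsup>l/2\<^esup>\<close> accounts for the extra factor in
  the second term.\<close>

theorem koorn_op_H_fun:
  assumes m: "m \<ge> 1"
  shows "fconst al_half * fconst par_t ^ (m - 1) * koorn_op m (H_fun m l) =
    K.eigen_coeff (fconst par_t ^ m) l * to_fract (H_fun m l) +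
    (if l = 0 then 0 else fconst (q_half / t_half) * K.raise_coeff (fconst par_t ^ m) (l - 1) *
      to_fract (H_fun m (l - 1)))"
proof -
  define \<rho> where "\<rho> = fconst (q_half / t_half)"
  define g where "g k = K.hsum (fconst par_a) m k" for k
  have e0: "to_fract (H_fun m k) = \<rho> ^ k * g k zf" for k
    unfolding fconst.H_fun_eval \<rho>_def g_def by (simp only: zf_def[abs_def])
  have e: "to_fract (zscale s i (H_fun m l)) = \<rho> ^ l * g l (zf(i := fconst s * zf i))" if "s \<noteq> 0" for s i
  proof -
    interpret Z: laurent_eval "\<lambda>P. to_fract (zscale s i P)" by (rule laurent_eval_zscale[OF that])
    show ?thesis unfolding Z.H_fun_eval zscale_zvar \<rho>_def g_def ..
  qed
  have iq: "inverse par_q \<noteq> 0" by (simp only: inverse_nonzero_iff_nonzero par_nz not_False_eq_True)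
  have r: "A * (\<rho> ^ l * x - \<rho> ^ l * y) = \<rho> ^ l * (A * (x - y))" for A x y
    by (simp only: right_diff_distrib mult.left_commute)
  have k1: "koorn_op m (H_fun m l) = \<rho> ^ l * K.diff_op m zf (g l)"
    unfolding koorn_op_def K.diff_op_def koorn_A_conv to_fract_diff e[OF par_nz(5)] e[OF iq] e0
      fconst_inverse
    by (simp only: r distrib_left sum_distrib_left)
  have k2: "fconst al_half * fconst par_t ^ (m - 1) * K.diff_op m zf (g l) =
      K.eigen_coeff (fconst par_t ^ m) l * g l zf +
      (if l = 0 then 0 else K.raise_coeff (fconst par_t ^ m) (l - 1) * g (l - 1) zf)"
    unfolding g_def
  proof (rule K.diff_op_hsum[OF regular_zf m])
    fix i j
    show "fconst par_a ^ 2 * fconst par_t ^ i * fconst par_q ^ j \<noteq> fconst par_t"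
      using par_a_t_q_neq_t[of i j] by (simp only: fconst_power[symmetric] fconst_mult[symmetric] fconst_eq_iff not_False_eq_True)
  qed
  have "fconst al_half * fconst par_t ^ (m - 1) * koorn_op m (H_fun m l) =
      \<rho> ^ l * (K.eigen_coeff (fconst par_t ^ m) l * g l zf +
      (if l = 0 then 0 else K.raise_coeff (fconst par_t ^ m) (l - 1) * g (l - 1) zf))"
    unfolding k1 mult.left_commute[of _ "\<rho> ^ l"] k2 ..
  also have "\<dots> = K.eigen_coeff (fconst par_t ^ m) l * (\<rho> ^ l * g l zf) +
    (if l = 0 then 0 else \<rho> * K.raise_coeff (fconst par_t ^ m) (l - 1) * (\<rho> ^ (l - 1) * g (l - 1) zf))"
    by (cases l) (simp_all only: ring_distribs mult_ac power_Suc diff_Suc_1 nat.simps if_True if_False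
         mult_zero_right add_0_right refl simp_thms)
  finally show ?thesis unfolding e0 \<rho>_def .
qed


section \<open>Leading monomials in the lexicographic order\<close>

abbreviation lk :: "('a \<Rightarrow>\<^sub>0 'b::zero) \<Rightarrow> 'a \<Rightarrow> 'b" where "lk \<equiv> Poly_Mapping.lookup"
abbreviation sg :: "'a \<Rightarrow> 'b \<Rightarrow> ('a \<Rightarrow>\<^sub>0 'b::zero)" where "sg \<equiv> Poly_Mapping.single"

text \<open>The order on exponent vectors is the lexicographic one in which \<open>z\<^sub>1\<close> is the largest variable; it is
  compatible with addition, and the lemmas hold for every such order.\<close>

definition bounded_by :: "('g::linordered_ab_group_add \<Rightarrow>\<^sub>0 'k::field) \<Rightarrow> 'g \<Rightarrow> bool" where
  "bounded_by P \<alpha> \<longleftrightarrow> (\<forall>\<nu>. lk P \<nu> \<noteq> 0 \<longrightarrow> \<nu> \<le> \<alpha>)"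

lemma bounded_byD: "bounded_by P \<alpha> \<Longrightarrow> \<alpha> < \<nu> \<Longrightarrow> lk P \<nu> = 0"
  unfolding bounded_by_def using leD by blast

lemma bounded_by_keysD: "bounded_by P \<alpha> \<Longrightarrow> \<nu> \<in> Poly_Mapping.keys P \<Longrightarrow> \<nu> \<le> \<alpha>"
  unfolding bounded_by_def in_keys_iff by (drule spec, erule mp)

lemma bounded_by_add:
  assumes "bounded_by P \<alpha>" "bounded_by Q \<alpha>"
  shows "bounded_by (P + Q) \<alpha>"
  unfolding bounded_by_def
proof (intro allI impI)
  fix \<nu> assume "lk (P + Q) \<nu> \<noteq> 0"
  hence "lk P \<nu> \<noteq> 0 \<or> lk Q \<nu> \<noteq> 0" unfolding lookup_add by (cases "lk Q \<nu> = 0") simp_all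
  thus "\<nu> \<le> \<alpha>" using assms unfolding bounded_by_def by blast
qed

lemma bounded_by_diff:
  assumes "bounded_by P \<alpha>" "bounded_by Q \<alpha>"
  shows "bounded_by (P - Q) \<alpha>"
  unfolding bounded_by_def
proof (intro allI impI)
  fix \<nu> assume "lk (P - Q) \<nu> \<noteq> 0"
  hence "lk P \<nu> \<noteq> 0 \<or> lk Q \<nu> \<noteq> 0" unfolding lookup_minus by (cases "lk Q \<nu> = 0") simp_all
  thus "\<nu> \<le> \<alpha>" using assms unfolding bounded_by_def by blast
qed

text \<open>Leading coefficients multiply: \<open>x + y = \<alpha> + \<beta>\<close> with \<open>x \<le> \<alpha>\<close> and \<open>y \<le> \<beta>\<close> forces equality.\<close>

lemma bounded_by_mult:
  assumes P: "bounded_by P \<alpha>" and Q: "bounded_by Q \<beta>"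
  shows "bounded_by (P * Q) (\<alpha> + \<beta>)" and "lk (P * Q) (\<alpha> + \<beta>) = lk P \<alpha> * lk Q \<beta>"
proof -
  show "bounded_by (P * Q) (\<alpha> + \<beta>)"
    unfolding bounded_by_def
  proof (intro allI impI)
    fix \<nu> assume "lk (P * Q) \<nu> \<noteq> 0"
    hence "\<nu> \<in> Poly_Mapping.keys (P * Q)" by (simp only: in_keys_iff not_False_eq_True)
    then obtain x y where "\<nu> = x + y" "x \<in> Poly_Mapping.keys P" "y \<in> Poly_Mapping.keys Q"
      using keys_mult[of P Q] by blast
    thus "\<nu> \<le> \<alpha> + \<beta>" using bounded_by_keysD[OF P] bounded_by_keysD[OF Q] by (simp only: add_mono)
  qed
  have "P * Q = (\<Sum>x\<in>Poly_Mapping.keys P. sg x (lk P x)) * (\<Sum>y\<in>Poly_Mapping.keys Q. sg y (lk Q y))"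
    by (simp only: sum_single_keys)
  also have "\<dots> = (\<Sum>x\<in>Poly_Mapping.keys P. \<Sum>y\<in>Poly_Mapping.keys Q. sg (x + y) (lk P x * lk Q y))"
    by (simp only: sum_product mult_single)
  finally have "lk (P * Q) (\<alpha> + \<beta>) = (\<Sum>x\<in>Poly_Mapping.keys P. \<Sum>y\<in>Poly_Mapping.keys Q.
      (if x + y = \<alpha> + \<beta> then lk P x * lk Q y else 0))"
    by (simp only: lookup_sum lookup_single when_def)
  also have "\<dots> = (\<Sum>x\<in>Poly_Mapping.keys P. \<Sum>y\<in>Poly_Mapping.keys Q.
      (if x = \<alpha> then if y = \<beta> then lk P \<alpha> * lk Q \<beta> else 0 else 0))"
  proof (intro sum.cong refl)
    fix x y assume "x \<in> Poly_Mapping.keys P" "y \<in> Poly_Mapping.keys Q"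
    hence le: "x \<le> \<alpha>" "y \<le> \<beta>" using bounded_by_keysD[OF P] bounded_by_keysD[OF Q] by blast+
    have "x + y = \<alpha> + \<beta> \<longleftrightarrow> x = \<alpha> \<and> y = \<beta>"
    proof
      assume e: "x + y = \<alpha> + \<beta>"
      have "x = \<alpha>"
      proof (rule ccontr)
        assume "x \<noteq> \<alpha>"
        hence "x + y < \<alpha> + \<beta>" using le by (intro add_less_le_mono) auto
        thus False using e by simp
      qed
      thus "x = \<alpha> \<and> y = \<beta>" using e by simp
    qed simp
    thus "(if x + y = \<alpha> + \<beta> then lk P x * lk Q y else 0) =
        (if x = \<alpha> then if y = \<beta> then lk P \<alpha> * lk Q \<beta> else 0 else 0)" by simp
  qed
  also have "\<dots> = (if \<alpha> \<in> Poly_Mapping.keys P then if \<beta> \<in> Poly_Mapping.keys Q then lk P \<alpha> * lk Q \<beta> else 0 else 0)"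
  proof -
    have "(\<Sum>y\<in>Poly_Mapping.keys Q. (if x = \<alpha> then if y = \<beta> then lk P \<alpha> * lk Q \<beta> else 0 else 0)) =
        (if x = \<alpha> then if \<beta> \<in> Poly_Mapping.keys Q then lk P \<alpha> * lk Q \<beta> else 0 else 0)" for x
      by (cases "x = \<alpha>") (simp_all only: if_True if_False refl sum.delta'[OF finite_keys] sum.neutral_const
          sum.delta[OF finite_keys])
    thus ?thesis by (simp only: sum.delta[OF finite_keys] sum.delta'[OF finite_keys])
  qed
  also have "\<dots> = lk P \<alpha> * lk Q \<beta>"
    by (cases "lk P \<alpha> = 0"; cases "lk Q \<beta> = 0") (simp_all only: in_keys_iff mult_zero_left mult_zero_right if_cancel
        simp_thms if_True if_False not_False_eq_True)
  finally show "lk (P * Q) (\<alpha> + \<beta>) = lk P \<alpha> * lk Q \<beta>" .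
qed

lemma bounded_by_single: "bounded_by (sg \<mu> c) \<mu>"
  by (simp add: bounded_by_def lookup_single when_def)

lemma bounded_by_prod:
  assumes "finite A" "\<And>x. x \<in> A \<Longrightarrow> bounded_by (f x) (\<alpha> x)"
  shows "bounded_by (prod f A) (sum \<alpha> A) \<and> lk (prod f A) (sum \<alpha> A) = (\<Prod>x\<in>A. lk (f x) (\<alpha> x))"
  using assms
proof (induction A)
  case empty
  show ?case by (simp add: bounded_by_def lookup_one when_def)
next
  case (insert x A)
  hence IH: "bounded_by (prod f A) (sum \<alpha> A)" "lk (prod f A) (sum \<alpha> A) = (\<Prod>x\<in>A. lk (f x) (\<alpha> x))"
    "bounded_by (f x) (\<alpha> x)" by blast+
  show ?case
    unfolding prod.insert[OF insert.hyps] sum.insert[OF insert.hyps]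
    using bounded_by_mult[OF IH(3,1)] IH(2) by (simp only: simp_thms)
qed

text \<open>\<open>c\<close> is the coefficient of \<open>z\<^sup>\<alpha>\<close> in a fraction \<open>f\<close> without higher monomials, with \<open>c = 0\<close> permitted. As
  a relation it needs no choice of numerator and denominator; \<open>leading_unique\<close> shows that \<open>f\<close> and
  \<open>\<alpha>\<close> determine \<open>c\<close>.\<close>

definition leading :: "('g::linordered_ab_group_add \<Rightarrow>\<^sub>0 'k::field) fract \<Rightarrow> 'g \<Rightarrow> 'k \<Rightarrow> bool" where
  "leading f \<alpha> c \<longleftrightarrow> (\<exists>A B \<beta>. f * to_fract B = to_fract A \<and> bounded_by B \<beta> \<and> lk B \<beta> \<noteq> 0 \<and>
     bounded_by A (\<alpha> + \<beta>) \<and> lk A (\<alpha> + \<beta>) = c * lk B \<beta>)"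

lemma leading_to_fract: "bounded_by P \<alpha> \<Longrightarrow> leading (to_fract P) \<alpha> (lk P \<alpha>)"
  unfolding leading_def
  by (rule exI[of _ P], rule exI[of _ 1], rule exI[of _ 0])
     (simp only: to_fract_1 mult_1_right add_0_right lookup_one_zero bounded_by_def, simp add: lookup_one when_def)

lemma leading_mult:
  assumes "leading f \<alpha> c" "leading g \<beta> e"
  shows "leading (f * g) (\<alpha> + \<beta>) (c * e)"
proof -
  obtain A B \<gamma> where 1: "f * to_fract B = to_fract A" "bounded_by B \<gamma>" "lk B \<gamma> \<noteq> 0"
     "bounded_by A (\<alpha> + \<gamma>)" "lk A (\<alpha> + \<gamma>) = c * lk B \<gamma>"
    using assms(1) unfolding leading_def by blast
  obtain A' B' \<gamma>' where 2: "g * to_fract B' = to_fract A'" "bounded_by B' \<gamma>'" "lk B' \<gamma>' \<noteq> 0"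
     "bounded_by A' (\<beta> + \<gamma>')" "lk A' (\<beta> + \<gamma>') = e * lk B' \<gamma>'"
    using assms(2) unfolding leading_def by blast
  have s: "\<alpha> + \<beta> + (\<gamma> + \<gamma>') = (\<alpha> + \<gamma>) + (\<beta> + \<gamma>')" by (simp only: ac_simps)
  note B = bounded_by_mult[OF 1(2) 2(2)]
  note A = bounded_by_mult[OF 1(4) 2(4)]
  have e1: "f * g * to_fract (B * B') = to_fract (A * A')"
    unfolding to_fract_mult 1(1)[symmetric] 2(1)[symmetric] by (simp only: mult_ac)
  have e2: "lk (A * A') (\<alpha> + \<beta> + (\<gamma> + \<gamma>')) = c * e * lk (B * B') (\<gamma> + \<gamma>')"
    unfolding s A(2) B(2) 1(5) 2(5) by (simp only: mult_ac)
  have e3: "lk (B * B') (\<gamma> + \<gamma>') \<noteq> 0" unfolding B(2) using 1(3) 2(3) by (simp only: mult_eq_0_iff simp_thms)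
  show ?thesis unfolding leading_def
    by (intro exI[of _ "A * A'"] exI[of _ "B * B'"] exI[of _ "\<gamma> + \<gamma>'"] conjI e1 e2 e3 B(1) A(1)[folded s])
qed

lemma leading_add:
  assumes "leading f \<alpha> c" "leading g \<alpha> e"
  shows "leading (f + g) \<alpha> (c + e)"
proof -
  obtain A B \<gamma> where 1: "f * to_fract B = to_fract A" "bounded_by B \<gamma>" "lk B \<gamma> \<noteq> 0"
     "bounded_by A (\<alpha> + \<gamma>)" "lk A (\<alpha> + \<gamma>) = c * lk B \<gamma>"
    using assms(1) unfolding leading_def by blast
  obtain A' B' \<gamma>' where 2: "g * to_fract B' = to_fract A'" "bounded_by B' \<gamma>'" "lk B' \<gamma>' \<noteq> 0"
     "bounded_by A' (\<alpha> + \<gamma>')" "lk A' (\<alpha> + \<gamma>') = e * lk B' \<gamma>'"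
    using assms(2) unfolding leading_def by blast
  have s1: "\<alpha> + (\<gamma> + \<gamma>') = (\<alpha> + \<gamma>) + \<gamma>'" and s2: "\<alpha> + (\<gamma> + \<gamma>') = \<gamma> + (\<alpha> + \<gamma>')"
    by (simp_all only: ac_simps)
  note B = bounded_by_mult[OF 1(2) 2(2)]
  note A = bounded_by_mult[OF 1(4) 2(2)]
  note A' = bounded_by_mult[OF 1(2) 2(4)]
  have e1: "(f + g) * to_fract (B * B') = to_fract (A * B' + B * A')"
    unfolding to_fract_mult to_fract_add 1(1)[symmetric] 2(1)[symmetric]
    by (simp only: mult_ac ring_distribs)
  have e2: "lk (A * B' + B * A') (\<alpha> + (\<gamma> + \<gamma>')) = (c + e) * lk (B * B') (\<gamma> + \<gamma>')"
    unfolding lookup_add A(2)[folded s1] A'(2)[folded s2] B(2) 1(5) 2(5)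
    by (simp only: mult_ac ring_distribs)
  have e3: "lk (B * B') (\<gamma> + \<gamma>') \<noteq> 0" unfolding B(2) using 1(3) 2(3) by (simp only: mult_eq_0_iff simp_thms)
  have e4: "bounded_by (A * B' + B * A') (\<alpha> + (\<gamma> + \<gamma>'))"
    by (rule bounded_by_add) (rule A(1)[folded s1], rule A'(1)[folded s2])
  show ?thesis unfolding leading_def
    by (intro exI[of _ "A * B' + B * A'"] exI[of _ "B * B'"] exI[of _ "\<gamma> + \<gamma>'"] conjI e1 e2 e3 e4 B(1))
qed

lemma leading_inverse:
  assumes "leading f \<alpha> c" "c \<noteq> 0"
  shows "leading (inverse f) (- \<alpha>) (inverse c)"
proof -
  obtain A B \<gamma> where 1: "f * to_fract B = to_fract A" "bounded_by B \<gamma>" "lk B \<gamma> \<noteq> 0"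
     "bounded_by A (\<alpha> + \<gamma>)" "lk A (\<alpha> + \<gamma>) = c * lk B \<gamma>"
    using assms(1) unfolding leading_def by blast
  have nz: "lk A (\<alpha> + \<gamma>) \<noteq> 0" unfolding 1(5) using assms(2) 1(3) by (simp only: mult_eq_0_iff simp_thms)
  hence A0: "A \<noteq> 0" by (intro notI) (simp only: lookup_zero simp_thms)
  have "f \<noteq> 0"
  proof
    assume "f = 0"
    hence "to_fract A = 0" using 1(1) by (simp only: mult_zero_left)
    thus False using A0 by (simp only: to_fract_eq_0_iff simp_thms)
  qed
  hence e1: "inverse f * to_fract A = to_fract B"
    unfolding 1(1)[symmetric] mult.assoc[symmetric] by (simp only: left_inverse mult_1_left simp_thms)
  have s: "- \<alpha> + (\<alpha> + \<gamma>) = \<gamma>" by (simp only: minus_add_cancel)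
  have e2: "lk B (- \<alpha> + (\<alpha> + \<gamma>)) = inverse c * lk A (\<alpha> + \<gamma>)"
    unfolding s 1(5) mult.assoc[symmetric] left_inverse[OF assms(2)] mult_1_left ..
  have e3: "bounded_by B (- \<alpha> + (\<alpha> + \<gamma>))" unfolding s by (rule 1(2))
  show ?thesis unfolding leading_def
    by (intro exI[of _ B] exI[of _ A] exI[of _ "\<alpha> + \<gamma>"] conjI e1 1(4) nz e3 e2)
qed

lemma leading_unique:
  assumes "leading f \<alpha> c" "leading f \<alpha> e"
  shows "c = e"
proof -
  obtain A B \<gamma> where 1: "f * to_fract B = to_fract A" "bounded_by B \<gamma>" "lk B \<gamma> \<noteq> 0"
     "bounded_by A (\<alpha> + \<gamma>)" "lk A (\<alpha> + \<gamma>) = c * lk B \<gamma>"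
    using assms(1) unfolding leading_def by blast
  obtain A' B' \<gamma>' where 2: "f * to_fract B' = to_fract A'" "bounded_by B' \<gamma>'" "lk B' \<gamma>' \<noteq> 0"
     "bounded_by A' (\<alpha> + \<gamma>')" "lk A' (\<alpha> + \<gamma>') = e * lk B' \<gamma>'"
    using assms(2) unfolding leading_def by blast
  have "to_fract (A * B') = to_fract (B * A')"
    unfolding to_fract_mult 1(1)[symmetric] 2(1)[symmetric] by (simp only: mult_ac)
  hence AB: "A * B' = B * A'" by (simp only: to_fract_eq_iff)
  have s: "\<alpha> + \<gamma> + \<gamma>' = \<gamma> + (\<alpha> + \<gamma>')" by (simp only: ac_simps)
  have "(lk B \<gamma> * lk B' \<gamma>') * c = lk (A * B') (\<alpha> + \<gamma> + \<gamma>')"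
    unfolding bounded_by_mult(2)[OF 1(4) 2(2)] 1(5) by (simp only: mult_ac)
  also have "\<dots> = (lk B \<gamma> * lk B' \<gamma>') * e"
    unfolding AB s bounded_by_mult(2)[OF 1(2) 2(4)] 2(5) by (simp only: mult_ac)
  finally show ?thesis using 1(3) 2(3) by (simp only: mult_cancel_left mult_eq_0_iff simp_thms)
qed

lemma leading_1: "leading 1 0 1"
proof -
  have "bounded_by 1 0" by (simp add: bounded_by_def lookup_one when_def)
  from leading_to_fract[OF this] show ?thesis by simp
qed

lemma leading_sum:
  assumes "finite A" "\<And>x. x \<in> A \<Longrightarrow> leading (f x) \<alpha> (c x)"
  shows "leading (sum f A) \<alpha> (sum c A)"
  using assms
proof (induction A)
  case empty
  have "leading (to_fract 0) \<alpha> (lk 0 \<alpha>)"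
    by (rule leading_to_fract) (simp add: bounded_by_def)
  thus ?case by (simp only: sum.empty lookup_zero to_fract_0)
next
  case (insert x A)
  thus ?case unfolding sum.insert[OF insert.hyps] by (intro leading_add) blast+
qed

lemma leading_prod_0:
  assumes "finite A" "\<And>x. x \<in> A \<Longrightarrow> leading (f x) 0 (c x)"
  shows "leading (prod f A) 0 (prod c A)"
  using assms
proof (induction A)
  case empty
  show ?case unfolding prod.empty by (rule leading_1)
next
  case (insert x A)
  hence "leading (f x * prod f A) (0 + 0) (c x * prod c A)" by (intro leading_mult) blast+
  thus ?case unfolding prod.insert[OF insert.hyps] add_0_right .
qed

lemma leading_quotient_0:
  assumes "leading f \<alpha> c" "leading g \<alpha> e" "e \<noteq> 0"
  shows "leading (f / g) 0 (c / e)"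
  using leading_mult[OF assms(1) leading_inverse[OF assms(2,3)]]
  by (simp only: divide_inverse add.right_inverse)

lemma leading_binomial:
  "0 < \<mu> \<Longrightarrow> leading (1 - to_fract (sg \<mu> c)) \<mu> (- c)"
  "\<mu> < 0 \<Longrightarrow> leading (1 - to_fract (sg \<mu> c)) 0 1"
proof -
  have e: "1 - to_fract (sg \<mu> c) = to_fract (1 - sg \<mu> c)" by simp
  have b: "bounded_by (1 - sg \<mu> c) \<alpha>" if "0 \<le> \<alpha>" "\<mu> \<le> \<alpha>" for \<alpha>
    by (rule bounded_by_diff) (use that in \<open>simp_all add: bounded_by_def lookup_one lookup_single when_def\<close>)
  show "leading (1 - to_fract (sg \<mu> c)) \<mu> (- c)" if "0 < \<mu>"
  proof -
    have "\<mu> \<noteq> 0" using that by blast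
    thus ?thesis using leading_to_fract[OF b[OF less_imp_le[OF that] order_refl]] unfolding e
      by (simp add: lookup_minus lookup_one when_def)
  qed
  show "leading (1 - to_fract (sg \<mu> c)) 0 1" if "\<mu> < 0"
  proof -
    have "\<mu> \<noteq> 0" using that by blast
    thus ?thesis using leading_to_fract[OF b[OF order_refl less_imp_le[OF that]]] unfolding e
      by (simp add: lookup_minus lookup_single when_def)
  qed
qed

lemma leading_fconst: "leading (fconst c) 0 c"
  using leading_to_fract[OF bounded_by_single[of 0 c]]
  by (simp only: fconst_def lconst_def lookup_single_eq)

lemma less_expvecI:
  fixes \<mu> \<nu> :: expvec
  assumes "lk \<mu> k < lk \<nu> k" "\<And>j. j < k \<Longrightarrow> lk \<mu> j = lk \<nu> j"
  shows "\<mu> < \<nu>"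
  using assms unfolding less_poly_mapping.rep_eq less_fun_def by blast


section \<open>Leading terms of Koornwinder's operator\<close>

lemma unit_pos: "(0 :: expvec) < sg i 1" "(0 :: expvec) < sg i 2"
  by (rule less_expvecI[of _ i]; simp add: lookup_single when_def)+

lemma unit_add_pos: "(0 :: expvec) < sg i 1 + sg j 1"
  by (rule add_pos_pos[OF unit_pos(1) unit_pos(1)])

lemma unit_diff_pos: "i < j \<Longrightarrow> (0 :: expvec) < sg i 1 + sg j (-1)"
  by (rule less_expvecI[of _ i]) (auto simp: lookup_add lookup_single when_def)

lemma inverse_zf: "inverse (zf j) = to_fract (sg (sg j (-1)) 1)"
  using fconst.zinv[of j] by (simp only: zf_def zinv_def)

definition zmon :: "expvec \<Rightarrow> lfield" where "zmon \<mu> = to_fract (sg \<mu> 1)"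

lemma zmon_mult: "zmon \<mu> * zmon \<nu> = zmon (\<mu> + \<nu>)"
  by (simp only: zmon_def to_fract_mult[symmetric] mult_single mult_1_left)

lemma zf_zmon: "zf j = zmon (sg j 1)" "inverse (zf j) = zmon (sg j (-1))" "inverse (zmon (sg j (-1))) = zmon (sg j 1)"
proof -
  show 1: "zf j = zmon (sg j 1)" by (simp only: zmon_def zf_def zvar_def)
  show 2: "inverse (zf j) = zmon (sg j (-1))" by (simp only: zmon_def inverse_zf)
  show "inverse (zmon (sg j (-1))) = zmon (sg j 1)" by (simp only: 2[symmetric] 1[symmetric] inverse_inverse_eq)
qed

lemma leading_zmon_pos: "0 < \<mu> \<Longrightarrow> leading (1 - fconst c * zmon \<mu>) \<mu> (- c)"
  and leading_zmon_neg: "\<mu> < 0 \<Longrightarrow> leading (1 - fconst c * zmon \<mu>) 0 1"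
proof -
  have e: "fconst c * zmon \<mu> = to_fract (sg \<mu> c)"
    by (simp only: zmon_def fconst_def lconst_def to_fract_mult[symmetric] mult_single add_0_left mult_1_right)
  show "0 < \<mu> \<Longrightarrow> leading (1 - fconst c * zmon \<mu>) \<mu> (- c)"
    unfolding e by (rule leading_binomial(1))
  show "\<mu> < 0 \<Longrightarrow> leading (1 - fconst c * zmon \<mu>) 0 1"
    unfolding e by (rule leading_binomial(2))
qed

text \<open>As the monomial \<open>z\<^sup>\<mu>\<close> becomes large, \<open>(1 - tz\<^sup>\<mu>)/(1 - z\<^sup>\<mu>)\<close> tends to \<open>t\<close>; as it becomes small, to \<open>1\<close>.\<close>

lemma leading_ratio_pos:
  assumes "0 < \<mu>"
  shows "leading ((1 - fconst par_t * zmon \<mu>) / (1 - zmon \<mu>)) 0 par_t"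
proof -
  have "leading (1 - fconst 1 * zmon \<mu>) \<mu> (- 1)" by (rule leading_zmon_pos[OF assms])
  from leading_quotient_0[OF leading_zmon_pos[OF assms] this, of par_t]
  show ?thesis by (simp only: fconst_1 mult_1_left minus_divide_divide div_by_1 neg_equal_0_iff_equal
      one_neq_zero simp_thms not_False_eq_True)
qed

lemma leading_ratio_neg:
  assumes "\<mu> < 0"
  shows "leading ((1 - fconst par_t * zmon \<mu>) / (1 - zmon \<mu>)) 0 1"
proof -
  have "leading (1 - fconst 1 * zmon \<mu>) 0 1" by (rule leading_zmon_neg[OF assms])
  from leading_quotient_0[OF leading_zmon_neg[OF assms] this, of par_t]
  show ?thesis by (simp only: fconst_1 mult_1_left div_by_1 one_neq_zero simp_thms not_False_eq_True)
qed

text \<open>The limits of \<open>\<A>\<^sub>i\<^sup>+\<close> and \<open>\<A>\<^sub>i\<^sup>-\<close> for \<open>z\<^sub>1\<close> much larger than \<open>z\<^sub>2\<close>, \<open>z\<^sub>2\<close> much larger than \<open>z\<^sub>3\<close>, and so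
  on: the monomial \<open>z\<^sub>i z\<^sub>j\<close> is large, and \<open>z\<^sub>i/z\<^sub>j\<close> is large if and only if \<open>i < j\<close>.\<close>

definition plus_weight :: "nat \<Rightarrow> nat \<Rightarrow> pfield" where
  "plus_weight m i = al_half / par_t ^ (m - 1) * (\<Prod>j\<in>{1..m} - {i}. par_t * (if i < j then par_t else 1))"

definition minus_weight :: "nat \<Rightarrow> nat \<Rightarrow> pfield" where
  "minus_weight m i = 1 / (al_half * par_t ^ (m - 1)) * (\<Prod>j\<in>{1..m} - {i}. if i < j then 1 else par_t)"

lemma al_half_nz: "al_half \<noteq> 0"
  unfolding al_half_def by (simp only: mult_eq_0_iff half_nz inverse_nonzero_iff_nonzero simp_thms not_False_eq_True)

lemma leading_koorn_A_plus: "leading (koorn_A m i zf) 0 (plus_weight m i)"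
proof -
  define e where "e = (sg i 1 :: expvec)"
  have e2: "sg i 1 + sg i 1 = (sg i 2 :: expvec)" by (simp add: single_add[symmetric])
  have z2: "zf i ^ 2 = zmon (e + e)" by (simp only: power2_eq_square zf_zmon zmon_mult e_def)
  have pos: "0 < e" "0 < e + e" unfolding e_def e2 by (rule unit_pos)+
  have num: "leading ((1 - fconst par_a * zf i) * (1 - fconst par_b * zf i) * (1 - fconst par_c * zf i) *
      (1 - fconst par_d * zf i)) (e + e + e + e) (- par_a * - par_b * - par_c * - par_d)"
    unfolding zf_zmon e_def[symmetric] by (intro leading_mult leading_zmon_pos pos)
  have "leading (fconst al_half * fconst (par_t ^ (m - 1)) * (1 - fconst 1 * zf i ^ 2) * (1 - fconst par_q * zf i ^ 2))
      (0 + 0 + (e + e) + (e + e)) (al_half * par_t ^ (m - 1) * - 1 * - par_q)"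
    unfolding z2 by (intro leading_mult leading_zmon_pos leading_fconst pos)
  hence den: "leading (fconst al_half * fconst par_t ^ (m - 1) * (1 - zf i ^ 2) * (1 - fconst par_q * zf i ^ 2))
      (e + e + e + e) (al_half * par_t ^ (m - 1) * par_q)"
    by (simp only: add_0_left add.assoc[symmetric] fconst_power fconst_1 mult_1_left
        mult_minus_left mult_minus_right mult_1_right minus_minus)
  have nz: "al_half * par_t ^ (m - 1) * par_q \<noteq> 0"
    by (simp only: mult_eq_0_iff power_eq_0_iff par_nz al_half_nz simp_thms)
  have "par_a * par_b * par_c * par_d / (al_half * par_t ^ (m - 1) * par_q) =
      (par_a * par_b * par_c * par_d * inverse par_q) / (al_half * par_t ^ (m - 1))"
    by (simp only: divide_inverse inverse_mult_distrib mult_ac)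
  also have "\<dots> = al_half / par_t ^ (m - 1)"
    unfolding al_half_power2[symmetric] power2_eq_square
    by (simp only: mult_divide_mult_cancel_left_if al_half_nz if_False)
  finally have w: "par_a * par_b * par_c * par_d / (al_half * par_t ^ (m - 1) * par_q) = al_half / par_t ^ (m - 1)" .
  have fac: "leading (((1 - fconst par_t * zf i * zf j) * (1 - fconst par_t * zf i * inverse (zf j))) /
        ((1 - zf i * zf j) * (1 - zf i * inverse (zf j)))) 0 (par_t * (if i < j then par_t else 1))"
    if "j \<in> {1..m} - {i}" for j
  proof -
    have sum_pos: "0 < (sg i 1 + sg j 1 :: expvec)" by (rule unit_add_pos)
    have "leading ((1 - fconst par_t * zmon (sg i 1 + sg j (-1))) / (1 - zmon (sg i 1 + sg j (-1)))) 0
        (if i < j then par_t else 1)"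
    proof (cases "i < j")
      case True
      thus ?thesis using leading_ratio_pos[OF unit_diff_pos[OF True]] by (simp only: if_True)
    next
      case False
      hence "j < i" using that by auto
      hence "0 < (sg j 1 + sg i (-1) :: expvec)" by (rule unit_diff_pos)
      hence "- (sg j 1 + sg i (-1) :: expvec) < 0" by (simp only: neg_less_0_iff_less)
      moreover have "- (sg j 1 + sg i (-1) :: expvec) = sg i 1 + sg j (-1)"
        by (simp only: minus_add_distrib single_uminus[symmetric] minus_minus add.commute)
      ultimately show ?thesis using leading_ratio_neg False by (simp only: if_False)
    qed
    from leading_mult[OF leading_ratio_pos[OF sum_pos] this]
    show ?thesis
      unfolding mult.assoc[of "fconst par_t"] zf_zmon(2) unfolding zf_zmon(1) zmon_mult add_0_left
        times_divide_times_eq .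
  qed
  have "leading (koorn_A m i zf) (0 + 0) (par_a * par_b * par_c * par_d / (al_half * par_t ^ (m - 1) * par_q) *
      (\<Prod>j\<in>{1..m} - {i}. par_t * (if i < j then par_t else 1)))"
    unfolding koorn_A_def msqrt_al
  proof (rule leading_mult[OF _ leading_prod_0[OF _ fac]])
    show "finite ({1..m} - {i})" by simp
    have "- par_a * - par_b * - par_c * - par_d = par_a * par_b * par_c * par_d"
      by (simp only: mult_minus_left mult_minus_right minus_minus)
    thus "leading ((1 - fconst par_a * zf i) * (1 - fconst par_b * zf i) * (1 - fconst par_c * zf i) *
       (1 - fconst par_d * zf i) /
       (fconst al_half * fconst par_t ^ (m - 1) * (1 - (zf i)\<^sup>2) * (1 - fconst par_q * (zf i)\<^sup>2))) 0
       (par_a * par_b * par_c * par_d / (al_half * par_t ^ (m - 1) * par_q))"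
      using leading_quotient_0[OF num den nz] by (simp only:)
  qed
  thus ?thesis unfolding w plus_weight_def add_0_left .
qed

lemma leading_koorn_A_minus: "leading (koorn_A m i (\<lambda>j. inverse (zf j))) 0 (minus_weight m i)"
proof -
  define e where "e = (sg i (-1) :: expvec)"
  have ze: "inverse (zf i) = zmon e" by (simp only: zf_zmon(2) e_def)
  have z2: "zmon e ^ 2 = zmon (e + e)" by (simp only: power2_eq_square zmon_mult)
  have "- (sg i 1 :: expvec) < 0" using unit_pos(1) by (simp only: neg_less_0_iff_less)
  hence e0: "e < 0" unfolding e_def by (simp only: single_uminus[symmetric])
  hence neg: "e < 0" "e + e < 0" using add_neg_neg by blast+
  have num: "leading ((1 - fconst par_a * zmon e) * (1 - fconst par_b * zmon e) * (1 - fconst par_c * zmon e) *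
      (1 - fconst par_d * zmon e)) (0 + 0 + 0 + 0) (1 * 1 * 1 * 1)"
    by (intro leading_mult leading_zmon_neg neg)
  have "leading (fconst al_half * fconst (par_t ^ (m - 1)) * (1 - fconst 1 * zmon e ^ 2) * (1 - fconst par_q * zmon e ^ 2))
      (0 + 0 + 0 + 0) (al_half * par_t ^ (m - 1) * 1 * 1)"
    unfolding z2 by (intro leading_mult leading_zmon_neg leading_fconst neg)
  hence den: "leading (fconst al_half * fconst par_t ^ (m - 1) * (1 - zmon e ^ 2) * (1 - fconst par_q * zmon e ^ 2))
      (0 + 0 + 0 + 0) (al_half * par_t ^ (m - 1))"
    by (simp only: fconst_power fconst_1 mult_1_left mult_1_right)
  have nz: "al_half * par_t ^ (m - 1) \<noteq> 0"
    by (simp only: mult_eq_0_iff power_eq_0_iff par_nz al_half_nz simp_thms)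
  have fac: "leading (((1 - fconst par_t * inverse (zf i) * inverse (zf j)) *
        (1 - fconst par_t * inverse (zf i) * inverse (inverse (zf j)))) /
        ((1 - inverse (zf i) * inverse (zf j)) * (1 - inverse (zf i) * inverse (inverse (zf j))))) 0
        (if i < j then 1 else par_t)"
    if "j \<in> {1..m} - {i}" for j
  proof -
    have "- (sg i 1 + sg j 1 :: expvec) < 0" using unit_add_pos by (simp only: neg_less_0_iff_less)
    hence sum_neg: "(sg i (-1) + sg j (-1) :: expvec) < 0"
      by (simp only: minus_add_distrib single_uminus[symmetric])
    have "leading ((1 - fconst par_t * zmon (sg i (-1) + sg j 1)) / (1 - zmon (sg i (-1) + sg j 1))) 0
        (if i < j then 1 else par_t)"
    proof (cases "i < j")
      case True
      hence "0 < (sg i 1 + sg j (-1) :: expvec)" by (rule unit_diff_pos)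
      hence "- (sg i 1 + sg j (-1) :: expvec) < 0" by (simp only: neg_less_0_iff_less)
      moreover have "- (sg i 1 + sg j (-1) :: expvec) = sg i (-1) + sg j 1"
        by (simp only: minus_add_distrib single_uminus[symmetric] minus_minus)
      ultimately show ?thesis using leading_ratio_neg True by (simp only: if_True)
    next
      case False
      hence "j < i" using that by auto
      hence "0 < (sg i (-1) + sg j 1 :: expvec)" unfolding add.commute[of "sg i (-1)"] by (rule unit_diff_pos)
      thus ?thesis using leading_ratio_pos False by (simp only: if_False)
    qed
    from leading_mult[OF leading_ratio_neg[OF sum_neg] this]
    show ?thesis
      unfolding mult.assoc[of "fconst par_t"] zf_zmon(2) unfolding zf_zmon(3) zmon_mult
        add_0_left times_divide_times_eq mult_1_left .
  qed
  have "leading (koorn_A m i (\<lambda>j. inverse (zf j))) (0 + 0) (1 / (al_half * par_t ^ (m - 1)) *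
      (\<Prod>j\<in>{1..m} - {i}. if i < j then 1 else par_t))"
    unfolding koorn_A_def msqrt_al
  proof (rule leading_mult[OF _ leading_prod_0[OF _ fac]])
    show "finite ({1..m} - {i})" by simp
    show "leading ((1 - fconst par_a * inverse (zf i)) * (1 - fconst par_b * inverse (zf i)) *
       (1 - fconst par_c * inverse (zf i)) * (1 - fconst par_d * inverse (zf i)) /
       (fconst al_half * fconst par_t ^ (m - 1) * (1 - (inverse (zf i))\<^sup>2) *
          (1 - fconst par_q * (inverse (zf i))\<^sup>2))) 0
       (1 / (al_half * par_t ^ (m - 1)))"
      using leading_quotient_0[OF num den nz] unfolding ze mult_1_left .
  qed
  thus ?thesis unfolding minus_weight_def add_0_left .
qed

text \<open>The diagonal entries of \<open>\<D>\<close> with respect to leading monomials.\<close>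

definition spectrum :: "nat \<Rightarrow> expvec \<Rightarrow> pfield" where
  "spectrum m \<nu> = (\<Sum>i=1..m. plus_weight m i * (par_q powi (lk \<nu> i) - 1)) +
     (\<Sum>i=1..m. minus_weight m i * (inverse par_q powi (lk \<nu> i) - 1))"

lemma lookup_zscale: "lk (zscale s i P) \<nu> = s powi (lk \<nu> i) * lk P \<nu>"
  unfolding zscale_def lookup_mapp
  by (cases "\<nu> \<in> Poly_Mapping.keys P") (simp_all only: when_simps in_keys_iff mult_zero_right simp_thms not_not)

text \<open>All coefficients of \<open>\<D>\<close> have leading exponent zero, so that \<open>\<D>\<close> does not raise leading monomials.\<close>

lemma leading_koorn_op:
  assumes "bounded_by P \<nu>"
  shows "leading (koorn_op m P) \<nu> (spectrum m \<nu> * lk P \<nu>)"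
proof -
  have d: "leading (to_fract (zscale s i P - P)) \<nu> ((s powi (lk \<nu> i) - 1) * lk P \<nu>)" for s i
  proof -
    have "bounded_by (zscale s i P) \<nu>"
      using assms unfolding bounded_by_def lookup_zscale by (simp only: mult_eq_0_iff) blast
    from leading_to_fract[OF bounded_by_diff[OF this assms]]
    show ?thesis unfolding lookup_minus lookup_zscale by (simp only: left_diff_distrib mult_1_left)
  qed
  have "leading (koorn_op m P) \<nu>
     ((\<Sum>i=1..m. plus_weight m i * ((par_q powi (lk \<nu> i) - 1) * lk P \<nu>)) +
      (\<Sum>i=1..m. minus_weight m i * ((inverse par_q powi (lk \<nu> i) - 1) * lk P \<nu>)))"
    unfolding koorn_op_def
    by (intro leading_add leading_sum finite_atLeastAtMost
        leading_mult[OF leading_koorn_A_plus d, unfolded add_0_left]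
        leading_mult[OF leading_koorn_A_minus d, unfolded add_0_left])
  thus ?thesis unfolding spectrum_def distrib_right sum_distrib_right mult.assoc .
qed

lemma eigenvalue_eq_spectrum:
  assumes "bounded_by P \<nu>" "lk P \<nu> \<noteq> 0" "koorn_op m P = fconst ev * to_fract P"
  shows "ev = spectrum m \<nu>"
proof -
  have "leading (koorn_op m P) (0 + \<nu>) (ev * lk P \<nu>)"
    unfolding assms(3) by (rule leading_mult[OF leading_fconst leading_to_fract[OF assms(1)]])
  from leading_unique[OF this[unfolded add_0_left] leading_koorn_op[OF assms(1)]]
  show ?thesis using assms(2) by (simp only: mult_cancel_right simp_thms)
qed


section \<open>Simplicity of the spectrum\<close>

lemma power_nat_add_int:
  fixes x :: "'f::field"
  assumes "x \<noteq> 0" "int N + k \<ge> 0"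
  shows "x ^ nat (int N + k) = x ^ N * x powi k"
proof -
  have "x ^ nat (int N + k) = x powi (int N + k)" using assms(2) by (simp add: power_int_def)
  also have "\<dots> = x ^ N * x powi k" using assms(1) by (simp add: power_int_add)
  finally show ?thesis .
qed

lemma prod_weights:
  fixes x :: "'f::comm_monoid_mult"
  assumes "i \<in> {1..m}"
  shows "(\<Prod>j\<in>{1..m} - {i}. x * (if i < j then x else 1)) = x ^ (m - 1) * x ^ (m - i)"
    and "(\<Prod>j\<in>{1..m} - {i}. if i < j then 1 else x) = x ^ (i - 1)"
proof -
  have c: "card ({1..m} - {i}) = m - 1" using assms by simp
  have 1: "({1..m} - {i}) \<inter> {j. i < j} = {i<..m}" "({1..m} - {i}) \<inter> - {j. i < j} = {1..<i}" using assms by auto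
  have fin: "finite ({1..m} - {i})" by simp
  show "(\<Prod>j\<in>{1..m} - {i}. x * (if i < j then x else 1)) = x ^ (m - 1) * x ^ (m - i)"
    unfolding prod.distrib prod_constant c prod.If_cases[OF fin] 1 by simp
  show "(\<Prod>j\<in>{1..m} - {i}. if i < j then 1 else x) = x ^ (i - 1)"
    unfolding prod.If_cases[OF fin] 1 by simp
qed

text \<open>Multiplying the nonconstant part of \<open>spectrum m \<nu>\<close> by \<open>(abcd/q)\<^bsup>1/2\<^esup> q t\<^bsup>m-1\<^esup> q\<^sup>N\<close>, for \<open>N\<close> at least as large
  as all \<open>\<bar>\<nu>\<^sub>i\<bar>\<close>, gives this polynomial in the parameters. Its exponents refer to the square roots of the
  parameters.\<close>

definition spectrum_poly :: "nat \<Rightarrow> nat \<Rightarrow> expvec \<Rightarrow> pring" where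
  "spectrum_poly N m \<nu> =
     (\<Sum>i=1..m. par_monom 2 2 2 2 (2 * nat (int N + lk \<nu> i)) (2 * (m - 1 + (m - i)))) +
     (\<Sum>i=1..m. par_monom 0 0 0 0 (2 * Suc (nat (int N + - lk \<nu> i))) (2 * (i - 1)))"

text \<open>In the applications \<open>A\<close> is \<open>{1..m}\<close>, \<open>x\<^sub>i\<close> and \<open>y\<^sub>i\<close> are \<open>q\<close> to the powers \<open>\<nu>\<^sub>i\<close> and \<open>-\<nu>\<^sub>i\<close>, and \<open>Q = q\<^sup>N\<close>. The
  last summand does not involve them, so that equality of the spectra is equality of the polynomials.\<close>

lemma spectrum_algebra:
  fixes al q t :: "'f::field" and x y :: "nat \<Rightarrow> 'f"
  assumes nz: "al \<noteq> 0" "t \<noteq> 0"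
  shows "(\<Sum>i\<in>A. (al ^ 2 * q) * (Q * x i) * (t ^ (m - 1) * t ^ (m - i))) + (\<Sum>i\<in>A. (Q * y i) * q * t ^ (i - 1)) =
    al * q * t ^ (m - 1) * Q *
      ((\<Sum>i\<in>A. al / t ^ (m - 1) * (t ^ (m - 1) * t ^ (m - i)) * (x i - 1)) +
       (\<Sum>i\<in>A. 1 / (al * t ^ (m - 1)) * t ^ (i - 1) * (y i - 1))) +
    al * q * t ^ (m - 1) * Q * ((\<Sum>i\<in>A. al / t ^ (m - 1) * (t ^ (m - 1) * t ^ (m - i))) +
       (\<Sum>i\<in>A. 1 / (al * t ^ (m - 1)) * t ^ (i - 1)))"
proof -
  define T where "T = t ^ (m - 1)"
  define K where "K = al * q * T * Q"
  have T: "T \<noteq> 0" using nz by (simp add: T_def)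
  have r: "K * (u * (z - 1)) + K * u = K * (u * z)" for u z by (simp add: algebra_simps)
  have 1: "(al ^ 2 * q) * (Q * z) * (T * v) = K * (al / T * (T * v) * (z - 1)) + K * (al / T * (T * v))" for z v
    unfolding r using nz T by (simp add: K_def power2_eq_square)
  have 2: "(Q * z) * q * v = K * (1 / (al * T) * v * (z - 1)) + K * (1 / (al * T) * v)" for z v
    unfolding r using nz T by (simp add: K_def)
  have "(\<Sum>i\<in>A. (al ^ 2 * q) * (Q * x i) * (T * t ^ (m - i))) + (\<Sum>i\<in>A. (Q * y i) * q * t ^ (i - 1)) =
      (K * (\<Sum>i\<in>A. al / T * (T * t ^ (m - i)) * (x i - 1)) +
       K * (\<Sum>i\<in>A. al / T * (T * t ^ (m - i)))) +
      (K * (\<Sum>i\<in>A. 1 / (al * T) * t ^ (i - 1) * (y i - 1)) +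
       K * (\<Sum>i\<in>A. 1 / (al * T) * t ^ (i - 1)))"
    unfolding 1 2 sum.distrib sum_distrib_left ..
  also have "\<dots> = K * ((\<Sum>i\<in>A. al / T * (T * t ^ (m - i)) * (x i - 1)) +
       (\<Sum>i\<in>A. 1 / (al * T) * t ^ (i - 1) * (y i - 1))) +
      K * ((\<Sum>i\<in>A. al / T * (T * t ^ (m - i))) + (\<Sum>i\<in>A. 1 / (al * T) * t ^ (i - 1)))"
    by (simp only: distrib_left add_ac)
  finally show ?thesis unfolding K_def T_def .
qed

lemma to_fract_spectrum_poly:
  assumes N: "\<forall>i\<in>{1..m}. \<bar>lk \<nu> i\<bar> \<le> int N"
  shows "to_fract (spectrum_poly N m \<nu>) = al_half * par_q * par_t ^ (m - 1) * par_q ^ N * spectrum m \<nu> +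
    al_half * par_q * par_t ^ (m - 1) * par_q ^ N *
      ((\<Sum>i=1..m. al_half / par_t ^ (m - 1) * (par_t ^ (m - 1) * par_t ^ (m - i))) +
       (\<Sum>i=1..m. 1 / (al_half * par_t ^ (m - 1)) * par_t ^ (i - 1)))"
proof -
  have sp: "spectrum m \<nu> = (\<Sum>i=1..m. al_half / par_t ^ (m - 1) * (par_t ^ (m - 1) * par_t ^ (m - i)) *
        (par_q powi (lk \<nu> i) - 1)) +
     (\<Sum>i=1..m. 1 / (al_half * par_t ^ (m - 1)) * par_t ^ (i - 1) * (par_q powi (- lk \<nu> i) - 1))"
    unfolding spectrum_def plus_weight_def minus_weight_def power_int_inverse power_int_minus
    by (intro arg_cong2[where f = "(+)"] sum.cong refl) (simp_all only: prod_weights)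
  have p1: "par_q ^ nat (int N + lk \<nu> i) = par_q ^ N * par_q powi (lk \<nu> i)"
    and p2: "par_q ^ nat (int N + - lk \<nu> i) = par_q ^ N * par_q powi (- lk \<nu> i)"
    if "i \<in> {1..m}" for i
    by (rule power_nat_add_int[OF par_nz(5)]; use bspec[OF N that] in linarith)+
  have alq: "al_half ^ 2 * par_q = par_a * par_b * par_c * par_d"
    unfolding al_half_power2 mult.assoc left_inverse[OF par_nz(5)] mult_1_right ..
  have m1: "to_fract (par_monom 2 2 2 2 (2 * n) (2 * k)) = par_a * par_b * par_c * par_d * par_q ^ n * par_t ^ k" for n k
    using par_conv_monom[of 1 1 1 1 n k] by (simp only: power_one_right mult_1_right)
  have m2: "to_fract (par_monom 0 0 0 0 (2 * n) (2 * k)) = par_q ^ n * par_t ^ k" for n k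
    using par_conv_monom[of 0 0 0 0 n k] by (simp only: power_0 mult_1_left mult_0_right)
  have "to_fract (spectrum_poly N m \<nu>) =
      (\<Sum>i=1..m. (al_half ^ 2 * par_q) * (par_q ^ N * par_q powi (lk \<nu> i)) * (par_t ^ (m - 1) * par_t ^ (m - i))) +
      (\<Sum>i=1..m. (par_q ^ N * par_q powi (- lk \<nu> i)) * par_q * par_t ^ (i - 1))"
    unfolding spectrum_poly_def to_fract_add to_fract_sum m1 m2 alq
    by (intro arg_cong2[where f = "(+)"] sum.cong refl) (simp_all only: p1 p2 power_add power_Suc2)
  thus ?thesis unfolding sp spectrum_algebra[OF al_half_nz par_nz(6)] .
qed

text \<open>The monomials of \<open>spectrum_poly\<close> that contain \<open>abcd\<close> carry pairwise different powers \<open>t\<^bsup>2m-1-i\<^esup>\<close>, and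
  in the \<open>i\<close>-th of them the exponent of \<open>q\<close> is \<open>N + \<nu>\<^sub>i\<close>.\<close>

theorem spectrum_inj:
  assumes eq: "spectrum m \<mu> = spectrum m \<nu>"
    and k: "Poly_Mapping.keys \<mu> \<subseteq> {1..m}" "Poly_Mapping.keys \<nu> \<subseteq> {1..m}"
  shows "\<mu> = \<nu>"
proof -
  define N where "N = nat ((\<Sum>i=1..m. \<bar>lk \<mu> i\<bar>) + (\<Sum>i=1..m. \<bar>lk \<nu> i\<bar>))"
  have s0: "0 \<le> (\<Sum>i=1..m. \<bar>lk \<mu> i\<bar>)" "0 \<le> (\<Sum>i=1..m. \<bar>lk \<nu> i\<bar>)" by (intro sum_nonneg; simp)+
  have N1: "\<bar>lk \<mu> i\<bar> \<le> int N" "\<bar>lk \<nu> i\<bar> \<le> int N" if "i \<in> {1..m}" for i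
  proof -
    have "\<bar>lk \<mu> i\<bar> \<le> (\<Sum>i=1..m. \<bar>lk \<mu> i\<bar>)" "\<bar>lk \<nu> i\<bar> \<le> (\<Sum>i=1..m. \<bar>lk \<nu> i\<bar>)"
      using that by (intro member_le_sum; simp)+
    thus "\<bar>lk \<mu> i\<bar> \<le> int N" "\<bar>lk \<nu> i\<bar> \<le> int N" using s0 unfolding N_def by linarith+
  qed
  have NN: "\<forall>i\<in>{1..m}. \<bar>lk \<mu> i\<bar> \<le> int N" "\<forall>i\<in>{1..m}. \<bar>lk \<nu> i\<bar> \<le> int N"
    using N1 by blast+
  have "to_fract (spectrum_poly N m \<mu>) = to_fract (spectrum_poly N m \<nu>)"
    unfolding to_fract_spectrum_poly[OF NN(1)] to_fract_spectrum_poly[OF NN(2)] eq ..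
  hence poly: "spectrum_poly N m \<mu> = spectrum_poly N m \<nu>" by (simp only: to_fract_eq_iff)
  have coeff: "par_coeff 2 2 2 2 (2 * e) (2 * (m - 1 + (m - i))) (spectrum_poly N m \<kappa>) =
      (if nat (int N + lk \<kappa> i) = e then 1 else 0)" if i: "i \<in> {1..m}" for e i \<kappa>
  proof -
    have "par_coeff 2 2 2 2 (2 * e) (2 * (m - 1 + (m - i))) (spectrum_poly N m \<kappa>) =
        (\<Sum>j=1..m. if j = i then (if nat (int N + lk \<kappa> i) = e then 1 else 0) else 0)"
      unfolding spectrum_poly_def par_coeff_add par_coeff_sum par_coeff_monom
      using i by (intro trans[OF arg_cong2[where f = "(+)", OF sum.cong[OF refl] sum.neutral] add_0_right]) auto
    also have "\<dots> = (if nat (int N + lk \<kappa> i) = e then 1 else 0)" using i by simp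
    finally show ?thesis .
  qed
  have "lk \<mu> i = lk \<nu> i" for i
  proof (cases "i \<in> {1..m}")
    case True
    have "nat (int N + lk \<nu> i) = nat (int N + lk \<mu> i)"
      using coeff[OF True, of "nat (int N + lk \<mu> i)" \<mu>] coeff[OF True, of "nat (int N + lk \<mu> i)" \<nu>] poly
      by (simp split: if_splits)
    thus ?thesis using N1[OF True] by linarith
  next
    case False
    thus ?thesis using k by (metis in_keys_iff subsetD)
  qed
  thus ?thesis by (rule poly_mapping_eqI)
qed


section \<open>The hyperoctahedral group\<close>

lemma weylE:
  assumes "w \<in> weyl m"
  obtains \<sigma> \<epsilon> where "\<sigma> permutes {1..m}" "\<And>i. \<epsilon> i = 1 \<or> \<epsilon> i = -1" "\<And>i. i \<notin> {1..m} \<Longrightarrow> \<epsilon> i = 1"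
    "\<And>\<nu> i. lk (w \<nu>) i = \<epsilon> i * lk \<nu> (\<sigma> i)"
proof -
  obtain \<sigma> \<epsilon> where w: "\<sigma> permutes {1..m}" "\<forall>i\<in>{1..m}. \<epsilon> i \<in> {1, -1}"
      "\<forall>i. i \<notin> {1..m} \<longrightarrow> \<epsilon> i = 1" "\<forall>\<nu> i. lk (w \<nu>) i = \<epsilon> i * lk \<nu> (\<sigma> i)"
    using assms unfolding weyl_def mem_Collect_eq by (elim exE conjE) (rule that)
  have "\<epsilon> i = 1 \<or> \<epsilon> i = -1" for i using w(2,3) by (cases "i \<in> {1..m}") auto
  thus ?thesis using that w by blast
qed

lemma weyl_exists:
  assumes "\<sigma> permutes {1..m}" "\<And>i. \<epsilon> i = 1 \<or> \<epsilon> i = (-1::int)" "\<And>i. i \<notin> {1..m} \<Longrightarrow> \<epsilon> i = 1"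
  shows "\<exists>w\<in>weyl m. \<forall>\<nu> i. lk (w \<nu>) i = \<epsilon> i * lk \<nu> (\<sigma> i)"
proof -
  define w where "w \<nu> = Abs_poly_mapping (\<lambda>i. \<epsilon> i * lk \<nu> (\<sigma> i))" for \<nu> :: expvec
  have l: "lk (w \<nu>) i = \<epsilon> i * lk \<nu> (\<sigma> i)" for \<nu> i
  proof -
    have "{i. \<epsilon> i * lk \<nu> (\<sigma> i) \<noteq> 0} \<subseteq> \<sigma> -` {k. lk \<nu> k \<noteq> 0}" by auto
    moreover have "finite (\<sigma> -` {k. lk \<nu> k \<noteq> 0})"
      by (rule finite_vimageI[OF finite_lookup permutes_inj[OF assms(1)]])
    ultimately have "finite {i. \<epsilon> i * lk \<nu> (\<sigma> i) \<noteq> 0}" by (rule finite_subset)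
    thus ?thesis by (simp add: w_def)
  qed
  have "w \<in> weyl m" unfolding weyl_def mem_Collect_eq
    by (rule exI[of _ \<sigma>], rule exI[of _ \<epsilon>]) (use assms l in blast)
  thus ?thesis using l by blast
qed

lemma weyl_add: "w \<in> weyl m \<Longrightarrow> w (\<mu> + \<nu>) = w \<mu> + w \<nu>"
  by (elim weylE) (simp add: poly_mapping_eq_iff fun_eq_iff lookup_add distrib_left)

lemma weyl_0: "w \<in> weyl m \<Longrightarrow> w 0 = 0"
  by (elim weylE) (simp add: poly_mapping_eq_iff fun_eq_iff)

lemma weyl_inverse:
  assumes "w \<in> weyl m"
  obtains w' where "w' \<in> weyl m" "\<And>\<nu>. w' (w \<nu>) = \<nu>"
proof -
  obtain \<sigma> \<epsilon> where w: "\<sigma> permutes {1..m}" "\<And>i. \<epsilon> i = 1 \<or> \<epsilon> i = -1" "\<And>i. i \<notin> {1..m} \<Longrightarrow> \<epsilon> i = 1"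
    "\<And>\<nu> i. lk (w \<nu>) i = \<epsilon> i * lk \<nu> (\<sigma> i)"
    by (rule weylE[OF assms]) (rule that)
  have e1: "\<epsilon> (inv \<sigma> i) = 1 \<or> \<epsilon> (inv \<sigma> i) = -1" for i by (rule w(2))
  have e2: "\<epsilon> (inv \<sigma> i) = 1" if "i \<notin> {1..m}" for i
    using w(3)[OF that] permutes_not_in[OF permutes_inv[OF w(1)] that] by simp
  obtain w' where w': "w' \<in> weyl m" "\<forall>\<nu> i. lk (w' \<nu>) i = \<epsilon> (inv \<sigma> i) * lk \<nu> (inv \<sigma> i)"
    using weyl_exists[OF permutes_inv[OF w(1)], of "\<lambda>i. \<epsilon> (inv \<sigma> i)"] e1 e2 by blast
  have "lk (w' (w \<nu>)) i = lk \<nu> i" for \<nu> i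
  proof -
    have "\<epsilon> (inv \<sigma> i) * \<epsilon> (inv \<sigma> i) = 1" using e1[of i] by auto
    thus ?thesis by (simp add: w' w(4) permutes_inverses[OF w(1)] mult.assoc[symmetric])
  qed
  hence "w' (w \<nu>) = \<nu>" for \<nu> by (rule poly_mapping_eqI)
  thus ?thesis using that w'(1) by blast
qed

lemma weyl_comp:
  assumes "w \<in> weyl m" "w' \<in> weyl m"
  shows "(\<lambda>\<nu>. w (w' \<nu>)) \<in> weyl m"
proof -
  obtain \<sigma> \<epsilon> where w: "\<sigma> permutes {1..m}" "\<And>i. \<epsilon> i = 1 \<or> \<epsilon> i = -1" "\<And>i. i \<notin> {1..m} \<Longrightarrow> \<epsilon> i = 1"
    "\<And>\<nu> i. lk (w \<nu>) i = \<epsilon> i * lk \<nu> (\<sigma> i)"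
    by (rule weylE[OF assms(1)]) (rule that)
  obtain \<sigma>' \<epsilon>' where w': "\<sigma>' permutes {1..m}" "\<And>i. \<epsilon>' i = 1 \<or> \<epsilon>' i = -1" "\<And>i. i \<notin> {1..m} \<Longrightarrow> \<epsilon>' i = 1"
    "\<And>\<nu> i. lk (w' \<nu>) i = \<epsilon>' i * lk \<nu> (\<sigma>' i)"
    by (rule weylE[OF assms(2)]) (rule that)
  have s: "\<epsilon> i * \<epsilon>' (\<sigma> i) \<in> {1, -1}" for i using w(2)[of i] w'(2)[of "\<sigma> i"] by auto
  have o: "\<epsilon> i * \<epsilon>' (\<sigma> i) = 1" if "i \<notin> {1..m}" for i
    using w(3)[OF that] w'(3)[OF that] permutes_not_in[OF w(1) that] by simp
  have l: "lk (w (w' \<nu>)) i = (\<epsilon> i * \<epsilon>' (\<sigma> i)) * lk \<nu> ((\<sigma>' \<circ> \<sigma>) i)" for \<nu> i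
    by (simp add: w(4) w'(4))
  show ?thesis unfolding weyl_def mem_Collect_eq
    by (rule exI[of _ "\<sigma>' \<circ> \<sigma>"], rule exI[of _ "\<lambda>i. \<epsilon> i * \<epsilon>' (\<sigma> i)"])
       (use permutes_compose[OF w(1) w'(1)] s o l in blast)
qed

definition orbit :: "nat \<Rightarrow> expvec \<Rightarrow> expvec set" where
  "orbit m \<nu> = (\<lambda>w. w \<nu>) ` weyl m"

lemma finite_orbit_set: "finite (orbit m \<nu>)"
  unfolding orbit_def by (rule finite_orbit)

lemma orbit_refl: "\<nu> \<in> orbit m \<nu>"
proof -
  obtain w where w: "w \<in> weyl m" "\<forall>\<nu> i. lk (w \<nu>) i = 1 * lk \<nu> (id i)"
    using weyl_exists[OF permutes_id, of "\<lambda>_. 1" m] by blast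
  have "w \<nu> = \<nu>" by (rule poly_mapping_eqI) (simp add: w)
  thus ?thesis unfolding orbit_def using w(1) by (metis image_eqI)
qed

lemma orbit_subset: "\<mu> \<in> orbit m \<nu> \<Longrightarrow> orbit m \<mu> \<subseteq> orbit m \<nu>"
  unfolding orbit_def using weyl_comp by fastforce

lemma orbit_sym: "\<mu> \<in> orbit m \<nu> \<Longrightarrow> \<nu> \<in> orbit m \<mu>"
  unfolding orbit_def using weyl_inverse by (metis (no_types, lifting) imageE image_eqI)

lemma orbit_eq: "\<mu> \<in> orbit m \<nu> \<Longrightarrow> orbit m \<mu> = orbit m \<nu>"
  using orbit_subset orbit_sym by blast

text \<open>Every orbit contains a unique partition. Taking it as the lexicographic maximum avoids sorting: a
  negative entry or an ascent could be removed by an element of \<open>W\<close>, and the result would be larger.\<close>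

definition dominant :: "nat \<Rightarrow> expvec \<Rightarrow> expvec" where
  "dominant m \<nu> = Max (orbit m \<nu>)"

lemma dominant_in_orbit: "dominant m \<nu> \<in> orbit m \<nu>"
  unfolding dominant_def using Max_in[OF finite_orbit_set] orbit_refl by blast

lemma orbit_le_dominant: "\<mu> \<in> orbit m \<nu> \<Longrightarrow> \<mu> \<le> dominant m \<nu>"
  unfolding dominant_def by (rule Max_ge[OF finite_orbit_set])

lemma dominant_eq: "\<mu> \<in> orbit m \<nu> \<Longrightarrow> dominant m \<mu> = dominant m \<nu>"
  unfolding dominant_def by (simp only: orbit_eq)

definition l1_norm :: "nat \<Rightarrow> expvec \<Rightarrow> int" where
  "l1_norm m \<nu> = (\<Sum>i=1..m. \<bar>lk \<nu> i\<bar>)"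

lemma orbit_l1_norm:
  assumes "\<mu> \<in> orbit m \<nu>"
  shows "l1_norm m \<mu> = l1_norm m \<nu>" and "Poly_Mapping.keys \<nu> \<subseteq> {1..m} \<Longrightarrow> Poly_Mapping.keys \<mu> \<subseteq> {1..m}"
proof -
  obtain w where "w \<in> weyl m" and m: "\<mu> = w \<nu>" using assms unfolding orbit_def by blast
  then obtain \<sigma> \<epsilon> where w: "\<sigma> permutes {1..m}" "\<And>i. \<epsilon> i = 1 \<or> \<epsilon> i = -1" "\<And>i. i \<notin> {1..m} \<Longrightarrow> \<epsilon> i = 1"
    "\<And>\<nu> i. lk (w \<nu>) i = \<epsilon> i * lk \<nu> (\<sigma> i)"
    using weylE by blast
  have "\<bar>lk \<mu> i\<bar> = \<bar>lk \<nu> (\<sigma> i)\<bar>" for i unfolding m w(4) using w(2)[of i] by auto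
  hence "l1_norm m \<mu> = (\<Sum>i=1..m. ((\<lambda>i. \<bar>lk \<nu> i\<bar>) \<circ> \<sigma>) i)" by (simp add: l1_norm_def)
  also have "\<dots> = l1_norm m \<nu>" unfolding l1_norm_def by (rule sum.permute[OF w(1), symmetric])
  finally show "l1_norm m \<mu> = l1_norm m \<nu>" .
  show "Poly_Mapping.keys \<mu> \<subseteq> {1..m}" if "Poly_Mapping.keys \<nu> \<subseteq> {1..m}"
  proof
    fix i assume "i \<in> Poly_Mapping.keys \<mu>"
    hence "lk \<nu> (\<sigma> i) \<noteq> 0" by (simp add: m in_keys_iff w(4))
    hence "\<sigma> i \<in> {1..m}" using that by (meson in_keys_iff subsetD)
    thus "i \<in> {1..m}" using permutes_in_image[OF w(1)] by blast
  qed
qed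

lemma dominant_partition:
  assumes k: "Poly_Mapping.keys \<nu> \<subseteq> {1..m}"
  shows "partition_vec m (dominant m \<nu>)"
proof -
  define \<mu> where "\<mu> = dominant m \<nu>"
  have keys: "Poly_Mapping.keys \<mu> \<subseteq> {1..m}"
    unfolding \<mu>_def by (rule orbit_l1_norm(2)[OF dominant_in_orbit k])
  have max: "\<kappa> \<le> \<mu>" if "\<kappa> \<in> orbit m \<mu>" for \<kappa>
    using orbit_le_dominant[OF that] dominant_eq[OF dominant_in_orbit[of m \<nu>]] by (simp add: \<mu>_def)
  have out: "lk \<mu> i = 0" if "i \<notin> {1..m}" for i
    using keys that by (meson in_keys_iff subsetD)
  have nn: "lk \<mu> i \<ge> 0" for i
  proof (rule ccontr)
    assume neg: "\<not> lk \<mu> i \<ge> 0"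
    hence i: "i \<in> {1..m}" using out by fastforce
    obtain w where w: "w \<in> weyl m" "\<forall>\<nu> j. lk (w \<nu>) j = (if j = i then -1 else 1) * lk \<nu> (id j)"
      using weyl_exists[OF permutes_id, of "\<lambda>j. if j = i then -1 else 1" m] i by fastforce
    have "\<mu> < w \<mu>"
      by (rule less_expvecI[of _ i]) (use neg in \<open>auto simp: w\<close>)
    moreover have "w \<mu> \<le> \<mu>" by (rule max) (use w(1) in \<open>auto simp: orbit_def\<close>)
    ultimately show False by simp
  qed
  have dec: "lk \<mu> j \<le> lk \<mu> i" if "1 \<le> i" "i \<le> j" "j \<le> m" for i j
  proof (rule ccontr)
    assume neg: "\<not> lk \<mu> j \<le> lk \<mu> i"
    have ij: "i < j" using that(2) neg by (cases "i = j") auto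
    have p: "transpose i j permutes {1..m}" by (rule permutes_swap_id) (use that in auto)
    obtain w where w: "w \<in> weyl m" "\<forall>\<nu> k. lk (w \<nu>) k = 1 * lk \<nu> (transpose i j k)"
      using weyl_exists[OF p, of "\<lambda>_. 1"] by blast
    have "\<mu> < w \<mu>"
      by (rule less_expvecI[of _ i]) (use neg ij in \<open>auto simp: w transpose_def\<close>)
    moreover have "w \<mu> \<le> \<mu>" by (rule max) (use w(1) in \<open>auto simp: orbit_def\<close>)
    ultimately show False by simp
  qed
  show ?thesis unfolding partition_vec_def \<mu>_def[symmetric] using keys nn dec by blast
qed

lemma row_lookup: "lk (row r) i = (if i = 1 then int r else 0)"
  by (simp add: row_def lookup_single when_def)

lemma l1_norm_row: "m \<ge> 1 \<Longrightarrow> l1_norm m (row r) = int r"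
proof -
  assume "m \<ge> 1"
  have "l1_norm m (row r) = (\<Sum>i=1..m. if i = 1 then int r else 0)"
    unfolding l1_norm_def row_lookup by (intro sum.cong) auto
  thus ?thesis using \<open>m \<ge> 1\<close> by simp
qed

lemma keys_row: "m \<ge> 1 \<Longrightarrow> Poly_Mapping.keys (row r) \<subseteq> {1..m}"
  by (auto simp: in_keys_iff row_lookup split: if_splits)

text \<open>The first entry of \<open>\<nu>\<close> is at most \<open>r\<close>, and if it is \<open>r\<close> then nothing is left for the others.\<close>

lemma le_row:
  assumes m: "m \<ge> 1" and k: "Poly_Mapping.keys \<nu> \<subseteq> {1..m}" and l: "l1_norm m \<nu> \<le> int r"
  shows "\<nu> \<le> row r"
proof -
  have out: "lk \<nu> i = 0" if "i \<notin> {1..m}" for i using k that by (meson in_keys_iff subsetD)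
  have split: "l1_norm m \<nu> = \<bar>lk \<nu> 1\<bar> + (\<Sum>i\<in>{1..m} - {1}. \<bar>lk \<nu> i\<bar>)"
    unfolding l1_norm_def by (rule sum.remove) (use m in auto)
  have nn: "0 \<le> (\<Sum>i\<in>{1..m} - {1}. \<bar>lk \<nu> i\<bar>)" by (intro sum_nonneg) simp
  show ?thesis
  proof (cases "lk \<nu> 1 < int r")
    case True
    have "\<nu> < row r"
      by (rule less_expvecI[of _ 1]) (use True out[of 0] in \<open>auto simp: row_lookup\<close>)
    thus ?thesis by simp
  next
    case False
    hence e: "lk \<nu> 1 = int r" "(\<Sum>i\<in>{1..m} - {1}. \<bar>lk \<nu> i\<bar>) = 0" using split nn l by linarith+
    have "lk \<nu> i = lk (row r) i" for i
    proof (cases "i \<in> {1..m} - {1}")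
      case True
      hence "\<bar>lk \<nu> i\<bar> = 0" using e(2) by (subst (asm) sum_nonneg_eq_0_iff) auto
      thus ?thesis using True by (simp add: row_lookup)
    next
      case False
      hence "i = 1 \<or> i \<notin> {1..m}" by auto
      thus ?thesis using e(1) out by (auto simp: row_lookup)
    qed
    hence "\<nu> = row r" by (rule poly_mapping_eqI)
    thus ?thesis by simp
  qed
qed

lemma dominant_row: "m \<ge> 1 \<Longrightarrow> dominant m (row r) = row r"
proof -
  assume m: "m \<ge> 1"
  have "dominant m (row r) \<le> row r"
    by (rule le_row[OF m orbit_l1_norm(2)[OF dominant_in_orbit keys_row[OF m]]])
       (simp only: orbit_l1_norm(1)[OF dominant_in_orbit] l1_norm_row[OF m] order_refl)
  moreover have "row r \<le> dominant m (row r)" by (rule orbit_le_dominant[OF orbit_refl])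
  ultimately show ?thesis by simp
qed

text \<open>So the orbit sums of the partitions below \<open>(r)\<close> do not contain the monomial \<open>z\<^sub>1\<^sup>r\<close>.\<close>

lemma partition_in_orbit_row:
  assumes m: "m \<ge> 1" and p: "partition_vec m \<mu>" and o: "row r \<in> orbit m \<mu>"
  shows "\<mu> = row r"
proof -
  have "\<mu> \<in> orbit m (row r)" using o by (rule orbit_sym)
  then obtain w where "w \<in> weyl m" and mu: "\<mu> = w (row r)" unfolding orbit_def by blast
  then obtain \<sigma> \<epsilon> where w: "\<sigma> permutes {1..m}" "\<And>i. \<epsilon> i = 1 \<or> \<epsilon> i = -1" "\<And>i. i \<notin> {1..m} \<Longrightarrow> \<epsilon> i = 1"
    "\<And>\<nu> i. lk (w \<nu>) i = \<epsilon> i * lk \<nu> (\<sigma> i)"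
    using weylE by blast
  have lm: "lk \<mu> i = (if \<sigma> i = 1 then \<epsilon> i * int r else 0)" for i by (simp add: mu w(4) row_lookup)
  have nn: "lk \<mu> i \<ge> 0" for i using p unfolding partition_vec_def by blast
  define i0 where "i0 = inv \<sigma> 1"
  have i0: "\<sigma> i0 = 1" by (simp add: i0_def permutes_inverses[OF w(1)])
  have "\<sigma> i0 \<in> {1..m}" unfolding i0 using m by simp
  hence i0m: "i0 \<in> {1..m}" by (simp only: permutes_in_image[OF w(1)])
  have e0: "lk \<mu> i0 = \<epsilon> i0 * int r" by (simp add: lm i0)
  have r0: "lk \<mu> i0 = int r"
  proof (cases "\<epsilon> i0 = 1")
    case True
    thus ?thesis by (simp add: e0)
  next
    case False
    hence "\<epsilon> i0 = -1" using w(2)[of i0] by blast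
    thus ?thesis using nn[of i0] by (simp add: e0)
  qed
  have le: "lk \<mu> i0 \<le> lk \<mu> 1" using p i0m unfolding partition_vec_def by auto
  have uniq: "\<sigma> i = 1 \<longleftrightarrow> i = i0" for i
    using inj_eq[OF permutes_inj[OF w(1)], of i i0] unfolding i0 .
  show ?thesis
  proof (cases "i0 = 1 \<or> r = 0")
    case True
    have "lk \<mu> i = lk (row r) i" for i
    proof (cases "i = i0")
      case i: True
      show ?thesis using True unfolding i r0 row_lookup by auto
    next
      case False
      hence "lk \<mu> i = 0" by (simp only: lm uniq if_False)
      thus ?thesis using False True by (auto simp: row_lookup)
    qed
    thus ?thesis by (rule poly_mapping_eqI)
  next
    case False
    hence "lk \<mu> 1 = 0" unfolding lm uniq by auto
    thus ?thesis using le r0 False by auto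
  qed
qed

lemma orbit_sum_lookup: "lk (orbit_sum m \<mu>) \<nu> = (if \<nu> \<in> orbit m \<mu> then 1 else 0)"
proof -
  have "lk (orbit_sum m \<mu>) \<nu> = (\<Sum>x\<in>orbit m \<mu>. if x = \<nu> then 1 else 0)"
    unfolding orbit_sum_def orbit_def[symmetric] lookup_sum lookup_single when_def ..
  thus ?thesis by (simp only: sum.delta[OF finite_orbit_set] sum.delta'[OF finite_orbit_set])
qed

lemma lookup_lconst_mult: "lk (lconst c * P) \<nu> = c * lk P \<nu>"
proof -
  have "lconst c * P = (\<Sum>x\<in>Poly_Mapping.keys P. sg x (c * lk P x))"
    unfolding lconst_def
    by (subst sum_single_keys[of P, symmetric]) (simp only: sum_distrib_left mult_single add_0_left)
  hence "lk (lconst c * P) \<nu> = (\<Sum>x\<in>Poly_Mapping.keys P. if x = \<nu> then c * lk P x else 0)"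
    by (simp only: lookup_sum lookup_single when_def)
  also have "\<dots> = (if \<nu> \<in> Poly_Mapping.keys P then c * lk P \<nu> else 0)"
    by (simp only: sum.delta[OF finite_keys] sum.delta'[OF finite_keys])
  also have "\<dots> = c * lk P \<nu>" by (simp only: in_keys_iff mult_zero_right split: if_split) simp
  finally show ?thesis .
qed

lemma weyl_invariant_lookup:
  assumes "weyl_invariant m P" "\<mu> \<in> orbit m \<nu>"
  shows "lk P \<mu> = lk P \<nu>"
proof -
  obtain w where w: "w \<in> weyl m" and mu: "\<mu> = w \<nu>" using assms(2) unfolding orbit_def by blast
  obtain w' where "\<And>\<nu>. w' (w \<nu>) = \<nu>" using weyl_inverse[OF w] by blast
  hence inj: "w x = w y \<longleftrightarrow> x = y" for x y by metis
  have "lk (weyl_act w P) \<mu> = (\<Sum>x\<in>Poly_Mapping.keys P. if x = \<nu> then lk P x else 0)"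
    unfolding weyl_act_def lookup_sum lookup_single when_def mu inj ..
  also have "\<dots> = (if \<nu> \<in> Poly_Mapping.keys P then lk P \<nu> else 0)"
    by (simp only: sum.delta[OF finite_keys] sum.delta'[OF finite_keys])
  also have "\<dots> = lk P \<nu>" by (simp only: in_keys_iff split: if_split) simp
  finally show ?thesis using assms(1) w unfolding weyl_invariant_def by simp
qed

text \<open>For \<open>W\<close>-invariant Laurent polynomials this means that only partitions \<open>\<mu> \<le> (r)\<close> occur, since dominance
  by the row \<open>(r)\<close> just says that \<open>\<mu>\<^sub>1 + \<dots> + \<mu>\<^sub>m \<le> r\<close>.\<close>

definition supported :: "nat \<Rightarrow> nat \<Rightarrow> laurent \<Rightarrow> bool" where
  "supported m r P \<longleftrightarrow> (\<forall>\<nu>. lk P \<nu> \<noteq> 0 \<longrightarrow> Poly_Mapping.keys \<nu> \<subseteq> {1..m} \<and> l1_norm m \<nu> \<le> int r)"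

lemma partition_dominated_row:
  assumes "partition_vec m \<mu>" "l1_norm m \<mu> \<le> int r"
  shows "dominated m \<mu> (row r)"
  unfolding dominated_def
proof
  fix i assume i: "i \<in> {1..m}"
  have "(\<Sum>j=1..i. lk \<mu> j) \<le> (\<Sum>j=1..i. \<bar>lk \<mu> j\<bar>)" by (intro sum_mono) simp
  also have "\<dots> \<le> l1_norm m \<mu>" unfolding l1_norm_def by (rule sum_mono2) (use i in auto)
  also have "\<dots> \<le> int r" by (rule assms(2))
  also have "int r = (\<Sum>j=1..i. lk (row r) j)" unfolding row_lookup using i by simp
  finally show "(\<Sum>j=1..i. lk \<mu> j) \<le> (\<Sum>j=1..i. lk (row r) j)" .
qed

lemma below_row_l1_norm:
  assumes m: "m \<ge> 1" and \<mu>: "\<mu> \<in> below m (row r)"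
  shows "Poly_Mapping.keys \<mu> \<subseteq> {1..m}" "l1_norm m \<mu> \<le> int r"
proof -
  have p: "partition_vec m \<mu>" and d: "dominated m \<mu> (row r)" using \<mu> by (simp_all add: below_def)
  show "Poly_Mapping.keys \<mu> \<subseteq> {1..m}" using p unfolding partition_vec_def by blast
  have "l1_norm m \<mu> = (\<Sum>j=1..m. lk \<mu> j)"
    unfolding l1_norm_def by (intro sum.cong refl abs_of_nonneg) (use p in \<open>auto simp: partition_vec_def\<close>)
  also have "\<dots> \<le> (\<Sum>j=1..m. lk (row r) j)" using d m unfolding dominated_def by auto
  also have "\<dots> = int r" unfolding row_lookup using m by simp
  finally show "l1_norm m \<mu> \<le> int r" .
qed

text \<open>The coefficient of \<open>z\<^sup>\<nu>\<close> equals that of \<open>z\<close> to the dominant element of the orbit of \<open>\<nu>\<close>. The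
  elements of \<open>below\<close> are partitions; the test \<open>dominant m \<mu> = \<mu>\<close> in the definition of the coefficients makes
  sure that each orbit is counted once.\<close>

theorem orbit_sum_expansion:
  assumes m: "m \<ge> 1" and inv: "weyl_invariant m P" and supp: "supported m r P" and one: "lk P (row r) = 1"
  shows "\<exists>cf. P = orbit_sum m (row r) + (\<Sum>\<mu>\<in>below m (row r). lconst (cf \<mu>) * orbit_sum m \<mu>)"
proof -
  define cf where "cf \<mu> = (if dominant m \<mu> = \<mu> then lk P \<mu> else 0)" for \<mu>
  define S where "S = insert (row r) (below m (row r))"
  have nin: "row r \<notin> below m (row r)" by (simp add: below_def)
  have finS: "finite S" by (simp add: S_def finite_below)
  have "lk P \<nu> = (\<Sum>\<mu>\<in>S. cf \<mu> * (if \<nu> \<in> orbit m \<mu> then 1 else 0))" for \<nu>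
  proof -
    have "(\<Sum>\<mu>\<in>S. cf \<mu> * (if \<nu> \<in> orbit m \<mu> then 1 else 0)) =
        (\<Sum>\<mu>\<in>S. if \<mu> = dominant m \<nu> then lk P \<nu> else 0)"
    proof (rule sum.cong[OF refl])
      fix \<mu> assume "\<mu> \<in> S"
      have "cf \<mu> * (if \<nu> \<in> orbit m \<mu> then 1 else 0) = (if dominant m \<mu> = \<mu> \<and> \<nu> \<in> orbit m \<mu> then lk P \<mu> else 0)"
        unfolding cf_def by (cases "dominant m \<mu> = \<mu>"; cases "\<nu> \<in> orbit m \<mu>")
          (simp_all only: if_True if_False mult_1_right mult_zero_right mult_zero_left simp_thms)
      also have "dominant m \<mu> = \<mu> \<and> \<nu> \<in> orbit m \<mu> \<longleftrightarrow> \<mu> = dominant m \<nu>"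
      proof
        assume a: "dominant m \<mu> = \<mu> \<and> \<nu> \<in> orbit m \<mu>"
        hence "dominant m \<nu> = dominant m \<mu>" by (intro dominant_eq) blast
        thus "\<mu> = dominant m \<nu>" using a by simp
      next
        assume a: "\<mu> = dominant m \<nu>"
        hence in_orb: "\<mu> \<in> orbit m \<nu>" using dominant_in_orbit by simp
        have "dominant m \<mu> = \<mu>" using dominant_eq[OF in_orb] a by simp
        thus "dominant m \<mu> = \<mu> \<and> \<nu> \<in> orbit m \<mu>" using orbit_sym[OF in_orb] by blast
      qed
      also have "(if \<mu> = dominant m \<nu> then lk P \<mu> else 0) = (if \<mu> = dominant m \<nu> then lk P \<nu> else 0)"
        using weyl_invariant_lookup[OF inv dominant_in_orbit[of m \<nu>]] by (intro if_cong refl) (simp only:)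
      finally show "cf \<mu> * (if \<nu> \<in> orbit m \<mu> then 1 else 0) = (if \<mu> = dominant m \<nu> then lk P \<nu> else 0)" .
    qed
    also have "\<dots> = (if dominant m \<nu> \<in> S then lk P \<nu> else 0)"
      by (simp only: sum.delta[OF finS] sum.delta'[OF finS])
    also have "\<dots> = lk P \<nu>"
    proof (cases "lk P \<nu> = 0")
      case False
      hence k: "Poly_Mapping.keys \<nu> \<subseteq> {1..m}" "l1_norm m \<nu> \<le> int r" using supp unfolding supported_def by blast+
      have p: "partition_vec m (dominant m \<nu>)" by (rule dominant_partition[OF k(1)])
      have "l1_norm m (dominant m \<nu>) \<le> int r" using orbit_l1_norm(1)[OF dominant_in_orbit[of m \<nu>]] k(2) by simp
      from partition_dominated_row[OF p this] have "dominant m \<nu> \<in> S"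
        using p unfolding S_def below_def by blast
      thus ?thesis by (simp only: if_True)
    qed (simp only: if_cancel)
    finally show ?thesis ..
  qed
  hence "P = (\<Sum>\<mu>\<in>S. lconst (cf \<mu>) * orbit_sum m \<mu>)"
    by (intro poly_mapping_eqI) (simp only: lookup_sum lookup_lconst_mult orbit_sum_lookup)
  also have "\<dots> = lconst (cf (row r)) * orbit_sum m (row r) + (\<Sum>\<mu>\<in>below m (row r). lconst (cf \<mu>) * orbit_sum m \<mu>)"
    unfolding S_def by (rule sum.insert[OF finite_below nin])
  also have "lconst (cf (row r)) = 1"
    unfolding cf_def dominant_row[OF m] one lconst_def by simp
  finally show ?thesis unfolding mult_1_left by blast
qed

lemma orbit_sum_expansionD:
  assumes m: "m \<ge> 1"
    and P: "P = orbit_sum m (row r) + (\<Sum>\<mu>\<in>below m (row r). lconst (cf \<mu>) * orbit_sum m \<mu>)"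
  shows "lk P (row r) = 1" and "supported m r P"
proof -
  have lkP: "lk P \<nu> = (if \<nu> \<in> orbit m (row r) then 1 else 0) +
      (\<Sum>\<mu>\<in>below m (row r). cf \<mu> * (if \<nu> \<in> orbit m \<mu> then 1 else 0))" for \<nu>
    unfolding P by (simp only: lookup_add lookup_sum lookup_lconst_mult orbit_sum_lookup)
  have "row r \<notin> orbit m \<mu>" if "\<mu> \<in> below m (row r)" for \<mu>
    using partition_in_orbit_row[OF m] that by (auto simp: below_def)
  hence "(\<Sum>\<mu>\<in>below m (row r). cf \<mu> * (if row r \<in> orbit m \<mu> then 1 else 0)) = 0"
    by (intro sum.neutral ballI) (simp only: if_False mult_zero_right)
  thus "lk P (row r) = 1" unfolding lkP using orbit_refl by (simp only: if_True add_0_right)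
  show "supported m r P"
    unfolding supported_def
  proof (intro allI impI)
    fix \<nu> assume nz: "lk P \<nu> \<noteq> 0"
    have "\<exists>\<mu>. \<nu> \<in> orbit m \<mu> \<and> Poly_Mapping.keys \<mu> \<subseteq> {1..m} \<and> l1_norm m \<mu> \<le> int r"
    proof (cases "\<nu> \<in> orbit m (row r)")
      case True
      thus ?thesis using keys_row[OF m] l1_norm_row[OF m] by (intro exI[of _ "row r"]) simp
    next
      case False
      have "\<exists>\<mu>\<in>below m (row r). \<nu> \<in> orbit m \<mu>"
      proof (rule ccontr)
        assume "\<not> (\<exists>\<mu>\<in>below m (row r). \<nu> \<in> orbit m \<mu>)"
        hence "(\<Sum>\<mu>\<in>below m (row r). cf \<mu> * (if \<nu> \<in> orbit m \<mu> then 1 else 0)) = 0"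
          by (intro sum.neutral ballI) (simp only: if_False mult_zero_right bex_simps simp_thms)
        thus False using nz False unfolding lkP by (simp only: if_False add_0_right simp_thms)
      qed
      thus ?thesis using below_row_l1_norm[OF m] by blast
    qed
    then obtain \<mu> where \<mu>: "\<nu> \<in> orbit m \<mu>" "Poly_Mapping.keys \<mu> \<subseteq> {1..m}" "l1_norm m \<mu> \<le> int r" by blast
    show "Poly_Mapping.keys \<nu> \<subseteq> {1..m} \<and> l1_norm m \<nu> \<le> int r"
      using orbit_l1_norm(1)[OF \<mu>(1)] orbit_l1_norm(2)[OF \<mu>(1,2)] \<mu>(3) by simp
  qed
qed

lemma supported_bounded_by: "m \<ge> 1 \<Longrightarrow> supported m r P \<Longrightarrow> bounded_by P (row r)"
  unfolding supported_def bounded_by_def using le_row by blast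

lemma diff_diff_swap: "(x - y) - (z - v) = (x - z) - (y - v :: 'g::ab_group_add)"
  by (simp add: algebra_simps)

lemma koorn_op_diff:
  "koorn_op m (P - Q) = koorn_op m P - koorn_op m Q"
proof -
  have z: "to_fract (zscale s i (P - Q) - (P - Q)) =
      to_fract (zscale s i P - P) - to_fract (zscale s i Q - Q)" for s i
  proof -
    have "zscale s i (P - Q) = zscale s i P - zscale s i Q"
      by (rule poly_mapping_eqI) (simp only: lookup_zscale lookup_minus right_diff_distrib)
    thus ?thesis by (simp only: to_fract_diff diff_diff_swap)
  qed
  show ?thesis unfolding koorn_op_def z right_diff_distrib sum_subtractf by (rule add_diff_add[symmetric])
qed

text \<open>The eigenvalue of a solution is the spectrum at \<open>(r)\<close>. The difference of two solutions is an
  eigenfunction for the same eigenvalue, hence its leading monomial is \<open>z\<^sub>1\<^sup>r\<close>, whose coefficient cancels.\<close>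

theorem koornwinder_unique:
  assumes m: "m \<ge> 1" and P: "is_koornwinder m (row r) P" and Q: "is_koornwinder m (row r) Q"
  shows "P = Q"
proof (rule ccontr)
  assume ne: "P \<noteq> Q"
  define D where "D = P - Q"
  have facts: "koorn_op m X = fconst (spectrum m (row r)) * to_fract X" "lk X (row r) = 1" "supported m r X"
    if K: "is_koornwinder m (row r) X" for X
  proof -
    obtain cf ev where X: "X = orbit_sum m (row r) + (\<Sum>\<mu>\<in>below m (row r). lconst (cf \<mu>) * orbit_sum m \<mu>)"
      and e: "koorn_op m X = fconst ev * to_fract X"
      using K unfolding is_koornwinder_def by (elim conjE exE) (rule that)
    note f = orbit_sum_expansionD[OF m X]
    have "ev = spectrum m (row r)"
      by (rule eigenvalue_eq_spectrum[OF supported_bounded_by[OF m f(2)] _ e]) (simp only: f(1) one_neq_zero not_False_eq_True)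
    thus "koorn_op m X = fconst (spectrum m (row r)) * to_fract X" using e by (simp only:)
    show "lk X (row r) = 1" "supported m r X" by (rule f)+
  qed
  note eP = facts[OF P] and eQ = facts[OF Q]
  have eD: "koorn_op m D = fconst (spectrum m (row r)) * to_fract D"
    unfolding D_def koorn_op_diff eP(1) eQ(1) to_fract_diff right_diff_distrib ..
  have "D \<noteq> 0" using ne unfolding D_def by (simp only: right_minus_eq not_False_eq_True)
  hence ne0: "Poly_Mapping.keys D \<noteq> {}"
    using sum_single_keys[of D] by (intro notI) (simp only: sum.empty)
  define \<nu> where "\<nu> = Max (Poly_Mapping.keys D)"
  have nD: "lk D \<nu> \<noteq> 0" using Max_in[OF finite_keys ne0] unfolding \<nu>_def in_keys_iff .
  have bD: "bounded_by D \<nu>"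
    unfolding bounded_by_def \<nu>_def
    by (intro allI impI Max_ge[OF finite_keys]) (simp only: in_keys_iff not_False_eq_True)
  have "spectrum m (row r) = spectrum m \<nu>" by (rule eigenvalue_eq_spectrum[OF bD nD eD])
  moreover have "Poly_Mapping.keys \<nu> \<subseteq> {1..m}"
  proof -
    have "lk P \<nu> \<noteq> 0 \<or> lk Q \<nu> \<noteq> 0"
      using nD unfolding D_def lookup_minus by (cases "lk P \<nu> = 0") (simp_all only: diff_0 neg_equal_0_iff_equal simp_thms)
    thus ?thesis using eP(3) eQ(3) unfolding supported_def by blast
  qed
  ultimately have "row r = \<nu>" using spectrum_inj keys_row[OF m] by blast
  moreover have "lk D (row r) = 0" unfolding D_def lookup_minus eP(2) eQ(2) by (rule diff_self)
  ultimately show False using nD by (simp only: simp_thms)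
qed


section \<open>Symmetry, support and leading coefficient of \<open>H\<^sub>l\<close>\<close>

lemma laurent_eval_weyl_act:
  assumes "w \<in> weyl m"
  shows "laurent_eval (\<lambda>P. to_fract (weyl_act w P))"
  unfolding weyl_act_conv_monom_subst
  by (rule laurent_eval_monom_subst) (simp_all only: weyl_add[OF assms] weyl_0[OF assms] mult_1_left)

text \<open>An element of \<open>W\<close> permutes the factors of the generating function, each of which is invariant under
  the inversion of its variable.\<close>

theorem weyl_act_H_fun:
  assumes w: "w \<in> weyl m"
  shows "weyl_act w (H_fun m l) = H_fun m l"
proof -
  interpret W: laurent_eval "\<lambda>P. to_fract (weyl_act w P)" by (rule laurent_eval_weyl_act[OF w])
  obtain \<sigma> \<epsilon> where we: "\<sigma> permutes {1..m}" "\<And>i. \<epsilon> i = 1 \<or> \<epsilon> i = -1" "\<And>i. i \<notin> {1..m} \<Longrightarrow> \<epsilon> i = 1"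
    "\<And>\<nu> i. lk (w \<nu>) i = \<epsilon> i * lk \<nu> (\<sigma> i)"
    by (rule weylE[OF w]) (rule that)
  define x where "x j = to_fract (weyl_act w (zvar j))" for j
  have ws: "w (sg j 1) = sg (inv \<sigma> j) (\<epsilon> (inv \<sigma> j))" for j
  proof (rule poly_mapping_eqI)
    fix i
    have "\<sigma> i = j \<longleftrightarrow> i = inv \<sigma> j" using permutes_inverses[OF we(1)] by auto
    thus "lk (w (sg j 1)) i = lk (sg (inv \<sigma> j) (\<epsilon> (inv \<sigma> j))) i"
      unfolding we(4) lookup_single when_def by auto
  qed
  have gx: "K.gen_fun1 (x j) = K.gen_fun1 (zf (inv \<sigma> j))" for j
  proof -
    have xj: "x j = zmon (sg (inv \<sigma> j) (\<epsilon> (inv \<sigma> j)))"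
      unfolding x_def weyl_act_conv_monom_subst zvar_def monom_subst_single ws zmon_def mult_1_left ..
    show ?thesis
    proof (cases "\<epsilon> (inv \<sigma> j) = 1")
      case True
      show ?thesis unfolding xj True zf_zmon(1) ..
    next
      case False
      hence e: "\<epsilon> (inv \<sigma> j) = -1" using we(2) by blast
      show ?thesis unfolding xj e zf_zmon(2)[symmetric] by (rule K.gen_fun1_inverse)
    qed
  qed
  have "(\<Prod>j=1..m. K.gen_fun1 (x j)) = (\<Prod>j=1..m. ((\<lambda>j. K.gen_fun1 (zf j)) \<circ> inv \<sigma>) j)"
    by (simp only: gx o_def)
  also have "\<dots> = (\<Prod>j=1..m. K.gen_fun1 (zf j))"
    by (rule prod.permute[OF permutes_inv[OF we(1)], symmetric])
  finally have "K.hsum (fconst par_a) m l x = K.hsum (fconst par_a) m l zf"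
    by (intro K.hsum_cong_gen_fun) (simp_all only: x_def W.zvar_nz zf_nz not_False_eq_True)
  moreover have "to_fract (weyl_act w (H_fun m l)) = fconst (q_half / t_half) ^ l * K.hsum (fconst par_a) m l x"
    unfolding W.H_fun_eval x_def ..
  moreover have "to_fract (H_fun m l) = fconst (q_half / t_half) ^ l * K.hsum (fconst par_a) m l zf"
    unfolding fconst.H_fun_eval by (simp only: zf_def[abs_def])
  ultimately have "to_fract (weyl_act w (H_fun m l)) = to_fract (H_fun m l)" by (simp only:)
  thus ?thesis by (simp only: to_fract_eq_iff)
qed

lemma l1_norm_add_le: "l1_norm m (\<mu> + \<nu>) \<le> l1_norm m \<mu> + l1_norm m \<nu>"
  unfolding l1_norm_def lookup_add sum.distrib[symmetric] by (intro sum_mono) simp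

lemma lookup_single_nonzeroD: "lk (sg \<mu> c) \<nu> \<noteq> 0 \<Longrightarrow> \<nu> = \<mu>"
  by (simp add: lookup_single when_def split: if_splits)

lemma supported_keysD:
  assumes "supported m r P" "\<nu> \<in> Poly_Mapping.keys P"
  shows "Poly_Mapping.keys \<nu> \<subseteq> {1..m} \<and> l1_norm m \<nu> \<le> int r"
proof -
  have "lk P \<nu> \<noteq> 0" using assms(2) unfolding in_keys_iff .
  with spec[OF assms(1)[unfolded supported_def], of \<nu>] show ?thesis by (rule mp)
qed

lemma supported_mult:
  assumes P: "supported m r P" and Q: "supported m s Q"
  shows "supported m (r + s) (P * Q)"
  unfolding supported_def
proof (intro allI impI)
  fix \<nu> assume "lk (P * Q) \<nu> \<noteq> 0"
  hence "\<nu> \<in> Poly_Mapping.keys (P * Q)" by (simp only: in_keys_iff not_False_eq_True)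
  then obtain x y where xy: "\<nu> = x + y" "x \<in> Poly_Mapping.keys P" "y \<in> Poly_Mapping.keys Q"
    using keys_mult[of P Q] by blast
  have x: "Poly_Mapping.keys x \<subseteq> {1..m}" "l1_norm m x \<le> int r"
    using supported_keysD[OF P xy(2)] by blast+
  have y: "Poly_Mapping.keys y \<subseteq> {1..m}" "l1_norm m y \<le> int s"
    using supported_keysD[OF Q xy(3)] by blast+
  have "Poly_Mapping.keys (x + y) \<subseteq> {1..m}" by (rule order_trans[OF keys_add]) (use x(1) y(1) in blast)
  moreover have "l1_norm m (x + y) \<le> int (r + s)" using x(2) y(2) l1_norm_add_le[of m x y] by linarith
  ultimately show "Poly_Mapping.keys \<nu> \<subseteq> {1..m} \<and> l1_norm m \<nu> \<le> int (r + s)"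
    unfolding xy(1) by blast
qed

lemma supported_single:
  assumes "Poly_Mapping.keys \<mu> \<subseteq> {1..m}" "l1_norm m \<mu> \<le> int r"
  shows "supported m r (sg \<mu> c)"
  unfolding supported_def
proof (intro allI impI)
  fix \<nu> assume "lk (sg \<mu> c) \<nu> \<noteq> 0"
  hence "\<nu> = \<mu>" by (rule lookup_single_nonzeroD)
  thus "Poly_Mapping.keys \<nu> \<subseteq> {1..m} \<and> l1_norm m \<nu> \<le> int r" using assms by simp
qed

lemma supported_add:
  assumes "supported m r P" "supported m r Q"
  shows "supported m r (P + Q)"
  unfolding supported_def
proof (intro allI impI)
  fix \<nu> assume "lk (P + Q) \<nu> \<noteq> 0"
  hence "lk P \<nu> \<noteq> 0 \<or> lk Q \<nu> \<noteq> 0"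
    unfolding lookup_add by (cases "lk P \<nu> = 0") (simp_all only: add_0_left simp_thms)
  thus "Poly_Mapping.keys \<nu> \<subseteq> {1..m} \<and> l1_norm m \<nu> \<le> int r"
    using assms unfolding supported_def by blast
qed

lemma supported_sum:
  assumes "\<And>x. x \<in> A \<Longrightarrow> supported m r (f x)"
  shows "supported m r (sum f A)"
proof (cases "finite A")
  case True
  thus ?thesis using assms
  proof (induction A)
    case empty
    show ?case by (simp only: sum.empty supported_def lookup_zero simp_thms)
  next
    case (insert x A)
    thus ?case unfolding sum.insert[OF insert.hyps] by (intro supported_add) blast+
  qed
next
  case False
  show ?thesis unfolding sum.infinite[OF False] by (simp only: supported_def lookup_zero simp_thms)
qed

lemma supported_lconst: "supported m 0 (lconst c)"
  unfolding lconst_def by (rule supported_single) (simp_all add: l1_norm_def)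

lemma supported_mono: "supported m r P \<Longrightarrow> r \<le> s \<Longrightarrow> supported m s P"
  unfolding supported_def by (meson of_nat_mono order_trans)

lemma ang2_conv: "ang2 j w = sg (sg j 1) 1 + sg (sg j (-1)) 1 + sg 0 (- w) + sg 0 (- inverse w)"
  by (simp only: ang2_def zvar_def zinv_def lconst_def single_uminus diff_conv_add_uminus)

lemma supported_ang2:
  assumes "j \<in> {1..m}"
  shows "supported m 1 (ang2 j w)"
proof -
  have l: "l1_norm m (sg j c) = \<bar>c\<bar>" for c
  proof -
    have "l1_norm m (sg j c) = (\<Sum>i=1..m. if i = j then \<bar>c\<bar> else 0)"
      unfolding l1_norm_def lookup_single when_def by (intro sum.cong) auto
    thus ?thesis using assms by simp
  qed
  have "l1_norm m 0 = 0" by (simp add: l1_norm_def)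
  thus ?thesis unfolding ang2_conv
    using assms by (intro supported_add supported_single) (auto simp: l)
qed

lemma supported_ang2_fact:
  assumes "j \<in> {1..m}"
  shows "supported m n (ang2_fact j w n)"
proof (induction n)
  case 0
  show ?case unfolding ang2_fact_def using supported_lconst[of m 1] by (simp add: lconst_def)
next
  case (Suc n)
  from supported_mult[OF Suc supported_ang2[OF assms, of "par_q ^ n * w"]]
  have "supported m (n + 1) (ang2_fact j w (Suc n))"
    unfolding ang2_fact_def prod.lessThan_Suc .
  thus ?case unfolding Suc_eq_plus1 .
qed

lemma supported_H_fun: "n \<le> m \<Longrightarrow> supported m l (H_fun n l)"
proof (induction n arbitrary: l)
  case 0
  have "supported m l (lconst c)" for c by (rule supported_mono[OF supported_lconst]) simp
  moreover have "H_fun 0 l = lconst (if l = 0 then 1 else 0)" by (simp add: H_fun_0 lconst_def)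
  ultimately show ?case by (simp only:)
next
  case (Suc n)
  show ?case unfolding H_fun_Suc
  proof (rule supported_sum)
    fix k assume "k \<in> {..l}"
    hence k: "k + (0 + (l - k)) = l" by simp
    have j: "Suc n \<in> {1..m}" using Suc.prems by simp
    have "supported m k (H_fun n k)" using Suc by simp
    hence "supported m (k + (0 + (l - k))) (H_fun n k * (lconst (ang_fact par_t (l - k) / ang_fact par_q (l - k)) *
       ang2_fact (Suc n) (par_t ^ n * par_q ^ k * par_a) (l - k)))"
      by (intro supported_mult supported_lconst supported_ang2_fact[OF j])
    thus "supported m l (H_fun n k * (lconst (ang_fact par_t (l - k) / ang_fact par_q (l - k)) *
       ang2_fact (Suc n) (par_t ^ n * par_q ^ k * par_a) (l - k)))" unfolding k .
  qed
qed

lemma leading_ang2: "bounded_by (ang2 j w) (sg j 1)" "lk (ang2 j w) (sg j 1) = 1"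
proof -
  have p: "(0 :: expvec) < sg j 1" by (rule unit_pos)
  have n: "sg j (-1) < (0 :: expvec)"
    using p unfolding single_uminus by (simp only: neg_less_0_iff_less)
  have b: "bounded_by (sg \<mu> c) (sg j 1)" if "\<mu> \<le> sg j 1" for \<mu> and c :: pfield
    unfolding bounded_by_def
  proof (intro allI impI)
    fix \<nu> assume "lk (sg \<mu> c) \<nu> \<noteq> 0"
    hence "\<nu> = \<mu>" by (rule lookup_single_nonzeroD)
    thus "\<nu> \<le> sg j 1" using that by simp
  qed
  show "bounded_by (ang2 j w) (sg j 1)"
    unfolding ang2_conv by (intro bounded_by_add b) (use p n in simp_all)
  have ne: "sg j (-1) \<noteq> (sg j 1 :: expvec)" "(0 :: expvec) \<noteq> sg j 1" using p n by auto
  show "lk (ang2 j w) (sg j 1) = 1"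
    unfolding ang2_conv lookup_add lookup_single_eq lookup_single_not_eq[OF ne(1)] lookup_single_not_eq[OF ne(2)]
      add_0_right ..
qed

lemma leading_ang2_fact:
  "bounded_by (ang2_fact j w n) (sg j (int n))" "lk (ang2_fact j w n) (sg j (int n)) = 1"
proof -
  have s: "(\<Sum>k<n. sg j 1) = (sg j (int n) :: expvec)"
    by (rule poly_mapping_eqI, unfold lookup_sum lookup_single) (simp add: when_def)
  have "bounded_by (ang2_fact j w n) (\<Sum>k<n. sg j 1) \<and>
      lk (ang2_fact j w n) (\<Sum>k<n. sg j 1) = (\<Prod>k<n. lk (ang2 j (par_q ^ k * w)) (sg j 1))"
    unfolding ang2_fact_def by (rule bounded_by_prod[OF finite_lessThan leading_ang2(1)])
  thus "bounded_by (ang2_fact j w n) (sg j (int n))" "lk (ang2_fact j w n) (sg j (int n)) = 1"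
    unfolding s leading_ang2(2) prod.neutral_const by blast+
qed

lemma bounded_by_H_fun: "bounded_by (H_fun (Suc n) l) (row l)"
  by (rule supported_bounded_by[of "Suc n"]) (simp_all add: supported_H_fun)

text \<open>In the recursion over the number of variables, the terms with \<open>k < l\<close> contain \<open>z\<^sub>1\<close> at most to the power \<open>k\<close>.
  The term with \<open>k = l\<close> is \<open>H\<^sub>l\<close> in one variable less, which reduces the claim to a single variable.\<close>

theorem H_fun_leading_coeff:
  "lk (H_fun (Suc n) l) (row l) = ang_fact par_t l / ang_fact par_q l"
proof (induction n)
  case 0
  define X where "X k = lconst (ang_fact par_t (l - k) / ang_fact par_q (l - k)) *
     ang2_fact (Suc 0) (par_t ^ 0 * par_q ^ k * par_a) (l - k)" for k
  have if_mult: "(if k = 0 then 1 else 0) * X k = (if k = 0 then X k else 0)" for k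
    by (cases "k = 0") (simp_all only: if_True if_False mult_1_left mult_zero_left refl)
  have "H_fun (Suc 0) l = (\<Sum>k\<le>l. if k = 0 then X k else 0)"
    unfolding H_fun_Suc X_def[symmetric] H_fun_0 if_mult ..
  also have "\<dots> = X 0" by (simp only: sum.delta[OF finite_atMost] atMost_iff le0 if_True)
  finally have H: "H_fun (Suc 0) l = X 0" .
  have row: "row l = sg (Suc 0) (int l)" by (simp add: row_def)
  show ?case unfolding H X_def row lookup_lconst_mult diff_zero leading_ang2_fact(2) mult_1_right ..
next
  case (Suc n)
  define X where "X k = lconst (ang_fact par_t (l - k) / ang_fact par_q (l - k)) *
     ang2_fact (Suc (Suc n)) (par_t ^ Suc n * par_q ^ k * par_a) (l - k)" for k
  have low: "lk (H_fun (Suc n) k * X k) (row l) = 0" if k: "k < l" for k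
  proof -
    have "bounded_by (lconst c * A) (0 + sg (Suc (Suc n)) (int (l - k)))"
      if "bounded_by A (sg (Suc (Suc n)) (int (l - k)))" for c A
      unfolding lconst_def by (rule bounded_by_mult(1)[OF bounded_by_single that])
    hence "bounded_by (X k) (0 + sg (Suc (Suc n)) (int (l - k)))"
      unfolding X_def using leading_ang2_fact(1) by blast
    hence "bounded_by (H_fun (Suc n) k * X k) (row k + (0 + sg (Suc (Suc n)) (int (l - k))))"
      by (rule bounded_by_mult(1)[OF bounded_by_H_fun])
    moreover have "row k + (0 + sg (Suc (Suc n)) (int (l - k))) < row l"
      by (rule less_expvecI[of _ 1]) (use k in \<open>auto simp: lookup_add row_lookup lookup_single when_def\<close>)
    ultimately show ?thesis by (rule bounded_byD)
  qed
  have X: "X l = 1"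
    unfolding X_def ang2_fact_def ang_fact_def diff_self_eq_0 lessThan_0 prod.empty lconst_def div_by_1 single_one mult_1_left ..
  have "lk (H_fun (Suc (Suc n)) l) (row l) = (\<Sum>k\<le>l. lk (H_fun (Suc n) k * X k) (row l))"
    unfolding H_fun_Suc[of "Suc n"] X_def[symmetric] by (rule lookup_sum)
  also have "\<dots> = (\<Sum>k\<in>{l}. lk (H_fun (Suc n) k * X k) (row l))"
    by (rule sum.mono_neutral_right) (use low in auto)
  also have "\<dots> = lk (H_fun (Suc n) l * X l) (row l)"
    by (simp only: sum.insert[OF finite.emptyI empty_iff[THEN iffD1, THEN notI]] sum.empty add_0_right)
  also have "\<dots> = lk (H_fun (Suc n) l) (row l)" unfolding X mult_1_right ..
  finally show ?case using Suc by (simp only:)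
qed

lemma H_fun_row_eq_0:
  assumes "m \<ge> 1" "l < r"
  shows "lk (H_fun m l) (row r) = 0"
proof (rule ccontr)
  assume "lk (H_fun m l) (row r) \<noteq> 0"
  hence "l1_norm m (row r) \<le> int l" using supported_H_fun[of m m l] unfolding supported_def by blast
  thus False using l1_norm_row[OF assms(1), of r] assms(2) by simp
qed


section \<open>The coefficients\<close>

text \<open>\<open>\<langle>q\<^sup>kx\<^sup>2\<rangle>\<close> for a monomial \<open>x\<close> in the square roots of the parameters, as a rational expression.\<close>

definition bracket :: "pfield \<Rightarrow> nat \<Rightarrow> pfield" where
  "bracket x k = - (1 - par_q ^ k * x ^ 2) / (q_half ^ k * x)"

lemma ang_fact_bracket: "half_monomial x \<Longrightarrow> ang_fact (x ^ 2) l = (\<Prod>k<l. bracket x k)"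
  unfolding bracket_def by (rule ang_fact_square)

lemma bracket_nz:
  assumes "half_monomial x" "par_q ^ k * x ^ 2 \<noteq> 1"
  shows "bracket x k \<noteq> 0"
proof -
  have "1 - par_q ^ k * x ^ 2 \<noteq> 0" using assms(2) by (simp only: right_minus_eq eq_commute not_False_eq_True)
  thus ?thesis unfolding bracket_def using half_monomial_nz[OF assms(1)]
    by (simp only: divide_eq_0_iff neg_equal_0_iff_equal mult_eq_0_iff power_eq_0_iff half_nz simp_thms)
qed

text \<open>\<open>-\<langle>q\<^bsup>k-r\<^esup>\<rangle> = \<langle>q\<^bsup>r-k\<^esup>\<rangle>\<close>, with \<open>x\<close> and \<open>y\<close> for the square roots of \<open>q\<^sup>k\<close> and \<open>q\<^bsup>r-k\<^esup>\<close>.\<close>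

lemma bracket_reflection:
  fixes x y :: "'f::field"
  assumes "x \<noteq> 0" "y \<noteq> 0"
  shows "- 1 * (- (1 - x ^ 2 * (inverse (x * y)) ^ 2) / (x * inverse (x * y))) = - (1 - y ^ 2) / y"
proof -
  have "x * inverse (x * y) = inverse y" using assms by simp
  moreover have "x ^ 2 * (inverse (x * y)) ^ 2 = (x * inverse (x * y)) ^ 2" by (simp only: power_mult_distrib)
  ultimately show ?thesis using assms by (simp add: field_simps power2_eq_square)
qed

text \<open>The quotient of consecutive coefficients times \<open>f\<^bsub>l+1\<^esub>\<close> is \<open>e\<^sub>r - e\<^sub>l\<close>. Letters with \<open>h\<close> are square roots of
  the parameters, \<open>T\<close> is that of \<open>t\<close>, \<open>S = T\<^bsup>m-1\<^esup>\<close>, \<open>Q\<close> and \<open>R\<close> are those of \<open>q\<^sup>l\<close> and \<open>q\<^sup>r\<close>, and \<open>x\<close> is the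
  node \<open>t\<^bsup>m-1\<^esup>aq\<^sup>l\<close>. The four brackets in the denominator cancel against the factors of \<open>f\<^bsub>l+1\<^esub>\<close>, and
  the two in the numerator are the factors of \<open>e\<^sub>r - e\<^sub>l\<close>.\<close>

lemma coefficient_recurrence:
  fixes ah bh ch dh qh T S Q R :: "'f::field"
  defines "al \<equiv> ah * bh * ch * dh / qh" and "x \<equiv> (T * S) ^ 2 * ah ^ 2 * Q ^ 2 / T ^ 2"
  assumes nz: "ah \<noteq> 0" "bh \<noteq> 0" "ch \<noteq> 0" "dh \<noteq> 0" "qh \<noteq> 0" "T \<noteq> 0" "S \<noteq> 0" "Q \<noteq> 0" "R \<noteq> 0"
    and D: "1 - Q ^ 2 * (T * S) ^ 2 \<noteq> 0" "1 - Q ^ 2 * (S * ah * bh) ^ 2 \<noteq> 0"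
      "1 - Q ^ 2 * (S * ah * ch) ^ 2 \<noteq> 0" "1 - Q ^ 2 * (S * ah * dh) ^ 2 \<noteq> 0"
  shows "- ((- (1 - Q ^ 2 * (inverse R) ^ 2) / (Q * inverse R)) * (- (1 - Q ^ 2 * (al * S ^ 2 * R) ^ 2) / (Q * (al * S ^ 2 * R)))) /
      ((- (1 - Q ^ 2 * (T * S) ^ 2) / (Q * (T * S))) * (- (1 - Q ^ 2 * (S * ah * bh) ^ 2) / (Q * (S * ah * bh))) *
       (- (1 - Q ^ 2 * (S * ah * ch) ^ 2) / (Q * (S * ah * ch))) * (- (1 - Q ^ 2 * (S * ah * dh) ^ 2) / (Q * (S * ah * dh)))) *
      (qh / T) *
      ((1 - bh ^ 2 * x) * (1 - ch ^ 2 * x) * (1 - dh ^ 2 * x) * (1 - (T * S) ^ 2 * Q ^ 2) / (Q ^ 2 * (qh ^ 2 * x))) =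
    ((1 / R ^ 2 - 1) + al ^ 2 * ((T * S) ^ 2) ^ 2 / (T ^ 2) ^ 2 * (R ^ 2 - 1)) -
    ((1 / Q ^ 2 - 1) + al ^ 2 * ((T * S) ^ 2) ^ 2 / (T ^ 2) ^ 2 * (Q ^ 2 - 1))"
proof -
  define F1 where "F1 = 1 - Q ^ 2 * (inverse R) ^ 2"
  define F2 where "F2 = 1 - Q ^ 2 * (al * S ^ 2 * R) ^ 2"
  define D1 where "D1 = 1 - Q ^ 2 * (T * S) ^ 2"
  define D2 where "D2 = 1 - Q ^ 2 * (S * ah * bh) ^ 2"
  define D3 where "D3 = 1 - Q ^ 2 * (S * ah * ch) ^ 2"
  define D4 where "D4 = 1 - Q ^ 2 * (S * ah * dh) ^ 2"
  have x: "x = S ^ 2 * ah ^ 2 * Q ^ 2" using nz by (simp add: x_def power_mult_distrib)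
  have e: "1 - (T * S) ^ 2 * Q ^ 2 = D1" "1 - bh ^ 2 * x = D2" "1 - ch ^ 2 * x = D3" "1 - dh ^ 2 * x = D4"
    unfolding D1_def D2_def D3_def D4_def x by (simp_all add: power_mult_distrib mult_ac)
  have Dnz: "D1 \<noteq> 0" "D2 \<noteq> 0" "D3 \<noteq> 0" "D4 \<noteq> 0" using D by (simp_all add: D1_def D2_def D3_def D4_def)
  have al: "al \<noteq> 0" using nz by (simp add: al_def)
  have aq: "al * qh = ah * bh * ch * dh" using nz by (simp add: al_def)
  have "- ((- F1 / (Q * inverse R)) * (- F2 / (Q * (al * S ^ 2 * R)))) /
      ((- D1 / (Q * (T * S))) * (- D2 / (Q * (S * ah * bh))) * (- D3 / (Q * (S * ah * ch))) * (- D4 / (Q * (S * ah * dh)))) *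
      (qh / T) * (D2 * D3 * D4 * D1 / (Q ^ 2 * (qh ^ 2 * x))) =
      - (F1 * F2) * (ah * bh * ch * dh) / (al * qh * Q ^ 2)"
    unfolding x using nz Dnz al by (simp add: divide_simps power2_eq_square) (simp add: mult_ac)?
  also have "\<dots> = - (F1 * F2) / Q ^ 2" unfolding aq using nz by simp
  also have "\<dots> = ((1 / R ^ 2 - 1) + al ^ 2 * ((T * S) ^ 2) ^ 2 / (T ^ 2) ^ 2 * (R ^ 2 - 1)) -
    ((1 / Q ^ 2 - 1) + al ^ 2 * ((T * S) ^ 2) ^ 2 / (T ^ 2) ^ 2 * (Q ^ 2 - 1))"
  proof -
    have t: "((T * S) ^ 2) ^ 2 / (T ^ 2) ^ 2 = S ^ 2 * S ^ 2"
      using nz by (simp add: power2_eq_square)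
    have "- (F1 * F2) / Q ^ 2 = (1 / R ^ 2 - 1 / Q ^ 2) * F2"
      unfolding F1_def using nz by (simp add: field_simps power2_eq_square)
    also have "\<dots> = (1 / R ^ 2 - 1 / Q ^ 2) + al ^ 2 * (S ^ 2 * S ^ 2) * (R ^ 2 - Q ^ 2)"
      unfolding F2_def using nz by (simp add: field_simps power2_eq_square)
    finally show ?thesis unfolding times_divide_eq_right[symmetric] t by (simp add: algebra_simps)
  qed
  finally show ?thesis
    unfolding e(1) e(2) e(3) e(4) unfolding F1_def F2_def D1_def D2_def D3_def D4_def .
qed


section \<open>Expansion in the functions \<open>H\<^sub>l\<close>\<close>

lemma koorn_op_add: "koorn_op m (P + Q) = koorn_op m P + koorn_op m Q"
  using koorn_op_diff[of m "P + Q" Q] by (simp only: add_diff_cancel_right' eq_diff_eq)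

lemma koorn_op_0: "koorn_op m 0 = 0"
  using koorn_op_diff[of m 0 0] by (simp only: diff_self)

lemma koorn_op_sum: "koorn_op m (sum f A) = (\<Sum>x\<in>A. koorn_op m (f x))"
  by (induction A rule: infinite_finite_induct)
     (simp_all only: sum.infinite sum.empty sum.insert koorn_op_0 koorn_op_add simp_thms)

lemma koorn_op_lconst_mult: "koorn_op m (lconst c * P) = fconst c * koorn_op m P"
proof -
  have z: "to_fract (zscale s i (lconst c * P) - lconst c * P) = fconst c * to_fract (zscale s i P - P)" for s i
  proof -
    have "zscale s i (lconst c * P) = lconst c * zscale s i P"
      by (rule poly_mapping_eqI) (simp only: lookup_zscale lookup_lconst_mult mult.left_commute)
    thus ?thesis by (simp only: fconst_def to_fract_mult[symmetric] right_diff_distrib)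
  qed
  show ?thesis unfolding koorn_op_def z distrib_left sum_distrib_left by (simp only: mult.left_commute)
qed

text \<open>The quantities \<open>eigen_coeff\<close>, \<open>node\<close> and \<open>raise_coeff\<close> in the parameter field, for \<open>B = t\<^sup>m\<close>.\<close>

definition eigen_par :: "nat \<Rightarrow> nat \<Rightarrow> pfield" where
  "eigen_par m l = (1 / par_q ^ l - 1) + al_half ^ 2 * (par_t ^ m) ^ 2 / par_t ^ 2 * (par_q ^ l - 1)"

definition node_par :: "nat \<Rightarrow> nat \<Rightarrow> pfield" where
  "node_par m l = par_t ^ m * par_a * par_q ^ l / par_t"

definition raise_par :: "nat \<Rightarrow> nat \<Rightarrow> pfield" where
  "raise_par m l = (1 - par_b * node_par m l) * (1 - par_c * node_par m l) * (1 - par_d * node_par m l) *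
     (1 - par_t ^ m * par_q ^ l) / (par_q ^ l * (par_q * node_par m l))"

lemma eigen_coeff_par: "K.eigen_coeff (fconst par_t ^ m) l = fconst (eigen_par m l)"
  unfolding K.eigen_coeff_def eigen_par_def
  by (simp only: fconst_add fconst_diff fconst_mult fconst_divide fconst_power fconst_1)

lemma raise_coeff_par: "K.raise_coeff (fconst par_t ^ m) l = fconst (raise_par m l)"
  unfolding K.raise_coeff_def K.node_def raise_par_def node_par_def
  by (simp only: fconst_add fconst_diff fconst_mult fconst_divide fconst_power fconst_1)

lemma sum_predecessor:
  fixes f :: "nat \<Rightarrow> 'a::comm_monoid_add"
  shows "(\<Sum>l=0..r. if l = 0 then 0 else f (l - 1)) = (\<Sum>l<r. f l)"
  by (induction r) simp_all

lemma mult_add_diff: "x * u + x * (v - u) = v * (x::'a::comm_ring)"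
  by (simp add: algebra_simps)

text \<open>By the two-term relation, the coefficient of \<open>H\<^sub>l\<close> in the image of the sum is, up to the normalising factor
  \<open>(abcd/q)\<^bsup>1/2\<^esup>t\<^bsup>m-1\<^esup>\<close> of the operator, \<open>\<kappa>\<^sub>le\<^sub>l + \<kappa>\<^bsub>l+1\<^esub>f\<^bsub>l+1\<^esub>\<close>, and the recurrence makes this \<open>e\<^sub>r\<kappa>\<^sub>l\<close>. It also yields \<open>\<kappa>\<^bsub>r+1\<^esub>f\<^bsub>r+1\<^esub> = 0\<close>, so that the
  sum may stop at \<open>l = r\<close>.\<close>

theorem H_expansion_eigenfunction:
  assumes m: "m \<ge> 1"
    and step: "\<And>l. \<kappa> (Suc l) * (q_half / t_half) * raise_par m l = \<kappa> l * (eigen_par m r - eigen_par m l)"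
  defines "S \<equiv> (\<Sum>l=0..r. lconst (\<kappa> l) * H_fun m l)"
  shows "koorn_op m S = fconst (eigen_par m r / (al_half * par_t ^ (m - 1))) * to_fract S"
proof -
  define M where "M = fconst al_half * fconst par_t ^ (m - 1)"
  define h where "h l = to_fract (H_fun m l)" for l
  define y where "y l = fconst (\<kappa> (Suc l) * (q_half / t_half) * raise_par m l)" for l
  have M: "M = fconst (al_half * par_t ^ (m - 1))" by (simp only: M_def fconst_mult fconst_power)
  have nz: "al_half * par_t ^ (m - 1) \<noteq> 0"
    by (simp only: mult_eq_0_iff power_eq_0_iff par_nz al_half_nz simp_thms)
  have M0: "M \<noteq> 0" unfolding M fconst_eq_0_iff by (rule nz)
  have S: "to_fract S = (\<Sum>l=0..r. fconst (\<kappa> l) * h l)"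
    unfolding S_def h_def by (simp only: to_fract_sum to_fract_mult fconst_def)
  have termwise: "M * (fconst (\<kappa> l) * koorn_op m (H_fun m l)) =
      fconst (\<kappa> l * eigen_par m l) * h l + (if l = 0 then 0 else y (l - 1) * h (l - 1))" for l
  proof -
    have "M * (fconst (\<kappa> l) * koorn_op m (H_fun m l)) = fconst (\<kappa> l) * (M * koorn_op m (H_fun m l))"
      by (rule mult.left_commute)
    also have "M * koorn_op m (H_fun m l) = fconst (eigen_par m l) * h l +
        (if l = 0 then 0 else fconst (q_half / t_half) * fconst (raise_par m (l - 1)) * h (l - 1))"
      unfolding M_def h_def koorn_op_H_fun[OF m] eigen_coeff_par raise_coeff_par ..
    also have "fconst (\<kappa> l) * \<dots> = fconst (\<kappa> l * eigen_par m l) * h l + (if l = 0 then 0 else y (l - 1) * h (l - 1))"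
    proof (cases l)
      case 0
      show ?thesis unfolding 0 if_P[OF refl] add_0_right fconst_mult mult.assoc ..
    next
      case (Suc k)
      show ?thesis unfolding Suc y_def diff_Suc_1 by (simp only: nat.simps if_False fconst_mult mult.assoc distrib_left)
    qed
    finally show ?thesis .
  qed
  have "M * koorn_op m S = (\<Sum>l=0..r. fconst (\<kappa> l * eigen_par m l) * h l) +
      (\<Sum>l=0..r. if l = 0 then 0 else y (l - 1) * h (l - 1))"
    unfolding S_def koorn_op_sum koorn_op_lconst_mult sum_distrib_left termwise sum.distrib ..
  also have "(\<Sum>l=0..r. if l = 0 then 0 else y (l - 1) * h (l - 1)) = (\<Sum>l=0..r. y l * h l)"
  proof -
    have yr: "y r = 0" unfolding y_def step by (simp only: diff_self mult_zero_right fconst_0)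
    have "(\<Sum>l=0..r. if l = 0 then 0 else y (l - 1) * h (l - 1)) = (\<Sum>l<r. y l * h l)"
      by (rule sum_predecessor)
    also have "\<dots> = (\<Sum>l<Suc r. y l * h l)" unfolding sum.lessThan_Suc yr mult_zero_left add_0_right ..
    finally show ?thesis unfolding lessThan_Suc_atMost atMost_atLeast0 .
  qed
  also have "(\<Sum>l=0..r. fconst (\<kappa> l * eigen_par m l) * h l) + (\<Sum>l=0..r. y l * h l) =
      (\<Sum>l=0..r. fconst (eigen_par m r) * (fconst (\<kappa> l) * h l))"
    unfolding sum.distrib[symmetric]
  proof (rule sum.cong[OF refl])
    fix l
    have "\<kappa> l * eigen_par m l + \<kappa> l * (eigen_par m r - eigen_par m l) = eigen_par m r * \<kappa> l"
      by (rule mult_add_diff)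
    thus "fconst (\<kappa> l * eigen_par m l) * h l + y l * h l = fconst (eigen_par m r) * (fconst (\<kappa> l) * h l)"
      unfolding y_def step distrib_right[symmetric] fconst_add[symmetric] mult.assoc[symmetric] fconst_mult[symmetric]
      by (simp only:)
  qed
  also have "\<dots> = fconst (eigen_par m r) * to_fract S" unfolding S sum_distrib_left ..
  finally have "inverse M * (M * koorn_op m S) = inverse M * (fconst (eigen_par m r) * to_fract S)" by (simp only:)
  thus ?thesis
    unfolding mult.assoc[symmetric] left_inverse[OF M0] mult_1_left
    by (simp only: M divide_inverse fconst_mult fconst_inverse mult_ac)
qed

lemma ang_facts_4: "ang_facts [u, v, x, y] l = ang_fact u l * ang_fact v l * ang_fact x l * ang_fact y l"
  and ang_facts_2: "ang_facts [u, v] l = ang_fact u l * ang_fact v l"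
  by (simp_all only: ang_facts_def list.map prod_list.Cons prod_list.Nil mult_1_right mult.assoc)

theorem theorem5p2:
  fixes m r :: nat
  assumes "m \<ge> 1"
  shows
    "lconst (ang_fact par_t r / ang_fact par_q r) * koornwinder m (row r) =
     lconst (ang_facts [par_t ^ m, par_t ^ (m - 1) * par_a * par_b,
                        par_t ^ (m - 1) * par_a * par_c, par_t ^ (m - 1) * par_a * par_d] r /
             ang_facts [par_q, par_t ^ (2 * (m - 1)) * par_a * par_b * par_c * par_d
                                 * par_q powi (int r - 1)] r) *
     (\<Sum>l=0..r.
        lconst ((-1) ^ l *
                ang_facts [par_q powi (- int r),
                           par_t ^ (2 * (m - 1)) * par_a * par_b * par_c * par_d
                             * par_q powi (int r - 1)] l /
                ang_facts [par_t ^ m, par_t ^ (m - 1) * par_a * par_b,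
                           par_t ^ (m - 1) * par_a * par_c, par_t ^ (m - 1) * par_a * par_d] l) *
        H_fun m l)"
proof -
  \<comment> \<open>the square roots of \<open>t\<^sup>m, t\<^bsup>m-1\<^esup>ab, t\<^bsup>m-1\<^esup>ac, t\<^bsup>m-1\<^esup>ad, q\<^bsup>-r\<^esup>\<close> and \<open>t\<^bsup>2(m-1)\<^esup>abcdq\<^bsup>r-1\<^esup>\<close>, in a form to which the
  recurrence of the coefficients applies\<close>
  define X1 where "X1 = t_half * t_half ^ (m - 1)"
  define X2 where "X2 = t_half ^ (m - 1) * a_half * b_half"
  define X3 where "X3 = t_half ^ (m - 1) * a_half * c_half"
  define X4 where "X4 = t_half ^ (m - 1) * a_half * d_half"
  define Y where "Y = inverse (q_half ^ r)"
  define Z where "Z = al_half * (t_half ^ (m - 1)) ^ 2 * q_half ^ r"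
  have hm: "half_monomial X1" "half_monomial X2" "half_monomial X3" "half_monomial X4"
    "half_monomial Y" "half_monomial Z"
    unfolding X1_def X2_def X3_def X4_def Y_def Z_def al_half_def by (intro half_monomial_intros)+
  have Tm: "t_half * t_half ^ (m - 1) = t_half ^ m" using assms by (cases m) (simp_all only: power_Suc diff_Suc_1)
  have e1: "par_t ^ m = X1 ^ 2"
    unfolding X1_def Tm par_t_def by (simp only: power_mult[symmetric] mult.commute)
  have e2: "par_t ^ (m - 1) * par_a * par_b = X2 ^ 2" "par_t ^ (m - 1) * par_a * par_c = X3 ^ 2"
    "par_t ^ (m - 1) * par_a * par_d = X4 ^ 2"
    unfolding X2_def X3_def X4_def par_t_def par_a_def par_b_def par_c_def par_d_def
    by (simp_all only: power_mult_distrib power_mult[symmetric] mult.commute[of 2])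
  have e3: "par_q powi (- int r) = Y ^ 2"
    unfolding Y_def par_q_def power_int_minus power_int_of_nat
    by (simp only: power_inverse power_mult[symmetric] mult.commute[of 2])
  have pq: "par_q powi (int r - 1) = par_q ^ r * inverse par_q"
    unfolding power_int_diff[OF disjI1[OF par_nz(5)]] power_int_of_nat power_int_1_right divide_inverse ..
  have e4: "par_t ^ (2 * (m - 1)) * par_a * par_b * par_c * par_d * par_q powi (int r - 1) = Z ^ 2"
  proof -
    have "((t_half ^ (m - 1)) ^ 2) ^ 2 = par_t ^ (2 * (m - 1))"
      unfolding par_t_def by (simp only: power_mult[symmetric] mult.commute mult.left_commute)
    moreover have "(q_half ^ r) ^ 2 = par_q ^ r" unfolding par_q_def by (simp only: power_mult[symmetric] mult.commute)
    ultimately show ?thesis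
      unfolding Z_def power_mult_distrib al_half_power2 pq by (simp only: mult_ac)
  qed
  have n1: "par_q ^ k * X1 ^ 2 \<noteq> 1" for k
    unfolding e1[symmetric] using par_power_eqD[of 0 0 0 0 k m 0 0 0 0 0 0] assms
    by (simp only: power_0 mult_1_left mult_1_right) auto
  have n2: "par_q ^ k * X2 ^ 2 \<noteq> 1" for k
    unfolding e2[symmetric] using par_power_eqD[of 1 1 0 0 k "m - 1" 0 0 0 0 0 0]
    by (simp only: power_0 power_one_right mult_1_left mult_1_right mult_ac) auto
  have n3: "par_q ^ k * X3 ^ 2 \<noteq> 1" for k
    unfolding e2[symmetric] using par_power_eqD[of 1 0 1 0 k "m - 1" 0 0 0 0 0 0]
    by (simp only: power_0 power_one_right mult_1_left mult_1_right mult_ac) auto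
  have n4: "par_q ^ k * X4 ^ 2 \<noteq> 1" for k
    unfolding e2[symmetric] using par_power_eqD[of 1 0 0 1 k "m - 1" 0 0 0 0 0 0]
    by (simp only: power_0 power_one_right mult_1_left mult_1_right mult_ac) auto
  have n5: "par_q ^ k * Z ^ 2 \<noteq> 1" for k
  proof
    assume "par_q ^ k * Z ^ 2 = 1"
    hence "par_q * (par_q ^ k * Z ^ 2) = par_q" by (simp only: mult_1_right)
    hence "par_a * par_b * par_c * par_d * (par_q ^ k * par_q ^ r) * par_t ^ (2 * (m - 1)) * (par_q * inverse par_q) = par_q"
      unfolding e4[symmetric] pq by (simp only: mult_ac)
    hence "par_a ^ 1 * par_b ^ 1 * par_c ^ 1 * par_d ^ 1 * par_q ^ (k + r) * par_t ^ (2 * (m - 1)) =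
        par_a ^ 0 * par_b ^ 0 * par_c ^ 0 * par_d ^ 0 * par_q ^ 1 * par_t ^ 0"
      by (simp only: right_inverse[OF par_nz(5)] power_one_right power_0 mult_1_right mult_1_left power_add)
    from par_power_eqD[OF this] show False by simp
  qed
  have n6: "par_q ^ k * q_half ^ 2 \<noteq> 1" for k
    unfolding par_q_def[symmetric] power_Suc2[symmetric] by (rule par_q_power_neq_1) simp
  have n7: "par_q ^ k * t_half ^ 2 \<noteq> 1" for k
    unfolding par_t_def[symmetric] using par_power_eqD[of 0 0 0 0 k 1 0 0 0 0 0 0]
    by (simp only: power_0 power_one_right mult_1_left mult_1_right) auto
  define D where "D l = (\<Prod>k<l. bracket X1 k) * (\<Prod>k<l. bracket X2 k) * (\<Prod>k<l. bracket X3 k) * (\<Prod>k<l. bracket X4 k)" for l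
  define E where "E l = (\<Prod>k<l. bracket Y k) * (\<Prod>k<l. bracket Z k)" for l
  define Bq where "Bq = (\<Prod>k<r. bracket q_half k)"
  define Bt where "Bt = (\<Prod>k<r. bracket t_half k)"
  define BZ where "BZ = (\<Prod>k<r. bracket Z k)"
  define \<kappa> where "\<kappa> l = (-1) ^ l * E l / D l" for l
  define S where "S = (\<Sum>l=0..r. lconst (\<kappa> l) * H_fun m l)"
  have prod_nz: "(\<Prod>k<l. bracket x k) \<noteq> 0" if "half_monomial x" "\<And>k. par_q ^ k * x ^ 2 \<noteq> 1" for x l
    by (subst prod_zero_iff[OF finite_lessThan]) (use bracket_nz[OF that] in blast)
  have D0: "D l \<noteq> 0" for l
    unfolding D_def using prod_nz[OF hm(1) n1] prod_nz[OF hm(2) n2] prod_nz[OF hm(3) n3] prod_nz[OF hm(4) n4]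
    by (simp only: mult_eq_0_iff simp_thms)
  have B0: "Bq \<noteq> 0" "Bt \<noteq> 0" "BZ \<noteq> 0"
    unfolding Bq_def Bt_def BZ_def
    using prod_nz[OF half_monomial_half(5) n6] prod_nz[OF half_monomial_half(6) n7] prod_nz[OF hm(6) n5] by blast+
  have Dfold: "ang_facts [par_t ^ m, par_t ^ (m - 1) * par_a * par_b,
     par_t ^ (m - 1) * par_a * par_c, par_t ^ (m - 1) * par_a * par_d] l = D l" for l
    unfolding ang_facts_4 e1 e2 D_def ang_fact_bracket[OF hm(1)] ang_fact_bracket[OF hm(2)]
      ang_fact_bracket[OF hm(3)] ang_fact_bracket[OF hm(4)] ..
  have Efold: "ang_facts [par_q powi (- int r), par_t ^ (2 * (m - 1)) * par_a * par_b * par_c * par_d *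
      par_q powi (int r - 1)] l = E l" for l
    unfolding ang_facts_2 e4 e3 E_def ang_fact_bracket[OF hm(5)] ang_fact_bracket[OF hm(6)] ..
  have q_fold: "ang_fact par_q r = Bq" and t_fold: "ang_fact par_t r = Bt"
    unfolding par_q_def par_t_def Bq_def Bt_def
    by (rule ang_fact_bracket[OF half_monomial_half(5)], rule ang_fact_bracket[OF half_monomial_half(6)])
  have qZ: "ang_facts [par_q, par_t ^ (2 * (m - 1)) * par_a * par_b * par_c * par_d * par_q powi (int r - 1)] r = Bq * BZ"
    unfolding ang_facts_2 e4 q_fold BZ_def ang_fact_bracket[OF hm(6)] ..
  have step: "\<kappa> (Suc l) * (q_half / t_half) * raise_par m l = \<kappa> l * (eigen_par m r - eigen_par m l)" for l
  proof -
    have "\<kappa> (Suc l) = \<kappa> l * (- (bracket Y l * bracket Z l) / (bracket X1 l * bracket X2 l * bracket X3 l * bracket X4 l))"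
      unfolding \<kappa>_def E_def D_def prod.lessThan_Suc power_Suc
      by (simp only: divide_inverse inverse_mult_distrib mult_minus_left mult_minus_right mult_1_left mult_ac)
    moreover have "- (bracket Y l * bracket Z l) / (bracket X1 l * bracket X2 l * bracket X3 l * bracket X4 l) *
        (q_half / t_half) * raise_par m l = eigen_par m r - eigen_par m l"
    proof -
      have qq: "par_q ^ k = (q_half ^ k) ^ 2" for k unfolding par_q_def by (simp only: power_mult[symmetric] mult.commute)
      have nz: "q_half ^ k \<noteq> 0" "t_half ^ k \<noteq> 0" for k by (simp_all only: power_eq_0_iff half_nz simp_thms)
      have d: "1 - (q_half ^ l) ^ 2 * x ^ 2 \<noteq> 0" if "par_q ^ l * x ^ 2 \<noteq> 1" for x
        using that unfolding qq by (simp only: right_minus_eq eq_commute not_False_eq_True)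
      show ?thesis
        unfolding bracket_def raise_par_def node_par_def eigen_par_def e1 qq
        unfolding X1_def X2_def X3_def X4_def Y_def Z_def par_a_def par_b_def par_c_def par_d_def par_t_def
          par_q_def al_half_def divide_inverse[of "a_half * b_half * c_half * d_half" q_half, symmetric]
        by (rule coefficient_recurrence[OF half_nz nz(2) nz(1) nz(1) d[OF n1, unfolded X1_def] d[OF n2, unfolded X2_def]
              d[OF n3, unfolded X3_def] d[OF n4, unfolded X4_def]])
    qed
    ultimately show ?thesis by (simp only: mult.assoc)
  qed
  have eig: "koorn_op m S = fconst (eigen_par m r / (al_half * par_t ^ (m - 1))) * to_fract S"
    unfolding S_def by (rule H_expansion_eigenfunction[OF assms step])
  define R where "R = D r / (Bq * BZ)"
  define N where "N = Bt / Bq"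
  have N0: "N \<noteq> 0" unfolding N_def using B0 by (simp only: divide_eq_0_iff simp_thms)
  \<comment> \<open>\<open>N\<close> is the leading coefficient of \<open>H\<^sub>r\<close>, \<open>R\<close> the prefactor on the right-hand side of the theorem; \<open>P\<close> will be
  the Koornwinder polynomial\<close>
  define P where "P = lconst (R / N) * S"
  have lead: "lk P (row r) = 1"
  proof -
    obtain m' where m': "m = Suc m'" using assms by (cases m) auto
    have "lk S (row r) = (\<Sum>l=0..r. \<kappa> l * lk (H_fun m l) (row r))"
      unfolding S_def by (simp only: lookup_sum lookup_lconst_mult)
    also have "\<dots> = (\<Sum>l\<in>{r}. \<kappa> l * lk (H_fun m l) (row r))"
    proof (rule sum.mono_neutral_right)
      show "\<forall>l\<in>{0..r} - {r}. \<kappa> l * lk (H_fun m l) (row r) = 0"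
      proof
        fix l assume "l \<in> {0..r} - {r}"
        hence "l < r" by auto
        thus "\<kappa> l * lk (H_fun m l) (row r) = 0" by (simp only: H_fun_row_eq_0[OF assms] mult_zero_right)
      qed
    qed simp_all
    also have "\<dots> = \<kappa> r * lk (H_fun m r) (row r)"
      by (simp only: sum.insert[OF finite.emptyI empty_iff[THEN iffD1, THEN notI]] sum.empty add_0_right)
    also have "lk (H_fun m r) (row r) = N" unfolding m' H_fun_leading_coeff q_fold t_fold N_def ..
    finally have lS: "lk S (row r) = \<kappa> r * N" .
    \<comment> \<open>\<open>(-1)\<^sup>r \<langle>q\<^bsup>-r\<^esup>\<rangle>\<^bsub>q,r\<^esub> = \<langle>q\<rangle>\<^bsub>q,r\<^esub>\<close>; hence the top coefficient of the sum is the inverse of \<open>R\<close>\<close>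
    have flip: "(-1) ^ r * (\<Prod>k<r. bracket Y k) = Bq"
    proof -
      have "(-1) ^ r * (\<Prod>k<r. bracket Y k) = (\<Prod>k<r. - 1 * bracket Y k)"
        by (simp only: prod.distrib prod_constant card_lessThan)
      also have "\<dots> = (\<Prod>k<r. bracket q_half (r - Suc k))"
      proof (rule prod.cong[OF refl])
        fix k assume "k \<in> {..<r}"
        hence k: "r = k + Suc (r - Suc k)" by simp
        define n where "n = Suc (r - Suc k)"
        have qk: "q_half ^ r = q_half ^ k * q_half ^ n" unfolding n_def power_add[symmetric] k[symmetric] ..
        have qq: "par_q ^ k = (q_half ^ k) ^ 2" unfolding par_q_def by (simp only: power_mult[symmetric] mult.commute)
        have qn: "par_q ^ (r - Suc k) * q_half ^ 2 = (q_half ^ n) ^ 2" "q_half ^ (r - Suc k) * q_half = q_half ^ n"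
          unfolding par_q_def n_def power_Suc2 power_mult_distrib by (simp_all only: power_mult[symmetric] mult.commute)
        have nz: "q_half ^ k \<noteq> 0" "q_half ^ n \<noteq> 0" by (simp_all only: power_eq_0_iff half_nz simp_thms)
        show "- 1 * bracket Y k = bracket q_half (r - Suc k)"
          unfolding bracket_def Y_def qk qq qn by (rule bracket_reflection[OF nz])
      qed
      also have "\<dots> = Bq" unfolding Bq_def by (rule prod.nat_diff_reindex)
      finally show ?thesis .
    qed
    have "\<kappa> r = Bq * BZ / D r" unfolding \<kappa>_def E_def mult.assoc[symmetric] flip BZ_def ..
    hence "R * \<kappa> r = 1"
      unfolding R_def using D0[of r] B0 by (simp only: times_divide_times_eq mult.commute) (simp only: divide_self mult_eq_0_iff simp_thms not_False_eq_True)
    moreover have "R / N * (\<kappa> r * N) = R * \<kappa> r"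
      using N0 by (simp only: times_divide_eq_left mult.assoc[symmetric] nonzero_mult_div_cancel_right simp_thms not_False_eq_True)
    ultimately show ?thesis unfolding P_def lookup_lconst_mult lS by (simp only:)
  qed
  have supp: "supported m r P"
  proof -
    have "supported m (0 + r) P"
      unfolding P_def S_def
    proof (intro supported_mult supported_lconst supported_sum)
      fix l assume "l \<in> {0..r}"
      hence l: "l \<le> r" by simp
      have "supported m (0 + l) (lconst (\<kappa> l) * H_fun m l)"
        by (intro supported_mult supported_lconst supported_H_fun order_refl)
      from supported_mono[OF this[unfolded add_0_left] l] show "supported m r (lconst (\<kappa> l) * H_fun m l)" .
    qed
    thus ?thesis unfolding add_0_left .
  qed
  have inv: "weyl_invariant m P"
    unfolding weyl_invariant_def
  proof
    fix w assume w: "w \<in> weyl m"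
    interpret W: laurent_eval "\<lambda>P. to_fract (weyl_act w P)" by (rule laurent_eval_weyl_act[OF w])
    have "to_fract (weyl_act w P) = to_fract P"
      unfolding P_def S_def W.mult W.sum W.const weyl_act_H_fun[OF w] to_fract_mult to_fract_sum fconst_def ..
    thus "weyl_act w P = P" by (simp only: to_fract_eq_iff)
  qed
  have "is_koornwinder m (row r) P"
    unfolding is_koornwinder_def
  proof (intro conjI)
    show "laurent_in m P"
      unfolding laurent_in_def using supported_keysD[OF supp] by blast
    show "weyl_invariant m P" by (rule inv)
    show "\<exists>cf. P = orbit_sum m (row r) + (\<Sum>\<mu>\<in>below m (row r). lconst (cf \<mu>) * orbit_sum m \<mu>)"
      by (rule orbit_sum_expansion[OF assms inv supp lead])
    have "koorn_op m P = fconst (eigen_par m r / (al_half * par_t ^ (m - 1))) * to_fract P"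
      unfolding P_def koorn_op_lconst_mult eig to_fract_mult fconst_def by (rule mult.left_commute)
    thus "\<exists>ev. koorn_op m P = fconst ev * to_fract P" by (rule exI)
  qed
  hence "koornwinder m (row r) = P"
    unfolding koornwinder_def by (intro the_equality koornwinder_unique[OF assms])
  moreover have "lconst N * (lconst (R / N) * S) = lconst R * S"
  proof -
    have "N * (R / N) = R" using N0 by (simp only: times_divide_eq_right nonzero_mult_div_cancel_left not_False_eq_True simp_thms)
    hence "lconst N * lconst (R / N) = lconst R" by (simp only: lconst_def mult_single add_0_left)
    thus ?thesis by (simp only: mult.assoc[symmetric])
  qed
  ultimately have "lconst N * koornwinder m (row r) = lconst R * S" unfolding P_def by (simp only:)
  thus ?thesis unfolding Dfold Efold qZ q_fold t_fold N_def R_def S_def \<kappa>_def .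
qed

end
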